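(* Let $G$ be a countably infinite cograph such that $G$ is connected and its complement $G^c$ is connected. Then there are $2^{\aleph_0}$ pairwise non-isomorphic graphs $G'$ that are equimorphic to $G$ and such that $G'$ and its complement are both connected.
   Context: Graphs are undirected and loopless; a cograph is a graph with no induced subgraph isomorphic to the path $P_4$ on four vertices. $G$ embeds into $G'$ if $G$ is isomorphic to an induced subgraph of $G'$; $G,G'$ are equimorphic if each embeds into the other. *)

theory Defs
  imports "HOL-Library.Countable_Set"
begin

definition is_graph :: "'a set \<Rightarrow> ('a \<Rightarrow> 'a \<Rightarrow> bool) \<Rightarrow> bool" where
  "is_graph V E \<longleftrightarrow> (\<forall>x y. E x y \<longrightarrow> x \<in> V \<and> y \<in> V \<and> x \<noteq> y \<and> E y x)"

definition compl_graph :: "'a set \<Rightarrow> ('a \<Rightarrow> 'a \<Rightarrow> bool) \<Rightarrow> 'a \<Rightarrow> 'a \<Rightarrow> bool" where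
  "compl_graph V E x y \<longleftrightarrow> x \<in> V \<and> y \<in> V \<and> x \<noteq> y \<and> \<not> E x y"

definition graph_connected :: "'a set \<Rightarrow> ('a \<Rightarrow> 'a \<Rightarrow> bool) \<Rightarrow> bool" where
  "graph_connected V E \<longleftrightarrow> V \<noteq> {} \<and> (\<forall>x\<in>V. \<forall>y\<in>V. E\<^sup>*\<^sup>* x y)"

definition cograph :: "'a set \<Rightarrow> ('a \<Rightarrow> 'a \<Rightarrow> bool) \<Rightarrow> bool" where
  "cograph V E \<longleftrightarrow> \<not> (\<exists>a\<in>V. \<exists>b\<in>V. \<exists>c\<in>V. \<exists>d\<in>V.
      distinct [a, b, c, d] \<and> E a b \<and> E b c \<and> E c d \<and>
      \<not> E a c \<and> \<not> E b d \<and> \<not> E a d)"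

definition graph_iso :: "'a set \<Rightarrow> ('a \<Rightarrow> 'a \<Rightarrow> bool) \<Rightarrow> 'b set \<Rightarrow> ('b \<Rightarrow> 'b \<Rightarrow> bool) \<Rightarrow> bool" where
  "graph_iso V E V' E' \<longleftrightarrow> (\<exists>f. bij_betw f V V' \<and> (\<forall>x\<in>V. \<forall>y\<in>V. E x y \<longleftrightarrow> E' (f x) (f y)))"

definition embeds :: "'a set \<Rightarrow> ('a \<Rightarrow> 'a \<Rightarrow> bool) \<Rightarrow> 'b set \<Rightarrow> ('b \<Rightarrow> 'b \<Rightarrow> bool) \<Rightarrow> bool" where
  "embeds V E V' E' \<longleftrightarrow> (\<exists>f. inj_on f V \<and> f ` V \<subseteq> V' \<and> (\<forall>x\<in>V. \<forall>y\<in>V. E x y \<longleftrightarrow> E' (f x) (f y)))"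

definition equimorphic :: "'a set \<Rightarrow> ('a \<Rightarrow> 'a \<Rightarrow> bool) \<Rightarrow> 'b set \<Rightarrow> ('b \<Rightarrow> 'b \<Rightarrow> bool) \<Rightarrow> bool" where
  "equimorphic V E V' E' \<longleftrightarrow> embeds V E V' E' \<and> embeds V' E' V E"

end

theory Submission
  imports Defs
begin

text \<open>
  Fix a vertex \<open>x\<close>.  Adjacency to \<open>x\<close> colours the other vertices, and they are arranged in a chain of
  classes, each of one colour: two vertices \<open>u\<close> before \<open>v\<close> are joined iff \<open>x\<close> and \<open>v\<close> are.  Since the graph
  and its complement are connected, the chain has no last class and both colours are cofinal in it.

  The final segments of such chains, taken with their colouring, are well-quasi-ordered by embeddability.
  To see this, countable cographs are described, up to mutual embeddability, by well-founded terms, and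
  Nash-Williams' minimal bad array argument shows that the terms are better-quasi-ordered.  A description
  exists because a set without one could be chosen such that all its undescribed subsets have the same
  contexts, and then it is the fixed point of these contexts.

  Hence some final segment \<open>T\<close> embeds into every later one, which leaves room to insert new classes into the
  chain without leaving the equimorphy class.  An infinite run of new classes, of sizes one and two, codes
  a set \<open>A\<close> of natural numbers; the run is placed before \<open>T\<close> if the chain of \<open>T\<close> has infinitely many classes
  below some vertex, and is interleaved with the classes of \<open>T\<close> otherwise.  A countable graph has only
  countably many vertices at which a code can be read, so each isomorphism class contains countably many of the
  \<open>2\<^sup>\<aleph>\<^sup>0\<close> graphs obtained.
\<close>

section \<open>Better-quasi-orders\<close>

text \<open>Well-quasi-orders are too weak for the induction: chains are compared through sets of
  contexts, and ordering sets by domination does not preserve well-quasi-orders. Terms refer to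
  themselves because splitting a chain at a class need not terminate: on both sides of a class of a
  dense chain the same chain may occur again, and a class may resemble the whole graph.
  \<open>None\<close> is this reference, read as a greatest fixed point, while proper subterms are
  well-founded and provide the rank for the minimal bad array. A term does not fix a graph up to
  isomorphism; it bounds it from above and from below, which is what a comparison needs.
  Countability turns a never-ending matching of splittings into an embedding.

  A code must be readable without knowing which vertices were inserted. Vertices are compared only
  when their colours differ, because then the order is visible on the root and the two vertices. So
  runs alternate colours, and in the interleaved case two classes, not one, follow each class of
  \<open>T\<close>: this keeps the alternation.\<close>

text \<open>Better-quasi-orders are defined by arrays on the infinite subsets of an infinite set; \<open>cont A f\<close> says
  that \<open>f\<close> is continuous for the discrete topology on its values.\<close>

definition isub :: "nat set \<Rightarrow> nat set \<Rightarrow> bool" where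
  "isub X A \<longleftrightarrow> X \<subseteq> A \<and> infinite X"

definition shift :: "nat set \<Rightarrow> nat set" where
  "shift X = X - {LEAST n. n \<in> X}"

definition cont :: "nat set \<Rightarrow> (nat set \<Rightarrow> 'q) \<Rightarrow> bool" where
  "cont A f \<longleftrightarrow> (\<forall>X. isub X A \<longrightarrow>
     (\<exists>n. \<forall>Y. isub Y A \<longrightarrow> Y \<inter> {..<n} = X \<inter> {..<n} \<longrightarrow> f Y = f X))"

definition bad :: "('q \<Rightarrow> 'q \<Rightarrow> bool) \<Rightarrow> nat set \<Rightarrow> (nat set \<Rightarrow> 'q) \<Rightarrow> bool" where
  "bad le A f \<longleftrightarrow> (\<forall>X. isub X A \<longrightarrow> \<not> le (f X) (f (shift X)))"

definition bqo :: "('q \<Rightarrow> 'q \<Rightarrow> bool) \<Rightarrow> bool" where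
  "bqo le \<longleftrightarrow> (\<forall>A f. infinite A \<longrightarrow> cont A f \<longrightarrow> \<not> bad le A f)"

lemma isub_trans: "isub X B \<Longrightarrow> isub B A \<Longrightarrow> isub X A"
  by (auto simp: isub_def)

lemma isub_mono: "isub X B \<Longrightarrow> B \<subseteq> A \<Longrightarrow> isub X A"
  by (auto simp: isub_def)

lemma Least_mem_inf: "infinite (X :: nat set) \<Longrightarrow> (LEAST n. n \<in> X) \<in> X"
  by (metis LeastI finite.emptyI ex_in_conv)

lemma isub_shift: "isub X A \<Longrightarrow> isub (shift X) A"
  by (auto simp: isub_def shift_def)

lemma shift_subset: "shift X \<subseteq> X"
  by (auto simp: shift_def)

lemma cont_subset: "cont A f \<Longrightarrow> B \<subseteq> A \<Longrightarrow> cont B f"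
  unfolding cont_def by (meson isub_mono)

lemma bad_subset: "bad le A f \<Longrightarrow> B \<subseteq> A \<Longrightarrow> bad le B f"
  unfolding bad_def by (meson isub_mono)

lemma cont_map: "cont A f \<Longrightarrow> cont A (\<lambda>X. g (f X))"
  unfolding cont_def by metis

lemma agree_le:
  assumes "Y \<inter> {..<n} = X \<inter> {..<n}" "m \<le> (n :: nat)"
  shows "Y \<inter> {..<m} = X \<inter> {..<m}"
proof -
  have "{..<m} = {..<n} \<inter> {..<m}" using assms(2) by auto
  then show ?thesis using assms(1) by (metis Int_assoc)
qed

lemma cont_Pair:
  assumes "cont A f" "cont A g"
  shows "cont A (\<lambda>X. (f X, g X))"
  unfolding cont_def
proof (intro allI impI)
  fix X assume X: "isub X A"
  obtain n where n: "\<And>Y. isub Y A \<Longrightarrow> Y \<inter> {..<n} = X \<inter> {..<n} \<Longrightarrow> f Y = f X"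
    using assms(1) X unfolding cont_def by metis
  obtain m where m: "\<And>Y. isub Y A \<Longrightarrow> Y \<inter> {..<m} = X \<inter> {..<m} \<Longrightarrow> g Y = g X"
    using assms(2) X unfolding cont_def by metis
  have "f Y = f X \<and> g Y = g X" if "isub Y A" "Y \<inter> {..<max n m} = X \<inter> {..<max n m}" for Y
    using n[OF that(1) agree_le[OF that(2)]] m[OF that(1) agree_le[OF that(2)]] by simp
  then show "\<exists>k. \<forall>Y. isub Y A \<longrightarrow> Y \<inter> {..<k} = X \<inter> {..<k} \<longrightarrow> (f Y, g Y) = (f X, g X)"
    by (metis (no_types))
qed

lemma shift_agree:
  assumes X: "infinite X" and Y: "infinite Y"
    and n: "(LEAST n. n \<in> X) < n"
    and eq: "Y \<inter> {..<n} = X \<inter> {..<n}"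
  shows "shift Y \<inter> {..<n} = shift X \<inter> {..<n}"
proof -
  let ?x = "LEAST n. n \<in> X"
  have x: "?x \<in> Y" using Least_mem_inf[OF X] n eq by auto
  have "?x \<le> y" if "y \<in> Y" for y
  proof (rule ccontr)
    assume "\<not> ?x \<le> y"
    then have "y \<in> Y \<inter> {..<n}" using n that by simp
    then have "y \<in> X" unfolding eq by blast
    then show False using \<open>\<not> ?x \<le> y\<close> by (simp add: Least_le)
  qed
  then have "(LEAST n. n \<in> Y) = ?x" using x by (intro Least_equality)
  then show ?thesis using eq by (auto simp: shift_def)
qed

lemma cont_shift:
  assumes "cont A f"
  shows "cont A (\<lambda>X. f (shift X))"
  unfolding cont_def
proof (intro allI impI)
  fix X assume X: "isub X A"
  obtain n where n: "\<And>Y. isub Y A \<Longrightarrow> Y \<inter> {..<n} = shift X \<inter> {..<n} \<Longrightarrow> f Y = f (shift X)"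
    using assms isub_shift[OF X] unfolding cont_def by metis
  \<comment> \<open>The segment has to contain the least element of \<open>X\<close>: then
    \<open>Y\<close> has the same least element and \<open>shift\<close> removes the same point from
    both.\<close>
  define m where "m = max n (Suc (LEAST n. n \<in> X))"
  have "f (shift Y) = f (shift X)" if Y: "isub Y A" "Y \<inter> {..<m} = X \<inter> {..<m}" for Y
  proof (rule n[OF isub_shift[OF Y(1)]])
    have "shift Y \<inter> {..<m} = shift X \<inter> {..<m}"
      by (rule shift_agree) (use X Y in \<open>auto simp: isub_def m_def\<close>)
    then have "shift Y \<inter> {..<m} \<inter> {..<n} = shift X \<inter> {..<m} \<inter> {..<n}" by simp
    moreover have "{..<m} \<inter> {..<n} = {..<n}" by (auto simp: m_def)
    ultimately show "shift Y \<inter> {..<n} = shift X \<inter> {..<n}" by (simp add: Int_assoc)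
  qed
  then show "\<exists>n. \<forall>Y. isub Y A \<longrightarrow> Y \<inter> {..<n} = X \<inter> {..<n} \<longrightarrow> f (shift Y) = f (shift X)"
    by blast
qed

text \<open>Nash-Williams' partition argument. A stem \<open>s\<close> is good if every infinite set
  beyond it shrinks to one whose infinite subsets, prefixed by \<open>s\<close>, have a single
  colour. A stem that is not good has a longer one that is not good, and an infinite sequence of
  such stems contradicts continuity at its union.\<close>

lemma clopen_ramsey:
  fixes c :: "nat set \<Rightarrow> 'c"
  assumes A: "infinite A" and c: "cont A c" and F: "finite F" "\<And>X. isub X A \<Longrightarrow> c X \<in> F"
  shows "\<exists>B i. isub B A \<and> (\<forall>X. isub X B \<longrightarrow> c X = i)"
proof -
  define good where "good s \<longleftrightarrow> (\<forall>A'. isub A' A \<and> (\<forall>a\<in>A'. \<forall>b\<in>s. b < a) \<longrightarrow>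
      (\<exists>B i. isub B A' \<and> (\<forall>Y. isub Y B \<longrightarrow> c (s \<union> Y) = i)))" for s
  have step: "\<exists>e\<in>A. (\<forall>b\<in>s. b < e) \<and> \<not> good (insert e s)" if s: "s \<subseteq> A" "\<not> good s" for s
  proof (rule ccontr)
    assume "\<not> ?thesis"
    then have gd: "good (insert e s)" if "e \<in> A" "\<forall>b\<in>s. b < e" for e using that by auto
    have "good s"
      unfolding good_def
    proof (intro allI impI)
      fix A' assume A': "isub A' A \<and> (\<forall>a\<in>A'. \<forall>b\<in>s. b < a)"
      define mn where "mn B = (LEAST n::nat. n \<in> B)" for B
      \<comment> \<open>Fusion: passing from \<open>B\<close> to \<open>B'\<close> settles the
        colour of all sets that continue \<open>s\<close> by the minimum of
        \<open>B\<close>.\<close>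
      define Q where "Q B B' \<longleftrightarrow> isub B' (B \<inter> {mn B<..}) \<and>
         (\<exists>i. \<forall>Y. isub Y B' \<longrightarrow> c (insert (mn B) s \<union> Y) = i)" for B B'
      have ex: "\<exists>B'. isub B' A' \<and> Q B B'" if B: "isub B A'" for B
      proof -
        have "mn B \<in> B" unfolding mn_def using B by (intro Least_mem_inf) (auto simp: isub_def)
        then have g: "good (insert (mn B) s)" using A' B by (intro gd) (auto simp: isub_def)
        have "infinite (B - {..mn B})" using B by (auto simp: isub_def)
        moreover have "B - {..mn B} = B \<inter> {mn B<..}" by auto
        ultimately have inf: "infinite (B \<inter> {mn B<..})" by simp
        then have "isub (B \<inter> {mn B<..}) A \<and> (\<forall>a\<in>B \<inter> {mn B<..}. \<forall>b\<in>insert (mn B) s. b < a)"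
          using A' B by (auto simp: isub_def)
        then obtain B' i where "isub B' (B \<inter> {mn B<..})"
            "\<forall>Y. isub Y B' \<longrightarrow> c (insert (mn B) s \<union> Y) = i"
          using g unfolding good_def by meson
        then show ?thesis unfolding Q_def using B by (auto simp: isub_def)
      qed
      have "\<exists>Bs. \<forall>n. isub (Bs n) A' \<and> Q (Bs n) (Bs (Suc n))"
        by (rule dependent_nat_choice) (use A' ex in \<open>auto simp: isub_def\<close>)
      then obtain Bs where Bs: "\<And>n. isub (Bs n) A'" "\<And>n. Q (Bs n) (Bs (Suc n))" by auto
      define e where "e n = mn (Bs n)" for n
      have eB: "e n \<in> Bs n" for n
        unfolding e_def mn_def using Bs(1) by (intro Least_mem_inf) (auto simp: isub_def)
      have dec: "Bs m \<subseteq> Bs n" if "n \<le> m" for n m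
        using that by (rule lift_Suc_antimono_le[rotated]) (use Bs(2) in \<open>auto simp: Q_def isub_def\<close>)
      have lt: "e n < e (Suc n)" for n
        using eB[of "Suc n"] Bs(2)[of n] by (auto simp: Q_def isub_def e_def)
      then have sm: "strict_mono e" by (rule strict_mono_Suc_iff[THEN iffD2, rule_format])
      have "\<forall>n. \<exists>i. \<forall>Y. isub Y (Bs (Suc n)) \<longrightarrow> c (insert (e n) s \<union> Y) = i"
        using Bs(2) unfolding Q_def e_def by blast
      then obtain i where i: "\<And>n Y. isub Y (Bs (Suc n)) \<Longrightarrow> c (insert (e n) s \<union> Y) = i n"
        by metis
      have iF: "i n \<in> F" for n
      proof -
        have "isub (Bs (Suc n)) (Bs (Suc n))" using Bs(1) by (auto simp: isub_def)
        then have "c (insert (e n) s \<union> Bs (Suc n)) = i n" by (rule i)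
        moreover have "isub (insert (e n) s \<union> Bs (Suc n)) A"
          using A' Bs(1)[of n] Bs(1)[of "Suc n"] eB[of n] s by (auto simp: isub_def)
        ultimately show ?thesis using F(2) by metis
      qed
      have "finite (i ` UNIV)" using iF F(1) by (auto intro: finite_subset)
      \<comment> \<open>The colour still depends on which \<open>e n\<close> comes first, so only
        indices with one and the same colour are kept.\<close>
      then obtain n0 where "infinite {n. i n = i n0}"
        using pigeonhole_infinite[of "UNIV :: nat set" i] by auto
      then have inf: "infinite (e ` {n. i n = i n0})"
        using sm by (simp add: finite_image_iff strict_mono_imp_inj_on inj_on_subset)
      let ?B = "e ` {n. i n = i n0}"
      have "isub ?B A'" using inf eB Bs(1) by (auto simp: isub_def)
      moreover have "c (s \<union> Y) = i n0" if Y: "isub Y ?B" for Y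
      proof -
        have "(LEAST n. n \<in> Y) \<in> Y" using Y by (intro Least_mem_inf) (auto simp: isub_def)
        then obtain n where n: "e n = (LEAST n. n \<in> Y)" "i n = i n0" "e n \<in> Y"
          using Y by (auto simp: isub_def)
        have "Y - {e n} \<subseteq> Bs (Suc n)"
        proof
          fix y assume y: "y \<in> Y - {e n}"
          then obtain m where m: "y = e m" using Y by (auto simp: isub_def)
          have "e n \<le> y" using y n(1) by (simp add: Least_le)
          then have "e n < e m" using y m by auto
          then have "n < m" using sm by (simp add: strict_mono_less)
          then show "y \<in> Bs (Suc n)" using dec[of "Suc n" m] eB m by auto
        qed
        then have "isub (Y - {e n}) (Bs (Suc n))" using Y by (auto simp: isub_def)
        then have "c (insert (e n) s \<union> (Y - {e n})) = i n" by (rule i)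
        moreover have "insert (e n) s \<union> (Y - {e n}) = s \<union> Y" using n(3) by auto
        ultimately show ?thesis using n(2) by simp
      qed
      ultimately show "\<exists>B i. isub B A' \<and> (\<forall>Y. isub Y B \<longrightarrow> c (s \<union> Y) = i)" by blast
    qed
    then show False using s by simp
  qed
  have "good {}"
  proof (rule ccontr)
    assume ng: "\<not> good {}"
    have "\<exists>s'. (s' \<subseteq> A \<and> \<not> good s') \<and> (\<exists>e\<in>A. (\<forall>b\<in>s. b < e) \<and> s' = insert e s)"
      if "s \<subseteq> A \<and> \<not> good s" for s
      using step[of s] that by (metis insert_subset)
    then have "\<exists>ss. \<forall>n. (ss n \<subseteq> A \<and> \<not> good (ss n)) \<and>
        (\<exists>e\<in>A. (\<forall>b\<in>ss n. b < e) \<and> ss (Suc n) = insert e (ss n))"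
      using ng by (intro dependent_nat_choice) auto
    then obtain ss where ss: "\<And>n. ss n \<subseteq> A" "\<And>n. \<not> good (ss n)"
      "\<And>n. \<exists>e\<in>A. (\<forall>b\<in>ss n. b < e) \<and> ss (Suc n) = insert e (ss n)" by blast
    then obtain e where e: "\<And>n. \<forall>b\<in>ss n. b < e n" "\<And>n. ss (Suc n) = insert (e n) (ss n)"
      by metis
    have lt: "e n < e (Suc n)" for n using e(1)[of "Suc n"] e(2)[of n] by auto
    then have sm: "strict_mono e" by (rule strict_mono_Suc_iff[THEN iffD2, rule_format])
    define X where "X = ss 0 \<union> range e"
    have ssn: "ss n = ss 0 \<union> e ` {..<n}" for n by (induction n) (auto simp: e(2) lessThan_Suc)
    have eA: "e n \<in> A" for n using ss(1)[of "Suc n"] e(2)[of n] by auto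
    have infe: "infinite (range e)" using sm by (simp add: finite_image_iff strict_mono_imp_inj_on)
    have X: "isub X A" using ss(1)[of 0] eA infe by (auto simp: X_def isub_def)
    obtain n where n: "\<And>Y. isub Y A \<Longrightarrow> Y \<inter> {..<n} = X \<inter> {..<n} \<Longrightarrow> c Y = c X"
      using c X unfolding cont_def by metis
    \<comment> \<open>Hence the stem \<open>ss (Suc n)\<close> contains all of \<open>X\<close>
      below \<open>n\<close>, and continuity at \<open>X\<close> makes this stem good.\<close>
    have nle: "n \<le> e n" using sm by (rule strict_mono_imp_increasing)
    have "good (ss (Suc n))"
      unfolding good_def
    proof (intro allI impI)
      fix A' assume A': "isub A' A \<and> (\<forall>a\<in>A'. \<forall>b\<in>ss (Suc n). b < a)"
      have big: "n < a" if "a \<in> A'" for a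
        using A' that nle e(2)[of n] by fastforce
      have "c (ss (Suc n) \<union> Y) = c X" if Y: "isub Y A'" for Y
      proof (rule n)
        show "isub (ss (Suc n) \<union> Y) A" using Y A' ss(1)[of "Suc n"] by (auto simp: isub_def)
        have ssS: "x \<in> ss (Suc n) \<longleftrightarrow> x \<in> ss 0 \<or> (\<exists>m\<le>n. x = e m)" for x
          unfolding ssn[of "Suc n"] by (auto simp: less_Suc_eq_le)
        have "x \<in> ss (Suc n)" if "x \<in> X" "x < n" for x
        proof (cases "x \<in> ss 0")
          case False
          then obtain m where m: "x = e m" using \<open>x \<in> X\<close> by (auto simp: X_def)
          then have "e m < e n" using \<open>x < n\<close> nle by simp
          then have "m < n" using sm by (simp add: strict_mono_less)
          then show ?thesis using m ssS by (metis less_imp_le)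
        next
          case True
          then show ?thesis using ssS by blast
        qed
        moreover have "x \<in> X" if "x \<in> ss (Suc n)" for x
          using that ssS unfolding X_def by blast
        moreover have "Y \<inter> {..<n} = {}" using Y big unfolding isub_def by (meson disjoint_iff lessThan_iff order_less_asym subsetD)
        ultimately show "(ss (Suc n) \<union> Y) \<inter> {..<n} = X \<inter> {..<n}"
          by (intro equalityI subsetI) blast+
      qed
      then show "\<exists>B i. isub B A' \<and> (\<forall>Y. isub Y B \<longrightarrow> c (ss (Suc n) \<union> Y) = i)"
        using A' by (auto simp: isub_def)
    qed
    then show False using ss(2) by blast
  qed
  then show ?thesis unfolding good_def using A by (auto simp: isub_def)
qed

section \<open>Minimal bad arrays\<close>

text \<open>Both applications take \<open>R\<close> to be the proper subterm relation, on words and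
  on graph terms.\<close>

locale ranked_qo =
  fixes le :: "'q \<Rightarrow> 'q \<Rightarrow> bool" and R :: "'q \<Rightarrow> 'q \<Rightarrow> bool"
  assumes le_trans: "le x y \<Longrightarrow> le y z \<Longrightarrow> le x z"
    and R_le: "R x y \<Longrightarrow> le x y"
    and R_trans: "R x y \<Longrightarrow> R y z \<Longrightarrow> R x z"
    and wf_R: "wfP R"
begin

definition barr :: "(nat set \<Rightarrow> 'q) \<Rightarrow> nat set \<Rightarrow> bool" where
  "barr f A \<longleftrightarrow> infinite A \<and> cont A f \<and> bad le A f"

definition ext :: "(nat set \<Rightarrow> 'q) \<Rightarrow> nat set \<Rightarrow> (nat set \<Rightarrow> 'q) \<Rightarrow> nat set \<Rightarrow> bool" where
  "ext g B f A \<longleftrightarrow> barr g B \<and> B \<subseteq> A \<and> (\<forall>X. isub X B \<longrightarrow> R (g X) (f X) \<or> g X = f X)"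

definition red :: "(nat set \<Rightarrow> 'q) \<Rightarrow> nat set \<Rightarrow> (nat set \<Rightarrow> 'q) \<Rightarrow> nat set \<Rightarrow> bool" where
  "red g B f A \<longleftrightarrow> barr g B \<and> B \<subseteq> A \<and> (\<forall>X. isub X B \<longrightarrow> R (g X) (f X))"

definition init :: "nat set \<Rightarrow> nat set \<Rightarrow> bool" where
  "init s B \<longleftrightarrow> s \<subseteq> B \<and> (\<forall>b\<in>B - s. \<forall>a\<in>s. a < b)"

text \<open>If every bad array below \<open>f\<close> can be reduced further, then the empty stem is hopeless.  Hopeless stems
  can be lengthened, and the limit stem is an infinite set on which the values descend forever.\<close>

definition alive :: "nat set \<Rightarrow> (nat set \<Rightarrow> 'q) \<Rightarrow> nat set \<Rightarrow> bool" where
  "alive s f A \<longleftrightarrow> (\<exists>h B. red h B f A \<and> init s B)"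

definition dn :: "nat set \<Rightarrow> nat set" where
  "dn s = {a. \<exists>b\<in>s. a \<le> b}"

text \<open>Points up to the stem must be kept even if they are outside it: in
  \<open>hopeless_step\<close> they include the points chosen earlier, which have to survive in the
  limit set.\<close>

definition hopeless :: "nat set \<Rightarrow> (nat set \<Rightarrow> 'q) \<Rightarrow> nat set \<Rightarrow> bool" where
  "hopeless s f A \<longleftrightarrow> barr f A \<and> finite s \<and> s \<subseteq> A \<and>
     (\<forall>g B. ext g B f A \<and> B \<inter> dn s = A \<inter> dn s \<longrightarrow> alive s g B)"

lemma finite_dn: "finite s \<Longrightarrow> finite (dn s)"
proof -
  assume "finite s"
  moreover have "dn s = (\<Union>b\<in>s. {..b})" by (auto simp: dn_def)
  ultimately show ?thesis by simp
qed

lemma subset_dn: "s \<subseteq> dn s"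
  by (auto simp: dn_def)

lemma barr_subset: "barr f A \<Longrightarrow> B \<subseteq> A \<Longrightarrow> infinite B \<Longrightarrow> barr f B"
  unfolding barr_def using cont_subset bad_subset by metis

lemma ext_refl: "barr f A \<Longrightarrow> ext f A f A"
  by (auto simp: ext_def)

lemma ext_trans: "ext h D g B \<Longrightarrow> ext g B f A \<Longrightarrow> ext h D f A"
  unfolding ext_def by (metis R_trans isub_mono subset_trans)

lemma red_ext: "red h D g B \<Longrightarrow> ext g B f A \<Longrightarrow> red h D f A"
  unfolding ext_def red_def by (metis R_trans isub_mono subset_trans)

lemma red_imp_ext: "red h D g B \<Longrightarrow> ext h D g B"
  unfolding ext_def red_def by blast

text \<open>Badness survives at the seam because \<open>R\<close> is contained in \<open>le\<close>:
  if \<open>shift X\<close> is a subset of \<open>B\<close> but \<open>X\<close> is not, then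
  \<open>f X\<close> below \<open>g (shift X)\<close> would put it below \<open>f (shift X)\<close>.
  Since \<open>F\<close> is finite, an initial segment decides whether a set is a subset of
  \<open>B\<close>; this gives continuity.\<close>

lemma mix:
  assumes f: "barr f A" and g: "ext g B f A" and F: "finite F" "F \<subseteq> A"
  shows "ext (\<lambda>X. if X \<subseteq> B then g X else f X) (F \<union> B) f A"
proof -
  let ?h = "\<lambda>X. if X \<subseteq> B then g X else f X"
  have B: "infinite B" "cont B g" "bad le B g" "B \<subseteq> A"
    and gf: "\<And>X. isub X B \<Longrightarrow> R (g X) (f X) \<or> g X = f X"
    using g by (auto simp: ext_def barr_def)
  have sub: "F \<union> B \<subseteq> A" using F B by auto
  have "cont (F \<union> B) ?h"
    unfolding cont_def
  proof (intro allI impI)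
    fix X assume X: "isub X (F \<union> B)"
    show "\<exists>n. \<forall>Y. isub Y (F \<union> B) \<longrightarrow> Y \<inter> {..<n} = X \<inter> {..<n} \<longrightarrow> ?h Y = ?h X"
    proof (cases "X \<subseteq> B")
      case True
      then have XB: "isub X B" using X by (auto simp: isub_def)
      obtain n where n: "\<And>Y. isub Y B \<Longrightarrow> Y \<inter> {..<n} = X \<inter> {..<n} \<Longrightarrow> g Y = g X"
        using B(2) XB unfolding cont_def by metis
      obtain k where k: "\<And>a. a \<in> F \<Longrightarrow> a < k"
        using F(1)[unfolded finite_nat_set_iff_bounded] by blast
      have "?h Y = ?h X" if Y: "isub Y (F \<union> B)" "Y \<inter> {..<max n k} = X \<inter> {..<max n k}" for Y
      proof -
        have "Y \<subseteq> B"
        proof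
          fix y assume y: "y \<in> Y"
          show "y \<in> B"
          proof (cases "y < k")
            case lt: True
            then have "y \<in> Y \<inter> {..<max n k}" using y by simp
            then have "y \<in> X" unfolding Y(2) by blast
            then show ?thesis using True by blast
          next
            case False
            then show ?thesis using k y Y(1) unfolding isub_def by blast
          qed
        qed
        moreover then have "g Y = g X"
          using Y(1) agree_le[OF Y(2), of n] by (intro n) (simp_all add: isub_def)
        ultimately show ?thesis using True by simp
      qed
      then show ?thesis by blast
    next
      case False
      then obtain a where a: "a \<in> X" "a \<notin> B" by blast
      have "cont A f" using f by (simp add: barr_def)
      then obtain n where n: "\<And>Y. isub Y A \<Longrightarrow> Y \<inter> {..<n} = X \<inter> {..<n} \<Longrightarrow> f Y = f X"
        using isub_mono[OF X sub] unfolding cont_def by metis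
      have "?h Y = ?h X" if Y: "isub Y (F \<union> B)" "Y \<inter> {..<max n (Suc a)} = X \<inter> {..<max n (Suc a)}" for Y
      proof -
        have "a \<in> X \<inter> {..<max n (Suc a)}" using a by simp
        then have "a \<in> Y" unfolding Y(2)[symmetric] by blast
        then have "\<not> Y \<subseteq> B" using a by blast
        moreover have "f Y = f X"
          using isub_mono[OF Y(1) sub] agree_le[OF Y(2), of n] by (intro n) simp_all
        ultimately show ?thesis using False by simp
      qed
      then show ?thesis by blast
    qed
  qed
  moreover have "bad le (F \<union> B) ?h"
    unfolding bad_def
  proof (intro allI impI notI)
    fix X assume X: "isub X (F \<union> B)" and le: "le (?h X) (?h (shift X))"
    have XA: "isub X A" using X sub by (rule isub_mono)
    then have nf: "\<not> le (f X) (f (shift X))" using f by (simp add: barr_def bad_def)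
    show False
    proof (cases "X \<subseteq> B")
      case True
      then have "isub X B" using X by (simp add: isub_def)
      then have "\<not> le (g X) (g (shift X))" using B(3) by (simp add: bad_def)
      then show False using le True shift_subset[of X] by (simp split: if_splits)
    next
      case False
      show False
      proof (cases "shift X \<subseteq> B")
        case True
        then have "isub (shift X) B" using isub_shift[OF X] by (simp add: isub_def)
        then have "R (g (shift X)) (f (shift X)) \<or> g (shift X) = f (shift X)" by (rule gf)
        then have "f (shift X) = g (shift X) \<or> le (g (shift X)) (f (shift X))" using R_le by metis
        moreover have "le (f X) (g (shift X))" using le True False by simp
        ultimately show False using nf le_trans by metis
      qed (use False le nf in simp)
    qed
  qed
  ultimately have "barr ?h (F \<union> B)" using B(1) by (simp add: barr_def)
  then show ?thesis unfolding ext_def using sub gf by (auto simp: isub_def)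
qed

text \<open>If no point lengthens the stem, there are successive arrays that are not alive at the
  stems \<open>insert (e n) s\<close>. Their limit is not alive at \<open>s\<close>: a reduction
  with initial segment \<open>s\<close> has some \<open>e n\<close> as its next point and would
  reduce the \<open>n\<close>-th array.\<close>

lemma hopeless_step:
  assumes hop: "hopeless s f A"
  shows "\<exists>e g B. ext g B f A \<and> e \<in> B \<and> (\<forall>b\<in>s. b < e) \<and> hopeless (insert e s) g B"
proof (rule ccontr)
  assume "\<not> ?thesis"
  then have nh: "\<not> hopeless (insert e s) g B"
    if "ext g B f A" "e \<in> B" "\<forall>b\<in>s. b < e" for e g B using that by blast
  have f: "barr f A" and s: "finite s" "s \<subseteq> A"
    and al: "\<And>g B. ext g B f A \<Longrightarrow> B \<inter> dn s = A \<inter> dn s \<Longrightarrow> alive s g B"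
    using hop by (auto simp: hopeless_def)
  define P where "P g B e \<longleftrightarrow> ext g B f A \<and> B \<inter> dn s = A \<inter> dn s \<and> e \<in> B \<and> (\<forall>b\<in>s. b < e) \<and>
      \<not> alive (insert e s) g B" for g B e
  \<comment> \<open>The last clause freezes the values at sets with a point below \<open>e'\<close>
    outside \<open>s\<close>; it makes the sequence of arrays converge at every set.\<close>
  define Q where "Q g B l g' B' e' \<longleftrightarrow> l < e' \<and> ext g' B' g B \<and> B' \<inter> {..e'} = B \<inter> {..e'} \<and>
      (\<forall>X. isub X B' \<longrightarrow> (\<exists>a\<in>X. a < e' \<and> a \<notin> s) \<longrightarrow> g' X = g X)" for g B l g' B' e'
  have one: "\<exists>g' B' e'. P g' B' e' \<and> Q g B l g' B' e'"
    if g: "ext g B f A" and ret: "B \<inter> dn s = A \<inter> dn s" for g B and l :: nat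
  proof -
    have gB: "barr g B" using g by (simp add: ext_def)
    have "infinite B" using gB by (simp add: barr_def)
    moreover have "finite (dn s \<union> {..l})" using finite_dn[OF s(1)] by simp
    ultimately have "infinite (B - (dn s \<union> {..l}))" by simp
    then obtain e where "e \<in> B - (dn s \<union> {..l})" using infinite_imp_nonempty by blast
    then have e: "e \<in> B" "l < e" "\<forall>b\<in>s. b < e" by (auto simp: dn_def not_le)
    let ?t = "insert e s"
    have sB: "s \<subseteq> B" using s(2) subset_dn[of s] ret by blast
    have dnt: "dn ?t = {..e}" using e(3) by (auto simp: dn_def)
    have dns: "dn s \<subseteq> {..e}" using e(3) by (auto simp: dn_def)
    obtain f' A' where f': "ext f' A' g B" "A' \<inter> {..e} = B \<inter> {..e}" "\<not> alive ?t f' A'"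
      using nh[OF g e(1,3)] gB s(1) sB e(1) unfolding hopeless_def dnt by auto
    have A': "barr f' A'" "A' \<subseteq> B" using f'(1) by (auto simp: ext_def)
    \<comment> \<open>Every subset of \<open>A'\<close> with initial segment \<open>?t\<close> is a
      subset of \<open>Bt\<close>. So using \<open>f'\<close> on subsets of \<open>Bt\<close> and
      \<open>g\<close> elsewhere already yields an array that is not alive at
      \<open>?t\<close>.\<close>
    define Bt where "Bt = ?t \<union> (A' \<inter> {e<..})"
    have tA': "?t \<subseteq> A'"
    proof -
      have "?t \<subseteq> B \<inter> {..e}" using sB e(1,3) by fastforce
      then show ?thesis using f'(2) by blast
    qed
    have BtA: "Bt \<subseteq> A'" using tA' by (auto simp: Bt_def)
    have "infinite (A' - {..e})" using A'(1) by (simp add: barr_def)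
    moreover have "A' - {..e} \<subseteq> Bt" by (auto simp: Bt_def)
    ultimately have infBt: "infinite Bt" using finite_subset by blast
    have extt: "ext f' Bt g B"
      using barr_subset[OF A'(1) BtA infBt] BtA f'(1) unfolding ext_def by (meson isub_mono subset_trans)
    have FB: "(A' \<inter> {..e}) \<union> Bt = A'" using BtA by (auto simp: Bt_def)
    define g' where "g' X = (if X \<subseteq> Bt then f' X else g X)" for X
    have ext': "ext g' A' g B"
      using mix[OF gB extt, of "A' \<inter> {..e}"] A'(2) unfolding FB g'_def by auto
    have "\<not> alive ?t g' A'"
    proof
      assume "alive ?t g' A'"
      then obtain h D where h: "red h D g' A'" "init ?t D" by (auto simp: alive_def)
      have "D \<subseteq> Bt" using h by (fastforce simp: init_def red_def Bt_def)
      then have "g' X = f' X" if "isub X D" for X using that by (auto simp: g'_def isub_def)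
      then have "red h D f' A'" using h(1) by (simp add: red_def)
      then show False using f'(3) h(2) by (auto simp: alive_def)
    qed
    moreover have "A' \<inter> dn s = A \<inter> dn s" using f'(2) dns ret by blast
    ultimately have "P g' A' e"
      unfolding P_def using ext_trans[OF ext' g] tA' e(3) by blast
    moreover have "g' X = g X" if ex: "\<exists>a\<in>X. a < e \<and> a \<notin> s" for X
    proof -
      obtain a where "a \<in> X" "a < e" "a \<notin> s" using ex by blast
      then have "a \<notin> Bt" by (auto simp: Bt_def)
      then have "\<not> X \<subseteq> Bt" using \<open>a \<in> X\<close> by blast
      then show ?thesis by (simp add: g'_def)
    qed
    ultimately show ?thesis unfolding Q_def using e(2) ext' f'(2) by blast
  qed
  define PP where "PP u \<longleftrightarrow> P (fst u) (fst (snd u)) (snd (snd u))" for u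
  define QQ where "QQ u v \<longleftrightarrow> Q (fst u) (fst (snd u)) (snd (snd u)) (fst v) (fst (snd v)) (snd (snd v))" for u v
  have init0: "\<exists>u. PP u"
    using one[OF ext_refl[OF f] refl, of 0] unfolding PP_def by auto
  have step0: "\<exists>v. PP v \<and> QQ u v" if "PP u" for u
    using one[of "fst u" "fst (snd u)" "snd (snd u)"] that unfolding PP_def QQ_def P_def by auto
  obtain us where us: "\<And>n. PP (us n)" "\<And>n. QQ (us n) (us (Suc n))"
    using dependent_nat_choice[of "\<lambda>_. PP" "\<lambda>_. QQ"] init0 step0 by metis
  define gs where "gs n = fst (us n)" for n
  define Bs where "Bs n = fst (snd (us n))" for n
  define e where "e n = snd (snd (us n))" for n
  have P: "ext (gs n) (Bs n) f A" "Bs n \<inter> dn s = A \<inter> dn s" "e n \<in> Bs n" "\<forall>b\<in>s. b < e n"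
     "\<not> alive (insert (e n) s) (gs n) (Bs n)" for n
    using us(1)[of n] by (auto simp: PP_def P_def gs_def Bs_def e_def)
  have Q: "e n < e (Suc n)" "ext (gs (Suc n)) (Bs (Suc n)) (gs n) (Bs n)"
     "Bs (Suc n) \<inter> {..e (Suc n)} = Bs n \<inter> {..e (Suc n)}"
     "\<And>X. isub X (Bs (Suc n)) \<Longrightarrow> (\<exists>a\<in>X. a < e (Suc n) \<and> a \<notin> s) \<Longrightarrow> gs (Suc n) X = gs n X" for n
    using us(2)[of n] by (auto simp: QQ_def Q_def gs_def Bs_def e_def)
  have sm: "strict_mono e" using Q(1) by (simp add: strict_mono_Suc_iff)
  have ext_le: "ext (gs m) (Bs m) (gs n) (Bs n)" if "n \<le> m" for n m
    using that
  proof (induction m rule: dec_induct)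
    case base
    then show ?case using P(1)[of n] by (simp add: ext_def)
  next
    case (step m)
    then show ?case using Q(2)[of m] ext_trans by blast
  qed
  define Ai where "Ai = (A \<inter> dn s) \<union> range e"
  have eB: "e m \<in> Bs n" for m n
  proof (cases "m \<le> n")
    case True
    then show ?thesis
    proof (induction n rule: dec_induct)
      case base
      show ?case by (rule P(3))
    next
      case (step n)
      have "e m \<le> e (Suc n)" using step sm by (simp add: strict_mono_less_eq)
      then have "e m \<in> Bs n \<inter> {..e (Suc n)}" using step by simp
      then show ?case using Q(3)[of n] by blast
    qed
  next
    case False
    then have "Bs m \<subseteq> Bs n" using ext_le[of n m] by (simp add: ext_def)
    then show ?thesis using P(3) by blast
  qed
  have AiB: "Ai \<subseteq> Bs n" for n unfolding Ai_def using eB P(2)[of n] by blast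
  have e_dn: "e n \<notin> dn s" for n using P(4)[of n] by (auto simp: dn_def not_le)
  have e_s: "e n \<notin> s" for n using P(4)[of n] by blast
  \<comment> \<open>From stage \<open>idx X\<close> on the value at \<open>X\<close> is fixed,
    because \<open>e (idx X)\<close> is a point of \<open>X\<close> outside \<open>s\<close> and
    below all later \<open>e\<close>.\<close>
  define idx where "idx X = (LEAST n. e n \<in> X)" for X
  have idx: "e (idx X) \<in> X" if X: "isub X Ai" for X
  proof -
    have "\<not> X \<subseteq> A \<inter> dn s" using X finite_dn[OF s(1)] finite_subset by (auto simp: isub_def)
    then obtain n where "e n \<in> X" using X by (auto simp: isub_def Ai_def)
    then show ?thesis unfolding idx_def by (rule LeastI)
  qed
  define fi where "fi X = gs (idx X) X" for X
  have stable: "gs m X = fi X" if X: "isub X Ai" and "idx X \<le> m" for X m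
    using that(2)
  proof (induction m rule: dec_induct)
    case base
    then show ?case by (simp add: fi_def)
  next
    case (step m)
    have "e (idx X) < e (Suc m)" using step sm by (simp add: strict_mono_less)
    then have "\<exists>a\<in>X. a < e (Suc m) \<and> a \<notin> s" using idx[OF X] e_s by blast
    then show ?case using Q(4)[of X m] isub_mono[OF X AiB] step by simp
  qed
  have infAi: "infinite Ai"
    unfolding Ai_def using sm by (simp add: finite_image_iff strict_mono_imp_inj_on)
  have "cont Ai fi"
    unfolding cont_def
  proof (intro allI impI)
    fix X assume X: "isub X Ai"
    have "cont (Bs (idx X)) (gs (idx X))" using P(1)[of "idx X"] by (simp add: ext_def barr_def)
    then obtain n where n: "\<And>Y. isub Y (Bs (idx X)) \<Longrightarrow> Y \<inter> {..<n} = X \<inter> {..<n} \<Longrightarrow>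
        gs (idx X) Y = gs (idx X) X"
      using isub_mono[OF X AiB] unfolding cont_def by metis
    let ?n = "max n (Suc (e (idx X)))"
    have "fi Y = fi X" if Y: "isub Y Ai" "Y \<inter> {..<?n} = X \<inter> {..<?n}" for Y
    proof -
      have "e (idx X) \<in> X \<inter> {..<?n}" using idx[OF X] by simp
      then have "e (idx X) \<in> Y" unfolding Y(2)[symmetric] by blast
      then have "idx Y \<le> idx X" unfolding idx_def[of Y] by (rule Least_le)
      then have "fi Y = gs (idx X) Y" using stable[OF Y(1)] by simp
      also have "\<dots> = gs (idx X) X"
        using isub_mono[OF Y(1) AiB] agree_le[OF Y(2), of n] by (intro n) simp_all
      finally show ?thesis by (simp add: fi_def)
    qed
    then show "\<exists>n. \<forall>Y. isub Y Ai \<longrightarrow> Y \<inter> {..<n} = X \<inter> {..<n} \<longrightarrow> fi Y = fi X" by blast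
  qed
  moreover have "bad le Ai fi"
    unfolding bad_def
  proof (intro allI impI)
    fix X assume X: "isub X Ai"
    let ?m = "max (idx X) (idx (shift X))"
    have "bad le (Bs ?m) (gs ?m)" using P(1)[of ?m] by (simp add: ext_def barr_def)
    then have "\<not> le (gs ?m X) (gs ?m (shift X))" using isub_mono[OF X AiB] by (simp add: bad_def)
    then show "\<not> le (fi X) (fi (shift X))"
      using stable[OF X, of ?m] stable[OF isub_shift[OF X], of ?m] by simp
  qed
  ultimately have bfi: "barr fi Ai" using infAi by (simp add: barr_def)
  have "ext fi Ai f A"
    unfolding ext_def
  proof (intro conjI allI impI)
    show "Ai \<subseteq> A" using AiB[of 0] P(1)[of 0] by (auto simp: ext_def)
    fix X assume X: "isub X Ai"
    show "R (fi X) (f X) \<or> fi X = f X"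
      using P(1)[of "idx X"] isub_mono[OF X AiB] by (simp add: ext_def fi_def)
  qed (rule bfi)
  moreover have "Ai \<inter> dn s = A \<inter> dn s" using e_dn by (auto simp: Ai_def)
  ultimately have "alive s fi Ai" by (rule al)
  then obtain h D where h: "red h D fi Ai" and D: "init s D" by (auto simp: alive_def)
  have infD: "infinite D" and DA: "D \<subseteq> Ai" using h by (auto simp: red_def barr_def)
  \<comment> \<open>The first point of \<open>D\<close> beyond the stem is some \<open>e n\<close>,
    and then \<open>D\<close> contradicts the choice of the \<open>n\<close>-th array.\<close>
  let ?d = "LEAST n. n \<in> D - s"
  have d: "?d \<in> D - s" using infD s(1) by (intro Least_mem_inf) simp
  then have "\<forall>a\<in>s. a < ?d" using D by (auto simp: init_def)
  then have "?d \<notin> dn s" by (auto simp: dn_def not_le)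
  then obtain n where n: "?d = e n" using d DA by (auto simp: Ai_def)
  have dmin: "?d \<le> y" if "y \<in> D - s" for y using that by (rule Least_le)
  have "init (insert (e n) s) D"
    unfolding init_def
  proof (intro conjI ballI)
    show "insert (e n) s \<subseteq> D" using D d n by (auto simp: init_def)
    fix b a assume b: "b \<in> D - insert (e n) s" and a: "a \<in> insert (e n) s"
    show "a < b"
    proof (cases "a \<in> s")
      case True
      then show ?thesis using D b by (auto simp: init_def)
    next
      case False
      then have "a = e n" using a by blast
      moreover have "e n \<le> b" using dmin[of b] b n by simp
      ultimately show ?thesis using b by auto
    qed
  qed
  moreover have "red h D (gs n) (Bs n)"
    unfolding red_def
  proof (intro conjI allI impI)
    show "barr h D" using h by (simp add: red_def)
    show "D \<subseteq> Bs n" using DA AiB by blast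
    fix X assume X: "isub X D"
    then have XA: "isub X Ai" using DA by (rule isub_mono)
    have 1: "R (h X) (fi X)" using h X by (simp add: red_def)
    have "e (idx X) \<in> D - s" using idx[OF XA] X e_s by (auto simp: isub_def)
    then have "e n \<le> e (idx X)" using dmin n by simp
    then have "n \<le> idx X" using sm by (simp add: strict_mono_less_eq)
    then have "R (gs (idx X) X) (gs n X) \<or> gs (idx X) X = gs n X"
      using ext_le[of n "idx X"] isub_mono[OF XA AiB] by (simp add: ext_def)
    then show "R (h X) (gs n X)" using 1 R_trans unfolding fi_def by metis
  qed
  ultimately have "alive (insert (e n) s) (gs n) (Bs n)" by (auto simp: alive_def)
  then show False using P(5) by blast
qed

text \<open>An extension of \<open>h\<close> is mixed back into \<open>f\<close> by restoring the
  finitely many points of \<open>A\<close> up to the stem. A reduction of the mixture with initial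
  segment \<open>s\<close> avoids the restored points outside \<open>s\<close>, so it reduces the
  given extension.\<close>

lemma hopeless_red:
  assumes hop: "hopeless s f A" and h: "red h B f A" and B: "init s B"
  shows "hopeless s h B"
proof -
  have f: "barr f A" and s: "finite s" "s \<subseteq> A"
    and al: "\<And>g B. ext g B f A \<Longrightarrow> B \<inter> dn s = A \<inter> dn s \<Longrightarrow> alive s g B"
    using hop by (auto simp: hopeless_def)
  have Bdn: "B \<inter> dn s = s"
  proof -
    have "x \<in> s" if x: "x \<in> B" "x \<in> dn s" for x
    proof (rule ccontr)
      assume "x \<notin> s"
      then have "\<forall>a\<in>s. a < x" using B x(1) by (simp add: init_def)
      then show False using x(2) by (auto simp: dn_def)
    qed
    then show ?thesis using B subset_dn[of s] by (auto simp: init_def)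
  qed
  have "alive s g D" if g: "ext g D h B" and D: "D \<inter> dn s = B \<inter> dn s" for g D
  proof -
    have gf: "ext g D f A" using g red_imp_ext[OF h] by (rule ext_trans)
    let ?F = "A \<inter> dn s"
    let ?k = "\<lambda>X. if X \<subseteq> D then g X else f X"
    have "ext ?k (?F \<union> D) f A" by (rule mix[OF f gf]) (use finite_dn[OF s(1)] in auto)
    moreover have "(?F \<union> D) \<inter> dn s = A \<inter> dn s"
      using gf by (auto simp: ext_def)
    ultimately have "alive s ?k (?F \<union> D)" by (rule al)
    then obtain k' D' where k': "red k' D' ?k (?F \<union> D)" "init s D'" by (auto simp: alive_def)
    have "D' \<subseteq> D"
    proof
      fix y assume y: "y \<in> D'"
      show "y \<in> D"
      proof (cases "y \<in> s")
        case True
        then show ?thesis using D Bdn by blast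
      next
        case False
        then have "\<forall>a\<in>s. a < y" using y k'(2) by (simp add: init_def)
        then have "y \<notin> dn s" by (auto simp: dn_def)
        then show ?thesis using y k'(1) by (auto simp: red_def)
      qed
    qed
    moreover have "R (k' X) (g X)" if "isub X D'" for X
    proof -
      have "X \<subseteq> D" using that \<open>D' \<subseteq> D\<close> unfolding isub_def by blast
      moreover have "R (k' X) (?k X)" using k'(1) that unfolding red_def by blast
      ultimately show ?thesis by simp
    qed
    ultimately have "red k' D' g D" using k'(1) by (simp add: red_def)
    then show ?thesis using k'(2) by (auto simp: alive_def)
  qed
  then show ?thesis unfolding hopeless_def using h s(1) B by (auto simp: red_def init_def)
qed

text \<open>Applied to arrays that pick a proper subterm of every value \<open>g X\<close>: by
  minimality such an array cannot be bad.\<close>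

theorem minimal_bad_array:
  assumes "infinite A" "cont A f" "bad le A f"
  obtains g B where "isub B A" "cont B g" "bad le B g"
    "\<And>X. isub X B \<Longrightarrow> R (g X) (f X) \<or> g X = f X"
    "\<And>h D. isub D B \<Longrightarrow> cont D h \<Longrightarrow> bad le D h \<Longrightarrow> \<exists>X. isub X D \<and> \<not> R (h X) (g X)"
proof -
  have f: "barr f A" using assms by (simp add: barr_def)
  have "\<exists>g B. ext g B f A \<and> \<not> alive {} g B"
  proof (rule ccontr)
    assume "\<not> ?thesis"
    then have hop0: "hopeless {} f A" using f by (auto simp: hopeless_def)
    define PP where "PP u \<longleftrightarrow> hopeless (snd (snd u)) (fst u) (fst (snd u))" for u
    define QQ where "QQ u v \<longleftrightarrow> red (fst v) (fst (snd v)) (fst u) (fst (snd u)) \<and>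
       (\<exists>e. (\<forall>b\<in>snd (snd u). b < e) \<and> snd (snd v) = insert e (snd (snd u)))"
      for u v :: "(nat set \<Rightarrow> 'q) \<times> nat set \<times> nat set"
    have init0: "\<exists>u. PP u" unfolding PP_def using hop0 by (metis fst_conv snd_conv)
    have step0: "\<exists>v. PP v \<and> QQ u v" if u: "PP u" for u
    proof -
      obtain f1 A1 s where uu: "u = (f1, A1, s)" by (metis prod.collapse)
      have hop: "hopeless s f1 A1" using u by (simp add: PP_def uu)
      obtain e g B where egB: "ext g B f1 A1" "\<forall>b\<in>s. b < e" "hopeless (insert e s) g B"
        using hopeless_step[OF hop] by blast
      have "barr g B" using egB(3) by (simp add: hopeless_def)
      then have "alive (insert e s) g B" using egB(3) ext_refl unfolding hopeless_def by blast
      then obtain h D where hD: "red h D g B" "init (insert e s) D" by (auto simp: alive_def)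
      have "hopeless (insert e s) h D" using hopeless_red[OF egB(3) hD] .
      moreover have "red h D f1 A1" using red_ext[OF hD(1) egB(1)] .
      ultimately show ?thesis using egB(2)
        by (intro exI[of _ "(h, D, insert e s)"]) (auto simp: PP_def QQ_def uu)
    qed
    obtain us where us: "\<And>n. PP (us n)" "\<And>n. QQ (us n) (us (Suc n))"
      using dependent_nat_choice[of "\<lambda>_. PP" "\<lambda>_. QQ"] init0 step0 by metis
    define gs where "gs n = fst (us n)" for n
    define Bs where "Bs n = fst (snd (us n))" for n
    define ss where "ss n = snd (snd (us n))" for n
    have "\<forall>n. \<exists>e. (\<forall>b\<in>ss n. b < e) \<and> ss (Suc n) = insert e (ss n)"
      using us(2) by (auto simp: QQ_def ss_def)
    then obtain e where e: "\<And>n. \<forall>b\<in>ss n. b < e n" "\<And>n. ss (Suc n) = insert (e n) (ss n)" by metis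
    have red: "red (gs (Suc n)) (Bs (Suc n)) (gs n) (Bs n)" for n
      using us(2)[of n] by (auto simp: QQ_def gs_def Bs_def)
    have ssB: "ss n \<subseteq> Bs n" for n
      using us(1)[of n] by (auto simp: PP_def ss_def Bs_def hopeless_def)
    have lt: "e n < e (Suc n)" for n using e(1)[of "Suc n"] e(2)[of n] by auto
    then have sm: "strict_mono e" by (simp add: strict_mono_Suc_iff)
    have Bdec: "Bs m \<subseteq> Bs n" if "n \<le> m" for n m
      using that by (rule lift_Suc_antimono_le[rotated]) (use red in \<open>auto simp: red_def\<close>)
    have ess: "e n \<in> ss m" if "n < m" for n m
      using that by (induction m) (auto simp: e(2) less_Suc_eq)
    have eB: "e m \<in> Bs n" for m n
    proof -
      have "e m \<in> Bs (max n (Suc m))" using ess[of m "max n (Suc m)"] ssB by (auto simp: less_max_iff_disj)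
      then show ?thesis using Bdec[of n "max n (Suc m)"] by auto
    qed
    have D: "isub (range e) (Bs n)" for n
      using eB sm by (auto simp: isub_def finite_image_iff strict_mono_imp_inj_on)
    \<comment> \<open>The set of all added points lies in every \<open>Bs n\<close>: one argument at
      which all arrays can be compared.\<close>
    have "R (gs (Suc n) (range e)) (gs n (range e))" for n
      using red[of n] D[of "Suc n"] by (auto simp: red_def)
    then have "\<exists>q. \<forall>n. (q (Suc n), q n) \<in> {(x, y). R x y}"
      by (intro exI[of _ "\<lambda>n. gs n (range e)"]) simp
    then show False using wf_R unfolding wfp_def wf_iff_no_infinite_down_chain by (rule notE[rotated])
  qed
  then obtain g B where gB: "ext g B f A" "\<not> alive {} g B" by blast
  show thesis
  proof (rule that[of B g])
    show "isub B A" "cont B g" "bad le B g" using gB(1) by (auto simp: ext_def barr_def isub_def)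
    show "R (g X) (f X) \<or> g X = f X" if "isub X B" for X using that gB(1) by (auto simp: ext_def)
    show "\<exists>X. isub X D \<and> \<not> R (h X) (g X)" if "isub D B" "cont D h" "bad le D h" for h D
    proof (rule ccontr)
      assume "\<not> ?thesis"
      then have "red h D g B" using that by (auto simp: red_def barr_def isub_def)
      then show False using gB(2) by (auto simp: alive_def init_def)
    qed
  qed
qed

end

section \<open>Terms\<close>

text \<open>A sequence becomes an array by evaluating it at the least element of a set;
  \<open>X\<close> and \<open>shift X\<close> then compare the terms at the first two elements of
  \<open>X\<close>.\<close>

lemma bqo_imp_good:
  assumes "bqo le"
  shows "\<exists>i j. i < j \<and> le (x i) (x (j :: nat))"
proof (rule ccontr)
  assume no: "\<not> ?thesis"
  define f where "f X = x (LEAST n. n \<in> X)" for X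
  have "cont UNIV f"
    unfolding cont_def
  proof (intro allI impI)
    fix X assume X: "isub X UNIV"
    let ?m = "LEAST n. n \<in> X"
    have m: "?m \<in> X" using X by (intro Least_mem_inf) (simp add: isub_def)
    have "f Y = f X" if Y: "isub Y UNIV" "Y \<inter> {..<Suc ?m} = X \<inter> {..<Suc ?m}" for Y
    proof -
      have "?m \<in> X \<inter> {..<Suc ?m}" using m by simp
      then have mY: "?m \<in> Y" unfolding Y(2)[symmetric] by blast
      have "?m \<le> y" if "y \<in> Y" for y
      proof (rule ccontr)
        assume "\<not> ?m \<le> y"
        then have "y \<in> Y \<inter> {..<Suc ?m}" using that by simp
        then have "y \<in> X" unfolding Y(2) by blast
        then show False using \<open>\<not> ?m \<le> y\<close> by (simp add: Least_le)
      qed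
      then have "(LEAST n. n \<in> Y) = ?m" using mY by (intro Least_equality)
      then show ?thesis by (simp add: f_def)
    qed
    then show "\<exists>n. \<forall>Y. isub Y UNIV \<longrightarrow> Y \<inter> {..<n} = X \<inter> {..<n} \<longrightarrow> f Y = f X" by blast
  qed
  moreover have "bad le UNIV f"
    unfolding bad_def
  proof (intro allI impI)
    fix X assume X: "isub X UNIV"
    let ?m = "LEAST n. n \<in> X" and ?k = "LEAST n. n \<in> shift X"
    have "infinite (shift X)" using isub_shift[OF X] by (simp add: isub_def)
    then have k: "?k \<in> shift X" by (rule Least_mem_inf)
    then have "?k \<in> X" "?k \<noteq> ?m" by (auto simp: shift_def)
    then have "?m < ?k" by (metis Least_le le_neq_implies_less)
    then show "\<not> le (f X) (f (shift X))" using no unfolding f_def by blast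
  qed
  ultimately show False using assms unfolding bqo_def by (meson infinite_UNIV_nat)
qed

text \<open>A word \<open>WFix S\<close> stands for a chain in which every class is, for some \<open>i\<close>, in the context \<open>S i\<close>, consisting of
  the word before the class, its colour, its letter and the word after it; \<open>None\<close> is the word \<open>WFix S\<close>
  itself.  A graph \<open>GFix S\<close> is a graph in which the chain of every vertex is one of the words \<open>S i\<close>, whose letters
  are graphs, \<open>None\<close> being \<open>GFix S\<close> itself.\<close>

datatype ('i, 'l) wt =
  WEmp | WFix "'i \<Rightarrow> ('i, 'l) wt option \<times> bool \<times> 'l \<times> ('i, 'l) wt option"

datatype 'i gt = GEmp | GFix "'i \<Rightarrow> ('i, 'i gt option) wt"

definition subw :: "('i, 'l) wt \<Rightarrow> ('i, 'l) wt \<Rightarrow> bool" where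
  "subw a w \<longleftrightarrow> (\<exists>S i e b d. w = WFix S \<and> (S i = (Some a, e, b, d) \<or> S i = (d, e, b, Some a)))"

definition subg :: "'i gt \<Rightarrow> 'i gt \<Rightarrow> bool" where
  "subg b g \<longleftrightarrow> (\<exists>S i. g = GFix S \<and> Some b \<in> set_wt (S i))"

lemma wf_subw: "wfP (subw :: ('i, 'l) wt \<Rightarrow> _)"
proof (rule wfpUNIVI)
  fix P :: "('i, 'l) wt \<Rightarrow> bool" and x
  assume *: "\<forall>x. (\<forall>y. subw y x \<longrightarrow> P y) \<longrightarrow> P x"
  show "P x"
  proof (induction x)
    case WEmp
    show ?case using *[rule_format, of WEmp] by (simp add: subw_def)
  next
    case (WFix S)
    show ?case
    proof (rule *[rule_format])
      fix y assume "subw y (WFix S)"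
      then obtain i e b d where S: "S i = (Some y, e, b, d) \<or> S i = (d, e, b, Some y)"
        by (auto simp: subw_def)
      then show "P y"
      proof
        assume "S i = (Some y, e, b, d)"
        then show ?thesis using WFix(1)[of "S i" "Some y" y] rangeI[of S i] by auto
      next
        assume "S i = (d, e, b, Some y)"
        then show ?thesis using WFix(2)[of "S i" "(e, b, Some y)" "(b, Some y)" "Some y" y] rangeI[of S i]
          by auto
      qed
    qed
  qed
qed

lemma wf_subg: "wfP (subg :: 'i gt \<Rightarrow> _)"
proof (rule wfpUNIVI)
  fix P :: "'i gt \<Rightarrow> bool" and x
  assume *: "\<forall>x. (\<forall>y. subg y x \<longrightarrow> P y) \<longrightarrow> P x"
  show "P x"
  proof (induction x)
    case GEmp
    show ?case using *[rule_format, of GEmp] by (simp add: subg_def)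
  next
    case (GFix S)
    show ?case
    proof (rule *[rule_format])
      fix y assume "subg y (GFix S)"
      then obtain i where "Some y \<in> set_wt (S i)" by (auto simp: subg_def)
      then show "P y" by (intro GFix[of "S i" "Some y"]) auto
    qed
  qed
qed

lemma set_wt_WFix:
  fixes S :: "'i \<Rightarrow> ('i, 'l) wt option \<times> bool \<times> 'l \<times> ('i, 'l) wt option"
  shows "set_wt (WFix S) = (\<Union>i. case S i of (a, e, b, d) \<Rightarrow>
     insert b (\<Union>(set_wt ` set_option a) \<union> \<Union>(set_wt ` set_option d)))"
proof -
  \<comment> \<open>Constant families reduce the claim to a single quadruple, on which the nested
    set functions can be evaluated.\<close>
  have "set_wt (WFix S) = (\<Union>i. set_wt (WFix (\<lambda>_ :: 'i. S i)))" by (simp add: SUP_image)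
  moreover have "set_wt (WFix (\<lambda>_ :: 'i. S i)) = (case S i of (a, e, b, d) \<Rightarrow>
     insert b (\<Union>(set_wt ` set_option a) \<union> \<Union>(set_wt ` set_option d)))" for i
    by (cases "S i") auto
  ultimately show ?thesis by simp
qed

lemma set_wt_subw: "subw a w \<Longrightarrow> set_wt a \<subseteq> set_wt w"
proof
  fix x assume "subw a w" "x \<in> set_wt a"
  then obtain S i e b d where w: "w = WFix S" "S i = (Some a, e, b, d) \<or> S i = (d, e, b, Some a)"
    unfolding subw_def by blast
  then show "x \<in> set_wt w"
    using \<open>x \<in> set_wt a\<close> unfolding w(1) set_wt_WFix by (intro UN_I[of i]) auto
qed

lemma set_wt_subw_trancl: "subw\<^sup>+\<^sup>+ a w \<Longrightarrow> set_wt a \<subseteq> set_wt w"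
  by (induction rule: tranclp_induct) (use set_wt_subw in blast)+

section \<open>Transfer of better-quasi-orders from letters to contexts, words and graph
  terms\<close>

fun ctxle :: "('w \<Rightarrow> 'w \<Rightarrow> bool) \<Rightarrow> ('l \<Rightarrow> 'l \<Rightarrow> bool) \<Rightarrow> 'w option \<times> bool \<times> 'l \<times> 'w option \<Rightarrow>
    'w option \<times> bool \<times> 'l \<times> 'w option \<Rightarrow> bool" where
  "ctxle leW leL (a, e, b, d) (a', e', b', d') \<longleftrightarrow>
     rel_option leW a a' \<and> e = e' \<and> leL b b' \<and> rel_option leW d d'"

text \<open>\<open>None\<close> is below \<open>None\<close>, so on a homogeneous set a bad array
  takes no value \<open>None\<close>.\<close>

lemma bad_option:
  assumes A: "infinite A" "cont A f" "bad (rel_option le) A f"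
  shows "\<exists>B. isub B A \<and> (\<forall>X. isub X B \<longrightarrow> f X \<noteq> None) \<and> bad le B (\<lambda>X. the (f X))"
proof -
  obtain B i where B: "isub B A" "\<And>X. isub X B \<Longrightarrow> (f X = None) = i"
    using clopen_ramsey[OF A(1) cont_map[OF A(2), of "\<lambda>x. x = None"], of UNIV] by auto
  have nb: "\<not> rel_option le (f X) (f (shift X))" if "isub X B" for X
    using A(3) isub_trans[OF that B(1)] by (simp add: bad_def)
  have "isub B B" using B(1) by (simp add: isub_def)
  then have "\<not> i" using nb[of B] B(2)[of B] B(2)[OF isub_shift, of B] by auto
  then have some: "f X \<noteq> None" if "isub X B" for X using B(2) that by blast
  have "\<not> le (the (f X)) (the (f (shift X)))" if X: "isub X B" for X
    using nb[OF X] some[OF X] some[OF isub_shift[OF X]] by auto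
  then show ?thesis using B(1) some by (auto simp: bad_def)
qed

text \<open>Ramsey's theorem makes the colour of the context and two of the three comparisons
  constant. Equal colours cannot cause badness, so if those two comparisons always succeed, the
  third always fails.\<close>

lemma bad_ctx:
  assumes A: "infinite A" "cont A s" "bad (ctxle leW leL) A s"
  shows "\<exists>B. isub B A \<and> (bad (rel_option leW) B (\<lambda>X. fst (s X)) \<or> bad leL B (\<lambda>X. fst (snd (snd (s X)))) \<or>
     bad (rel_option leW) B (\<lambda>X. snd (snd (snd (s X)))))"
proof -
  let ?c = "\<lambda>p. (fst (snd (fst p)), rel_option leW (fst (fst p)) (fst (snd p)),
     leL (fst (snd (snd (fst p)))) (fst (snd (snd (snd p)))))"
  have "cont A (\<lambda>X. ?c (s X, s (shift X)))"
    by (rule cont_map[OF cont_Pair[OF A(2) cont_shift[OF A(2)]], of ?c])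
  from clopen_ramsey[OF A(1) this finite_UNIV]
  obtain B i where B: "isub B A" "\<And>X. isub X B \<Longrightarrow> ?c (s X, s (shift X)) = i" by auto
  obtain e p q where i: "i = (e, p, q)" by (metis prod.collapse)
  have nb: "\<not> ctxle leW leL (s X) (s (shift X))" if "isub X B" for X
    using A(3) isub_trans[OF that B(1)] by (simp add: bad_def)
  have "\<not> p \<or> \<not> q \<or> \<not> rel_option leW (snd (snd (snd (s X)))) (snd (snd (snd (s (shift X)))))"
    if X: "isub X B" for X
    using nb[OF X] B(2)[OF X] B(2)[OF isub_shift[OF X]] unfolding i
    by (cases "s X"; cases "s (shift X)") auto
  moreover have "rel_option leW (fst (s X)) (fst (s (shift X))) = p"
     "leL (fst (snd (snd (s X)))) (fst (snd (snd (s (shift X))))) = q" if X: "isub X B" for X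
    using B(2)[OF X] unfolding i by auto
  ultimately show ?thesis using B(1) unfolding bad_def by metis
qed

text \<open>\<open>leW_dom\<close> asks for domination: each context of one word lies below some
  context of the other. This is the order on sets that forces the use of
  better-quasi-orders.\<close>

locale word_order =
  fixes leL :: "'l \<Rightarrow> 'l \<Rightarrow> bool" and leW :: "('i, 'l) wt \<Rightarrow> ('i, 'l) wt \<Rightarrow> bool"
  assumes leW_trans: "leW x y \<Longrightarrow> leW y z \<Longrightarrow> leW x z"
    and leW_Emp: "leW WEmp x"
    and leW_sub: "subw a w \<Longrightarrow> leW a w"
    and leW_dom: "(\<And>i. \<exists>j. ctxle leW leL (S i) (S' j)) \<Longrightarrow> leW (WFix S) (WFix S')"
begin

lemma ranked: "ranked_qo leW subw\<^sup>+\<^sup>+"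
proof
  show "leW x z" if "leW x y" "leW y z" for x y z using that by (rule leW_trans)
  show "leW x y" if "subw\<^sup>+\<^sup>+ x y" for x y
    using that by (induction rule: tranclp_induct) (use leW_sub leW_trans in blast)+
  show "subw\<^sup>+\<^sup>+ x z" if "subw\<^sup>+\<^sup>+ x y" "subw\<^sup>+\<^sup>+ y z" for x y z :: "('i, 'l) wt" using that by (rule tranclp_trans)
  show "wfP (subw\<^sup>+\<^sup>+ :: ('i, 'l) wt \<Rightarrow> _)" by (rule wfp_tranclp[OF wf_subw])
qed

text \<open>In the minimal array every \<open>g X\<close> has a context below no context of
  \<open>g (shift X)\<close>. These contexts form a bad array; by minimality its word components
  contain no bad array, so the letters do.\<close>

lemma bad_words:
  assumes "infinite A" "cont A f" "bad leW A f"
  shows "\<exists>B g. isub B A \<and> cont B g \<and> bad leL B g \<and> (\<forall>X. isub X B \<longrightarrow> g X \<in> set_wt (f X))"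
proof -
  interpret ranked_qo leW "subw\<^sup>+\<^sup>+" by (rule ranked)
  obtain g B where B: "isub B A" "cont B g" "bad leW B g"
    and gf: "\<And>X. isub X B \<Longrightarrow> subw\<^sup>+\<^sup>+ (g X) (f X) \<or> g X = f X"
    and mn: "\<And>h D. isub D B \<Longrightarrow> cont D h \<Longrightarrow> bad leW D h \<Longrightarrow> \<exists>X. isub X D \<and> \<not> subw\<^sup>+\<^sup>+ (h X) (g X)"
    using minimal_bad_array[OF assms] by metis
  have infB: "infinite B" using B(1) by (simp add: isub_def)
  define cx where "cx w = (case w of WEmp \<Rightarrow> {} | WFix S \<Rightarrow> range S)" for w :: "('i, 'l) wt"
  \<comment> \<open>A fixed choice function makes the chosen context depend only on the pair
    \<open>(g X, g (shift X))\<close>, hence continuously on \<open>X\<close>.\<close>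
  define pick where "pick = (\<lambda>(w, w'). SOME c. c \<in> cx w \<and> (\<forall>c'\<in>cx w'. \<not> ctxle leW leL c c'))"
  define s where "s = (\<lambda>X. pick (g X, g (shift X)))"
  have s: "s X \<in> cx (g X) \<and> (\<forall>c'\<in>cx (g (shift X)). \<not> ctxle leW leL (s X) c')" if X: "isub X B" for X
  proof -
    have nle: "\<not> leW (g X) (g (shift X))" "\<not> leW (g (shift X)) (g (shift (shift X)))"
      using B(3) X isub_shift[OF X] by (auto simp: bad_def)
    obtain S where S: "g X = WFix S" using nle(1) leW_Emp by (cases "g X") auto
    obtain S' where S': "g (shift X) = WFix S'" using nle(2) leW_Emp by (cases "g (shift X)") auto
    obtain i where "\<forall>j. \<not> ctxle leW leL (S i) (S' j)" using nle(1) leW_dom S S' by metis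
    then have "\<exists>c. c \<in> cx (g X) \<and> (\<forall>c'\<in>cx (g (shift X)). \<not> ctxle leW leL c c')"
      by (auto simp: cx_def S S')
    then show ?thesis unfolding s_def pick_def prod.case by (rule someI_ex)
  qed
  have contS: "cont B s"
    using cont_map[OF cont_Pair[OF B(2) cont_shift[OF B(2)]], of pick] unfolding s_def .
  have "bad (ctxle leW leL) B s" unfolding bad_def using s isub_shift by blast
  from bad_ctx[OF infB contS this]
  obtain D where D: "isub D B" and
    dis: "bad (rel_option leW) D (\<lambda>X. fst (s X)) \<or> bad leL D (\<lambda>X. fst (snd (snd (s X)))) \<or>
     bad (rel_option leW) D (\<lambda>X. snd (snd (snd (s X))))" by blast
  have infD: "infinite D" and contD: "cont D s"
    using D contS cont_subset by (auto simp: isub_def)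
  have no: False if t: "bad (rel_option leW) D (\<lambda>X. t (s X))"
    and sub: "\<And>w c a. c \<in> cx w \<Longrightarrow> t c = Some a \<Longrightarrow> subw a w" for t
  proof -
    obtain D' where D': "isub D' D" "\<And>X. isub X D' \<Longrightarrow> t (s X) \<noteq> None" "bad leW D' (\<lambda>X. the (t (s X)))"
      using bad_option[OF infD cont_map[OF contD, of t] t] by blast
    have "cont D' (\<lambda>X. the (t (s X)))"
      using cont_map[OF contD, of "\<lambda>c. the (t c)"] D'(1) cont_subset by (auto simp: isub_def)
    then obtain X where X: "isub X D'" "\<not> subw\<^sup>+\<^sup>+ (the (t (s X))) (g X)"
      using mn[OF isub_trans[OF D'(1) D]] D'(3) by blast
    have "isub X B" using X(1) D'(1) D isub_trans by blast
    then have "subw (the (t (s X))) (g X)" using s D'(2)[OF X(1)] by (intro sub[of "s X"]) auto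
    then show False using X(2) by blast
  qed
  have "bad leL D (\<lambda>X. fst (snd (snd (s X))))"
  proof -
    have "subw a w" if "c \<in> cx w" "fst c = Some a" for w c a
      using that by (cases w; cases c) (auto simp: cx_def subw_def, metis)
    moreover have "subw a w" if "c \<in> cx w" "snd (snd (snd c)) = Some a" for w c a
      using that by (cases w; cases c) (auto simp: cx_def subw_def, metis)
    ultimately show ?thesis using dis no[of fst] no[of "\<lambda>c. snd (snd (snd c))"] by blast
  qed
  moreover have "fst (snd (snd (s X))) \<in> set_wt (f X)" if X: "isub X D" for X
  proof -
    have XB: "isub X B" using X D by (rule isub_trans)
    have "fst (snd (snd c)) \<in> set_wt w" if c: "c \<in> cx w" for c and w :: "('i, 'l) wt"
    proof (cases w)
      case (WFix S)
      then obtain i where "c = S i" using c by (auto simp: cx_def)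
      then show ?thesis unfolding WFix set_wt_WFix by (intro UN_I[of i]) (auto split: prod.splits)
    qed (use c in \<open>simp add: cx_def\<close>)
    then have "fst (snd (snd (s X))) \<in> set_wt (g X)" using s[OF XB] by blast
    then show ?thesis using gf[OF XB] set_wt_subw_trancl by (metis subsetD)
  qed
  ultimately show ?thesis
    using isub_trans[OF D B(1)] cont_map[OF contD, of "\<lambda>c. fst (snd (snd c))"] by blast
qed

lemma bqo_words: "bqo leL \<Longrightarrow> bqo leW"
  unfolding bqo_def by (metis bad_words isub_def)

lemma bqo_ctx:
  assumes "bqo leL" shows "bqo (ctxle leW leL)"
  unfolding bqo_def
proof (intro allI impI notI)
  fix A and s :: "nat set \<Rightarrow> ('i, 'l) wt option \<times> bool \<times> 'l \<times> ('i, 'l) wt option"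
  assume A: "infinite A" "cont A s" "bad (ctxle leW leL) A s"
  obtain D where D: "isub D A" and
    dis: "bad (rel_option leW) D (\<lambda>X. fst (s X)) \<or> bad leL D (\<lambda>X. fst (snd (snd (s X)))) \<or>
     bad (rel_option leW) D (\<lambda>X. snd (snd (snd (s X))))" using bad_ctx[OF A] by blast
  have infD: "infinite D" and contD: "cont D s"
    using D A(2) cont_subset by (auto simp: isub_def)
  have no: False if t: "bad (rel_option leW) D (\<lambda>X. t (s X))" for t
  proof -
    obtain D' where D': "isub D' D" "bad leW D' (\<lambda>X. the (t (s X)))"
      using bad_option[OF infD cont_map[OF contD, of t] t] by blast
    have "cont D' (\<lambda>X. the (t (s X)))"
      using cont_map[OF contD, of "\<lambda>c. the (t c)"] D'(1) cont_subset by (auto simp: isub_def)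
    then show False using bqo_words[OF assms] D' unfolding bqo_def isub_def by blast
  qed
  moreover have "\<not> bad leL D (\<lambda>X. fst (snd (snd (s X))))"
    using assms infD cont_map[OF contD, of "\<lambda>c. fst (snd (snd c))"] unfolding bqo_def by blast
  ultimately show False using dis no[of fst] no[of "\<lambda>c. snd (snd (snd c))"] by blast
qed

end

locale graph_order = word_order "rel_option leG" leW
  for leG :: "'i gt \<Rightarrow> 'i gt \<Rightarrow> bool" and leW :: "('i, 'i gt option) wt \<Rightarrow> ('i, 'i gt option) wt \<Rightarrow> bool" +
  assumes leG_trans: "leG x y \<Longrightarrow> leG y z \<Longrightarrow> leG x z"
    and leG_Emp: "leG GEmp x"
    and leG_sub: "subg a w \<Longrightarrow> leG a w"
    and leG_dom: "(\<And>i. \<exists>j. leW (S i) (S' j)) \<Longrightarrow> leG (GFix S) (GFix S')"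
begin

lemma rankedG: "ranked_qo leG subg\<^sup>+\<^sup>+"
proof
  show "leG x z" if "leG x y" "leG y z" for x y z using that by (rule leG_trans)
  show "leG x y" if "subg\<^sup>+\<^sup>+ x y" for x y
    using that by (induction rule: tranclp_induct) (use leG_sub leG_trans in blast)+
  show "subg\<^sup>+\<^sup>+ x z" if "subg\<^sup>+\<^sup>+ x y" "subg\<^sup>+\<^sup>+ y z" for x y z :: "'i gt" using that by (rule tranclp_trans)
  show "wfP (subg\<^sup>+\<^sup>+ :: 'i gt \<Rightarrow> _)" by (rule wfp_tranclp[OF wf_subg])
qed

text \<open>The argument for words one level higher: the members of a graph term are words, and
  \<open>bad_words\<close> turns a bad array of them into a bad array of letters, which are subterms
  of the graph terms.\<close>

lemma bqo_graphs: "bqo leG"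
  unfolding bqo_def
proof (intro allI impI notI)
  fix A f assume A: "infinite A" "cont A f" "bad leG A f"
  interpret ranked_qo leG "subg\<^sup>+\<^sup>+" by (rule rankedG)
  obtain g B where B: "isub B A" "cont B g" "bad leG B g"
    and mn: "\<And>h D. isub D B \<Longrightarrow> cont D h \<Longrightarrow> bad leG D h \<Longrightarrow> \<exists>X. isub X D \<and> \<not> subg\<^sup>+\<^sup>+ (h X) (g X)"
    using minimal_bad_array[OF A] by metis
  have infB: "infinite B" using B(1) by (simp add: isub_def)
  define cx where "cx w = (case w of GEmp \<Rightarrow> {} | GFix S \<Rightarrow> range S)" for w :: "'i gt"
  define pick where "pick = (\<lambda>(w, w'). SOME c. c \<in> cx w \<and> (\<forall>c'\<in>cx w'. \<not> leW c c'))"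
  define s where "s = (\<lambda>X. pick (g X, g (shift X)))"
  have s: "s X \<in> cx (g X) \<and> (\<forall>c'\<in>cx (g (shift X)). \<not> leW (s X) c')" if X: "isub X B" for X
  proof -
    have nle: "\<not> leG (g X) (g (shift X))" "\<not> leG (g (shift X)) (g (shift (shift X)))"
      using B(3) X isub_shift[OF X] by (auto simp: bad_def)
    obtain S where S: "g X = GFix S" using nle(1) leG_Emp by (cases "g X") auto
    obtain S' where S': "g (shift X) = GFix S'" using nle(2) leG_Emp by (cases "g (shift X)") auto
    obtain i where "\<forall>j. \<not> leW (S i) (S' j)" using nle(1) leG_dom S S' by metis
    then have "\<exists>c. c \<in> cx (g X) \<and> (\<forall>c'\<in>cx (g (shift X)). \<not> leW c c')"
      by (auto simp: cx_def S S')
    then show ?thesis unfolding s_def pick_def prod.case by (rule someI_ex)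
  qed
  have contS: "cont B s"
    using cont_map[OF cont_Pair[OF B(2) cont_shift[OF B(2)]], of pick] unfolding s_def .
  have "bad leW B s" unfolding bad_def using s isub_shift by blast
  from bad_words[OF infB contS this]
  obtain D l where D: "isub D B" "cont D l" "bad (rel_option leG) D l"
    "\<And>X. isub X D \<Longrightarrow> l X \<in> set_wt (s X)" by blast
  have infD: "infinite D" using D(1) by (simp add: isub_def)
  obtain D' where D': "isub D' D" "\<And>X. isub X D' \<Longrightarrow> l X \<noteq> None" "bad leG D' (\<lambda>X. the (l X))"
    using bad_option[OF infD D(2,3)] by blast
  have "cont D' (\<lambda>X. the (l X))"
    using cont_map[OF D(2), of the] D'(1) cont_subset by (auto simp: isub_def)
  then obtain X where X: "isub X D'" "\<not> subg\<^sup>+\<^sup>+ (the (l X)) (g X)"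
    using mn[OF isub_trans[OF D'(1) D(1)]] D'(3) by blast
  have XD: "isub X D" using X(1) D'(1) by (rule isub_trans)
  have "Some (the (l X)) \<in> set_wt (s X)" using D(4)[OF XD] D'(2)[OF X(1)] by simp
  moreover have "s X \<in> cx (g X)" using s isub_trans[OF XD D(1)] by blast
  ultimately have "subg (the (l X)) (g X)"
    by (cases "g X") (auto simp: subg_def cx_def)
  then show False using X(2) by blast
qed

lemma bqo_letters: "bqo (rel_option leG)"
  unfolding bqo_def
proof (intro allI impI notI)
  fix A and f :: "nat set \<Rightarrow> 'i gt option"
  assume A: "infinite A" "cont A f" "bad (rel_option leG) A f"
  obtain B where "isub B A" "bad leG B (\<lambda>X. the (f X))" using bad_option[OF A] by blast
  moreover then have "cont B (\<lambda>X. the (f X))"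
    using cont_map[OF A(2), of the] cont_subset by (auto simp: isub_def)
  ultimately show False using bqo_graphs unfolding bqo_def isub_def by blast
qed

end

section \<open>The chain of a root\<close>

locale countable_cograph =
  fixes V :: "'a set" and E :: "'a \<Rightarrow> 'a \<Rightarrow> bool"
  assumes graph: "is_graph V E" and countable_V: "countable V" and cograph: "cograph V E"
begin

lemma E_sym: "E x y = E y x"
  using graph unfolding is_graph_def by blast

lemma E_irrefl: "\<not> E x x"
  using graph unfolding is_graph_def by blast

lemma E_V: "E x y \<Longrightarrow> x \<in> V \<and> y \<in> V"
  using graph unfolding is_graph_def by blast

lemma no_P4:
  assumes "E a b" "E b c" "E c d" "\<not> E a c" "\<not> E b d" "\<not> E a d"
  shows False
proof -
  have "a \<in> V" "b \<in> V" "c \<in> V" "d \<in> V" using assms E_V by blast+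
  moreover have "distinct [a, b, c, d]" using assms E_sym E_irrefl by auto
  ultimately show False using assms cograph unfolding cograph_def by blast
qed

text \<open>Since \<open>P\<^sub>4\<close> is self-complementary, the two colours of pairs are interchangeable.\<close>

lemma no_P4_colour:
  assumes "E a b = e" "E b c = e" "E c d = e" "E a c = (\<not> e)" "E b d = (\<not> e)" "E a d = (\<not> e)"
  shows False
proof (cases e)
  case True
  then show ?thesis using assms no_P4[of a b c d] by simp
next
  case False
  then show ?thesis using assms no_P4[of b d a c] E_sym by metis
qed

text \<open>\<open>lt r H u v\<close> says that some module of the graph on \<open>insert r H\<close> contains \<open>r\<close> and \<open>u\<close>, but not \<open>v\<close>.\<close>

definition lt0 :: "'a \<Rightarrow> 'a \<Rightarrow> 'a \<Rightarrow> bool" where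
  "lt0 r u v \<longleftrightarrow> E r u \<noteq> E r v \<and> E u v = E r v"

definition lt :: "'a \<Rightarrow> 'a set \<Rightarrow> 'a \<Rightarrow> 'a \<Rightarrow> bool" where
  "lt r H u v \<longleftrightarrow> lt0 r u v \<or> (E r u = E r v \<and> (\<exists>w\<in>H. lt0 r u w \<and> lt0 r w v))"

lemma lt0_total: "E r u \<noteq> E r v \<Longrightarrow> lt0 r u v \<or> lt0 r v u"
  unfolding lt0_def using E_sym by metis

lemma lt0_asym: "lt0 r u v \<Longrightarrow> \<not> lt0 r v u"
  unfolding lt0_def using E_sym by metis

text \<open>If it failed for two vertices of equal colour with \<open>w\<close> between them, then
  \<open>v\<close>, \<open>u\<close>, \<open>w\<close>, \<open>r\<close> would be an induced path in
  the opposite colour.\<close>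

lemma lt_label: "lt r H u v \<Longrightarrow> E u v = E r v"
proof -
  assume "lt r H u v"
  then consider "lt0 r u v" | w where "E r u = E r v" "lt0 r u w" "lt0 r w v"
    unfolding lt_def by blast
  then show ?thesis
  proof cases
    case 1
    then show ?thesis by (simp add: lt0_def)
  next
    case 2
    show ?thesis
    proof (rule ccontr)
      assume "E u v \<noteq> E r v"
      then show False
        using 2 no_P4_colour[of v u "\<not> E r v" w r] E_sym[of v u] E_sym[of w r] E_sym[of v w] E_sym[of u r] E_sym[of v r]
        unfolding lt0_def by metis
    qed
  qed
qed

text \<open>For equal colours, witnesses \<open>w\<close> and \<open>w'\<close> for both directions
  give the forbidden path \<open>u\<close>, \<open>w\<close>, \<open>w'\<close>, \<open>v\<close> or
  the path \<open>u\<close>, \<open>w\<close>, \<open>r\<close>, \<open>w'\<close>, depending on the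
  colour of the pair \<open>w\<close>, \<open>w'\<close>.\<close>

lemma lt_asym:
  assumes "lt r H u v" shows "\<not> lt r H v u"
proof
  assume vu: "lt r H v u"
  show False
  proof (cases "E r u = E r v")
    case False
    then show False using assms vu lt0_asym unfolding lt_def by metis
  next
    case True
    then obtain w w' where w: "lt0 r u w" "lt0 r w v" "lt0 r v w'" "lt0 r w' u"
      using assms vu unfolding lt_def by (metis lt0_def)
    have uv: "E u v = E r v" using assms by (rule lt_label)
    show False
    proof (cases "E w w' = E r w")
      case True
      then show False
        using w uv no_P4_colour[of u w "E r w" w' v] E_sym[of w' v] E_sym[of w' u] unfolding lt0_def by metis
    next
      case False
      then show False
        using w no_P4_colour[of u w "E r w" r w'] E_sym[of w r] E_sym[of u r] E_sym[of w' u] unfolding lt0_def by metis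
    qed
  qed
qed

lemma lt0_negtrans:
  assumes "lt0 r u w" "u \<in> H" "w \<in> H"
  shows "lt r H u v \<or> lt r H v w"
proof (cases "E r v = E r u")
  case True
  then have "E r v \<noteq> E r w" using assms(1) by (simp add: lt0_def)
  then consider "lt0 r v w" | "lt0 r w v" using lt0_total by blast
  then show ?thesis
  proof cases
    case 2
    then show ?thesis using True assms unfolding lt_def by metis
  qed (simp add: lt_def)
next
  case False
  then consider "lt0 r u v" | "lt0 r v u" using lt0_total by metis
  then show ?thesis
  proof cases
    case 2
    have "E r v = E r w" using False assms(1) by (auto simp: lt0_def)
    then show ?thesis using 2 assms unfolding lt_def by metis
  qed (simp add: lt_def)
qed

text \<open>With asymmetry this makes \<open>lt\<close> a strict weak order on \<open>H\<close>:
  incomparability is an equivalence, whose classes are given by \<open>cls\<close>.\<close>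

lemma lt_negtrans:
  assumes "lt r H u w" "u \<in> H" "w \<in> H"
  shows "lt r H u v \<or> lt r H v w"
proof (cases "lt0 r u w")
  case True
  then show ?thesis using assms by (intro lt0_negtrans)
next
  case False
  then obtain x where x: "x \<in> H" "lt0 r u x" "lt0 r x w" "E r u = E r w"
    using assms(1) unfolding lt_def by blast
  show ?thesis
  proof (rule ccontr)
    assume no: "\<not> ?thesis"
    then have vx: "lt r H v x" using lt0_negtrans[OF x(2) assms(2) x(1)] by blast
    have xv: "lt r H x v" using no lt0_negtrans[OF x(3,1) assms(3)] by blast
    show False using vx xv lt_asym by blast
  qed
qed

lemma lt_trans:
  assumes "lt r H u v" "lt r H v w" "u \<in> H" "v \<in> H"
  shows "lt r H u w"
  using lt_negtrans[OF assms(1,3,4), of w] assms(2) lt_asym by blast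

lemma lt_irrefl: "\<not> lt r H u u"
  using lt_asym by blast

text \<open>A splitting of the chain: a pair from different blocks has the colour of its later
  member. \<open>C\<close> may be any block of one colour, so the images of classes under embeddings
  are covered as well.\<close>

definition tri :: "'a \<Rightarrow> 'a set \<Rightarrow> 'a set \<Rightarrow> 'a set \<Rightarrow> bool" where
  "tri r A C D \<longleftrightarrow> A \<inter> C = {} \<and> A \<inter> D = {} \<and> C \<inter> D = {} \<and> (\<forall>c\<in>C. \<forall>c'\<in>C. E r c = E r c') \<and>
     (\<forall>a\<in>A. \<forall>c\<in>C. E a c = E r c) \<and> (\<forall>a\<in>A. \<forall>d\<in>D. E a d = E r d) \<and> (\<forall>c\<in>C. \<forall>d\<in>D. E c d = E r d)"

definition cls :: "'a \<Rightarrow> 'a set \<Rightarrow> 'a \<Rightarrow> 'a set" where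
  "cls r H v = {u \<in> H. \<not> lt r H u v \<and> \<not> lt r H v u}"

lemma cls_self: "v \<in> H \<Longrightarrow> v \<in> cls r H v"
  by (simp add: cls_def lt_irrefl)

lemma cls_label: "u \<in> cls r H v \<Longrightarrow> E r u = E r v"
  using lt0_total[of r u v] unfolding cls_def lt_def by blast

lemma tri_cls:
  assumes v: "v \<in> H"
  shows "tri r {u\<in>H. lt r H u v} (cls r H v) {u\<in>H. lt r H v u}"
    and "H = {u\<in>H. lt r H u v} \<union> cls r H v \<union> {u\<in>H. lt r H v u}"
proof -
  have ac: "lt r H a c" if "a \<in> H" "lt r H a v" "c \<in> cls r H v" for a c
    using lt_negtrans[OF that(2,1) v, of c] that by (simp add: cls_def)
  have cd: "lt r H c d" if "d \<in> H" "lt r H v d" "c \<in> cls r H v" for d c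
    using lt_negtrans[OF that(2) v that(1), of c] that by (simp add: cls_def)
  have ad: "lt r H a d" if "a \<in> H" "d \<in> H" "lt r H a v" "lt r H v d" for a d
    using lt_trans[OF that(3,4,1) v] .
  show "tri r {u\<in>H. lt r H u v} (cls r H v) {u\<in>H. lt r H v u}"
    unfolding tri_def
  proof (intro conjI ballI)
    show "{u \<in> H. lt r H u v} \<inter> {u \<in> H. lt r H v u} = {}" using lt_asym by blast
    show "E r c = E r c'" if "c \<in> cls r H v" "c' \<in> cls r H v" for c c'
      using that cls_label by metis
    show "E a c = E r c" if "a \<in> {u \<in> H. lt r H u v}" "c \<in> cls r H v" for a c
      using that ac lt_label by blast
    show "E a d = E r d" if "a \<in> {u \<in> H. lt r H u v}" "d \<in> {u \<in> H. lt r H v u}" for a d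
      using that ad lt_label by blast
    show "E c d = E r d" if "c \<in> cls r H v" "d \<in> {u \<in> H. lt r H v u}" for c d
      using that cd lt_label by blast
  qed (auto simp: cls_def)
  show "H = {u\<in>H. lt r H u v} \<union> cls r H v \<union> {u\<in>H. lt r H v u}"
    by (auto simp: cls_def)
qed

section \<open>Embeddings of graphs and of rooted pieces\<close>

definition gle :: "'a set \<Rightarrow> 'a set \<Rightarrow> bool" where
  "gle K K' \<longleftrightarrow> (\<exists>f. inj_on f K \<and> f ` K \<subseteq> K' \<and> (\<forall>u\<in>K. \<forall>v\<in>K. E u v = E (f u) (f v)))"

definition remb :: "('a \<Rightarrow> 'a) \<Rightarrow> 'a \<Rightarrow> 'a set \<Rightarrow> 'a \<Rightarrow> 'a set \<Rightarrow> bool" where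
  "remb f r H r' H' \<longleftrightarrow> inj_on f H \<and> f ` H \<subseteq> H' \<and> (\<forall>u\<in>H. \<forall>v\<in>H. E u v = E (f u) (f v)) \<and>
     (\<forall>u\<in>H. E r u = E r' (f u))"

definition wle :: "'a \<Rightarrow> 'a set \<Rightarrow> 'a \<Rightarrow> 'a set \<Rightarrow> bool" where
  "wle r H r' H' \<longleftrightarrow> (\<exists>f. remb f r H r' H')"

text \<open>\<open>tri\<close> refined at a vertex \<open>v\<close> of the middle block, whose
  remainder \<open>B\<close> is to be treated as a piece rooted at \<open>v\<close>; the pairs of
  \<open>v\<close> with \<open>B\<close> are its colours.\<close>

definition rtri :: "'a \<Rightarrow> 'a \<Rightarrow> 'a set \<Rightarrow> 'a set \<Rightarrow> 'a set \<Rightarrow> bool" where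
  "rtri r v A B D \<longleftrightarrow> v \<notin> A \<and> v \<notin> B \<and> v \<notin> D \<and> A \<inter> B = {} \<and> A \<inter> D = {} \<and> B \<inter> D = {} \<and>
     (\<forall>a\<in>A. E a v = E r v) \<and> (\<forall>b\<in>B. E r b = E r v) \<and> (\<forall>d\<in>D. E v d = E r d) \<and>
     (\<forall>a\<in>A. \<forall>b\<in>B. E a b = E r v) \<and> (\<forall>a\<in>A. \<forall>d\<in>D. E a d = E r d) \<and> (\<forall>b\<in>B. \<forall>d\<in>D. E b d = E r d)"

text \<open>Pairs from different outer blocks depend on colours only. The pairs of \<open>v\<close>
  with the rest of its block are preserved because \<open>g\<close> is a rooted embedding for the
  roots \<open>v\<close> and \<open>v'\<close>.\<close>

lemma remb_glue:
  assumes t: "rtri r v A B D" and t': "rtri r' v' A' B' D'" and lab: "E r v = E r' v'"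
    and fA: "remb f r A r' A'" and fB: "remb g v B v' B'" and fD: "remb h r D r' D'"
    and H': "v' \<in> H'" "A' \<subseteq> H'" "B' \<subseteq> H'" "D' \<subseteq> H'"
    and k: "\<And>u. k u = (if u = v then v' else if u \<in> A then f u else if u \<in> B then g u else h u)"
  shows "remb k r (insert v (A \<union> B \<union> D)) r' H'"
proof -
  have kv: "k v = v'" by (simp add: k)
  have kA: "k u = f u \<and> f u \<in> A'" if "u \<in> A" for u
    using that t fA by (auto simp: k rtri_def remb_def)
  have kB: "k u = g u \<and> g u \<in> B'" if "u \<in> B" for u
    using that t fB by (auto simp: k rtri_def remb_def)
  have kD: "k u = h u \<and> h u \<in> D'" if "u \<in> D" for u
    using that t fD by (auto simp: k rtri_def remb_def)
  have sub: "k ` insert v (A \<union> B \<union> D) \<subseteq> H'" using kv kA kB kD H' by auto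
  have inj: "inj_on k (insert v (A \<union> B \<union> D))"
  proof (rule inj_onI)
    fix x y assume x: "x \<in> insert v (A \<union> B \<union> D)" and y: "y \<in> insert v (A \<union> B \<union> D)" and eq: "k x = k y"
    have fi: "inj_on f A" "inj_on g B" "inj_on h D" using fA fB fD by (auto simp: remb_def)
    have dis: "v' \<notin> A'" "v' \<notin> B'" "v' \<notin> D'"
       "\<And>z. z \<in> A' \<Longrightarrow> z \<notin> B'" "\<And>z. z \<in> A' \<Longrightarrow> z \<notin> D'" "\<And>z. z \<in> B' \<Longrightarrow> z \<notin> D'"
      using t' by (auto simp: rtri_def disjoint_iff)
    consider "x = v" | "x \<in> A" | "x \<in> B" | "x \<in> D" using x by blast
    then show "x = y"
    proof cases
      case 1
      then show ?thesis using y eq kv kA kB kD dis by (metis Un_iff insert_iff)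
    next
      case 2
      then have "k x \<in> A'" "k x = f x" using kA by auto
      then have "y \<in> A" using y eq kv kB kD dis by (metis Un_iff insert_iff)
      then show ?thesis using 2 eq kA fi(1) by (metis inj_onD)
    next
      case 3
      then have "k x \<in> B'" "k x = g x" using kB by auto
      then have "y \<in> B" using y eq kv kA kD dis by (metis Un_iff insert_iff)
      then show ?thesis using 3 eq kB fi(2) by (metis inj_onD)
    next
      case 4
      then have "k x \<in> D'" "k x = h x" using kD by auto
      then have "y \<in> D" using y eq kv kA kB dis by (metis Un_iff insert_iff)
      then show ?thesis using 4 eq kD fi(3) by (metis inj_onD)
    qed
  qed
  have labk: "E r u = E r' (k u)" if "u \<in> insert v (A \<union> B \<union> D)" for u
    using that
  proof (elim insertE UnE)
    assume "u \<in> B"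
    then have "E r u = E r v" "E r' (k u) = E r' v'" using t t' kB by (auto simp: rtri_def)
    then show ?thesis using lab by simp
  qed (use kv lab kA kD fA fD in \<open>auto simp: remb_def\<close>)
  have half: "E x y = E (k x) (k y)"
    if "x = v \<and> y \<in> insert v (A \<union> B \<union> D) \<or> x \<in> A \<and> y \<in> A \<union> B \<union> D \<or> x \<in> B \<and> y \<in> B \<union> D \<or> x \<in> D \<and> y \<in> D" for x y
    using that
  proof (elim disjE conjE)
    assume "x = v" "y \<in> insert v (A \<union> B \<union> D)"
    then show ?thesis
    proof (elim insertE UnE)
      assume "x = v" "y = v"
      then show ?thesis using E_irrefl by simp
    next
      assume "x = v" "y \<in> A"
      then have "E y v = E r v" "E (k y) v' = E r' v'" using t t' kA by (auto simp: rtri_def)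
      then show ?thesis using \<open>x = v\<close> kv lab E_sym by metis
    next
      assume "x = v" "y \<in> B"
      then show ?thesis using fB kB kv by (auto simp: remb_def)
    next
      assume y: "x = v" "y \<in> D"
      then have "E v y = E r y" "E v' (k y) = E r' (k y)" using t t' kD by (auto simp: rtri_def)
      then show ?thesis using y kv labk[of y] by simp
    qed
  next
    assume x: "x \<in> A" and "y \<in> A \<union> B \<union> D"
    then consider "y \<in> A" | "y \<in> B" | "y \<in> D" by blast
    then show ?thesis
    proof cases
      case 1
      then show ?thesis using x fA kA by (auto simp: remb_def)
    next
      case 2
      then have "E x y = E r v" "E (k x) (k y) = E r' v'" using x t t' kA kB by (auto simp: rtri_def)
      then show ?thesis using lab by simp
    next
      case 3
      then have "E x y = E r y" "E (k x) (k y) = E r' (k y)" using x t t' kA kD by (auto simp: rtri_def)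
      then show ?thesis using 3 labk[of y] by simp
    qed
  next
    assume x: "x \<in> B" and "y \<in> B \<union> D"
    then consider "y \<in> B" | "y \<in> D" by blast
    then show ?thesis
    proof cases
      case 1
      then show ?thesis using x fB kB by (auto simp: remb_def)
    next
      case 2
      then have "E x y = E r y" "E (k x) (k y) = E r' (k y)" using x t t' kB kD by (auto simp: rtri_def)
      then show ?thesis using 2 labk[of y] by simp
    qed
  next
    assume "x \<in> D" "y \<in> D"
    then show ?thesis using fD kD by (auto simp: remb_def)
  qed
  have "E x y = E (k x) (k y)" if "x \<in> insert v (A \<union> B \<union> D)" "y \<in> insert v (A \<union> B \<union> D)" for x y
    using half[of x y] half[of y x] that E_sym by (metis Un_iff insert_iff)
  then show ?thesis unfolding remb_def using inj sub labk by (intro conjI ballI)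
qed

lemma remb_subset: "remb f r H r' H' \<Longrightarrow> A \<subseteq> H \<Longrightarrow> remb f r A r' H'"
  unfolding remb_def by (meson image_mono inj_on_subset subset_iff subset_trans)

lemma remb_cong: "remb f r H r' H' \<Longrightarrow> (\<And>u. u \<in> H \<Longrightarrow> g u = f u) \<Longrightarrow> remb g r H r' H'"
proof -
  assume f: "remb f r H r' H'" and g: "\<And>u. u \<in> H \<Longrightarrow> g u = f u"
  have "inj_on g H" using f g by (auto simp: remb_def cong: inj_on_cong)
  then show ?thesis using f g by (auto simp: remb_def)
qed

end

primrec stepemb :: "('a \<times> 'a set \<times> 'a \<times> 'a set \<Rightarrow> 'a \<times> 'a set \<times> 'a set \<times> 'a set \<times> 'a \<times> 'a set \<times> 'a set \<times> 'a set) \<Rightarrow>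
    nat \<Rightarrow> 'a \<times> 'a set \<times> 'a \<times> 'a set \<Rightarrow> 'a \<Rightarrow> 'a" where
  "stepemb nx 0 q u = u"
| "stepemb nx (Suc n) q u = (case q of (r, H, r', H') \<Rightarrow> case nx q of (v, A, B, D, v', A', B', D') \<Rightarrow>
     if u = v then v' else if u \<in> A then stepemb nx n (r, A, r', A') u
     else if u \<in> B then stepemb nx n (v, B, v', B') u else stepemb nx n (r, D, r', D') u)"

context countable_cograph
begin

text \<open>Each vertex is placed after finitely many expansions, because the vertex of least index is always
  expanded first; \<open>stepemb\<close> runs this recursion with a bound on the depth.\<close>

lemma wle_limit:
  assumes closed: "\<And>r H r' H' v. R r H r' H' \<Longrightarrow> v \<in> H \<Longrightarrow> \<exists>A B D v' A' B' D'.
       H = insert v (A \<union> B \<union> D) \<and> rtri r v A B D \<and> v' \<in> H' \<and> A' \<subseteq> H' \<and> B' \<subseteq> H' \<and> D' \<subseteq> H' \<and>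
       rtri r' v' A' B' D' \<and> E r v = E r' v' \<and> R r A r' A' \<and> R v B v' B' \<and> R r D r' D'"
    and sub: "\<And>r H r' H'. R r H r' H' \<Longrightarrow> H \<subseteq> V"
    and R0: "R r0 H0 r0' H0'"
  shows "wle r0 H0 r0' H0'"
proof -
  define ix where "ix = to_nat_on V"
  have ix_inj: "inj_on ix V" unfolding ix_def using countable_V by (rule inj_on_to_nat_on)
  define lv where "lv H = (SOME v. v \<in> H \<and> (\<forall>u\<in>H. ix v \<le> ix u))" for H
  have lv: "lv H \<in> H \<and> (\<forall>u\<in>H. ix (lv H) \<le> ix u)" if ne: "H \<noteq> {}" for H
  proof -
    obtain v where "v \<in> H" using ne by blast
    then have "\<exists>v. v \<in> H \<and> (\<forall>u. u \<in> H \<longrightarrow> ix v \<le> ix u)" by (rule ex_has_least_nat)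
    then have "\<exists>v. v \<in> H \<and> (\<forall>u\<in>H. ix v \<le> ix u)" by blast
    then show ?thesis unfolding lv_def by (rule someI_ex)
  qed
  have "\<forall>q. \<exists>t. case q of (r, H, r', H') \<Rightarrow> case t of (v, A, B, D, v', A', B', D') \<Rightarrow>
      R r H r' H' \<longrightarrow> H \<noteq> {} \<longrightarrow> v = lv H \<and>
       H = insert v (A \<union> B \<union> D) \<and> rtri r v A B D \<and> v' \<in> H' \<and> A' \<subseteq> H' \<and> B' \<subseteq> H' \<and> D' \<subseteq> H' \<and>
       rtri r' v' A' B' D' \<and> E r v = E r' v' \<and> R r A r' A' \<and> R v B v' B' \<and> R r D r' D'"
  proof (intro allI, clarify)
    fix r H r' H'
    show "\<exists>t. case t of (v, A, B, D, v', A', B', D') \<Rightarrow>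
      R r H r' H' \<longrightarrow> H \<noteq> {} \<longrightarrow> v = lv H \<and>
       H = insert v (A \<union> B \<union> D) \<and> rtri r v A B D \<and> v' \<in> H' \<and> A' \<subseteq> H' \<and> B' \<subseteq> H' \<and> D' \<subseteq> H' \<and>
       rtri r' v' A' B' D' \<and> E r v = E r' v' \<and> R r A r' A' \<and> R v B v' B' \<and> R r D r' D'"
    proof (cases "R r H r' H' \<and> H \<noteq> {}")
      case True
      then obtain A B D v' A' B' D' where
        "H = insert (lv H) (A \<union> B \<union> D) \<and> rtri r (lv H) A B D \<and> v' \<in> H' \<and> A' \<subseteq> H' \<and> B' \<subseteq> H' \<and> D' \<subseteq> H' \<and>
       rtri r' v' A' B' D' \<and> E r (lv H) = E r' v' \<and> R r A r' A' \<and> R (lv H) B v' B' \<and> R r D r' D'"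
        using closed[of r H r' H' "lv H"] lv[of H] by blast
      then show ?thesis by (intro exI[of _ "(lv H, A, B, D, v', A', B', D')"]) simp
    qed auto
  qed
  from choice[OF this] obtain nx where nx0: "\<forall>q. case q of (r, H, r', H') \<Rightarrow> case nx q of (v, A, B, D, v', A', B', D') \<Rightarrow>
      R r H r' H' \<longrightarrow> H \<noteq> {} \<longrightarrow> v = lv H \<and>
       H = insert v (A \<union> B \<union> D) \<and> rtri r v A B D \<and> v' \<in> H' \<and> A' \<subseteq> H' \<and> B' \<subseteq> H' \<and> D' \<subseteq> H' \<and>
       rtri r' v' A' B' D' \<and> E r v = E r' v' \<and> R r A r' A' \<and> R v B v' B' \<and> R r D r' D'"
    by (rule exE)
  have nxE: "\<exists>v A B D v' A' B' D'. nx (r, H, r', H') = (v, A, B, D, v', A', B', D') \<and> v = lv H \<and>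
       H = insert v (A \<union> B \<union> D) \<and> rtri r v A B D \<and> v' \<in> H' \<and> A' \<subseteq> H' \<and> B' \<subseteq> H' \<and> D' \<subseteq> H' \<and>
       rtri r' v' A' B' D' \<and> E r v = E r' v' \<and> R r A r' A' \<and> R v B v' B' \<and> R r D r' D' \<and>
       (\<forall>u\<in>A \<union> B \<union> D. ix v < ix u)"
    if RH: "R r H r' H'" "H \<noteq> {}" for r H r' H'
  proof -
    obtain v A B D v' A' B' D' where eq: "nx (r, H, r', H') = (v, A, B, D, v', A', B', D')"
      by (metis prod.collapse)
    then have f: "v = lv H" "H = insert v (A \<union> B \<union> D)" "rtri r v A B D" "v' \<in> H'" "A' \<subseteq> H'" "B' \<subseteq> H'" "D' \<subseteq> H'"
       "rtri r' v' A' B' D'" "E r v = E r' v'" "R r A r' A'" "R v B v' B'" "R r D r' D'"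
      using nx0[THEN spec, of "(r, H, r', H')", unfolded eq prod.case, THEN mp, THEN mp, OF RH] by blast+
    have "ix v < ix u" if u: "u \<in> A \<union> B \<union> D" for u
    proof -
      have "u \<in> H" using u f(2) by blast
      then have "ix v \<le> ix u" using lv[OF RH(2)] f(1) by blast
      moreover have "u \<noteq> v" using u f(3) by (auto simp: rtri_def)
      moreover have "u \<in> V" "v \<in> V" using sub[OF RH(1)] \<open>u \<in> H\<close> f(2) by blast+
      ultimately show ?thesis using ix_inj by (metis inj_onD le_neq_implies_less)
    qed
    then show ?thesis using eq f by blast
  qed
  \<comment> \<open>Every expansion uses up the least index and so raises the lower bound
    \<open>k\<close> by one; depth \<open>n\<close> therefore reaches all indices below
    \<open>k + n\<close>.\<close>
  have main: "remb (stepemb nx n (r, H, r', H')) r {u\<in>H. ix u < k + n} r' H'"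
    if "R r H r' H'" "\<forall>u\<in>H. k \<le> ix u" for n k r H r' H'
    using that
  proof (induction n arbitrary: k r H r' H')
    case 0
    \<comment> \<open>At depth 0 no vertex is claimed, so the default value of
      \<open>stepemb\<close> does not enter.\<close>
    then have "{u\<in>H. ix u < k + 0} = {}" by auto
    then show ?case by (simp only:) (simp add: remb_def)
  next
    case (Suc n)
    show ?case
    proof (cases "H = {}")
      case True
      then show ?thesis by (simp add: remb_def)
    next
      case False
      obtain v A B D v' A' B' D' where nx: "nx (r, H, r', H') = (v, A, B, D, v', A', B', D')" "v = lv H"
       "H = insert v (A \<union> B \<union> D)" "rtri r v A B D" "v' \<in> H'" "A' \<subseteq> H'" "B' \<subseteq> H'" "D' \<subseteq> H'"
       "rtri r' v' A' B' D'" "E r v = E r' v'" "R r A r' A'" "R v B v' B'" "R r D r' D'"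
       "\<forall>u\<in>A \<union> B \<union> D. ix v < ix u" using nxE[OF Suc.prems(1) False] by blast
      have vH: "v \<in> H" using nx(3) by blast
      have kv: "k \<le> ix v" using Suc.prems(2) vH by blast
      have gt: "\<forall>u\<in>A \<union> B \<union> D. Suc k \<le> ix u" using nx(14) kv by (meson Suc_leI le_less_trans)
      let ?c = "\<lambda>A. {u\<in>A. ix u < Suc k + n}"
      have IH: "remb (stepemb nx n (r, A, r', A')) r (?c A) r' A'"
        "remb (stepemb nx n (v, B, v', B')) v (?c B) v' B'"
        "remb (stepemb nx n (r, D, r', D')) r (?c D) r' D'"
        using Suc.IH[OF nx(11), of "Suc k"] Suc.IH[OF nx(12), of "Suc k"] Suc.IH[OF nx(13), of "Suc k"] gt by auto
      have t: "rtri r v (?c A) (?c B) (?c D)" using nx(4) by (auto simp: rtri_def)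
      define kk where "kk u = (if u = v then v' else if u \<in> ?c A then stepemb nx n (r, A, r', A') u
        else if u \<in> ?c B then stepemb nx n (v, B, v', B') u else stepemb nx n (r, D, r', D') u)" for u
      have "remb kk r (insert v (?c A \<union> ?c B \<union> ?c D)) r' H'"
        by (rule remb_glue[OF t nx(9) nx(10) IH nx(5-8) kk_def])
      then have "remb kk r {u\<in>H. ix u < k + Suc n} r' H'"
        by (rule remb_subset) (use nx(3) in auto)
      then show ?thesis
        by (rule remb_cong) (use nx(1) in \<open>auto simp: kk_def\<close>)
    qed
  qed
  \<comment> \<open>More depth leaves assigned values unchanged, so the partial embeddings have a
    common extension.\<close>
  have stab: "stepemb nx (Suc n) (r, H, r', H') u = stepemb nx n (r, H, r', H') u"
    if "R r H r' H'" "\<forall>u\<in>H. k \<le> ix u" "u \<in> H" "ix u < k + n" for n k r H r' H' u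
    using that
  proof (induction n arbitrary: k r H r' H')
    case 0
    then show ?case by auto
  next
    case (Suc n)
    then have ne: "H \<noteq> {}" by blast
    obtain v A B D v' A' B' D' where nx: "nx (r, H, r', H') = (v, A, B, D, v', A', B', D')" "v = lv H"
       "H = insert v (A \<union> B \<union> D)" "rtri r v A B D" "R r A r' A'" "R v B v' B'" "R r D r' D'"
       "\<forall>u\<in>A \<union> B \<union> D. ix v < ix u" using nxE[OF Suc.prems(1) ne] by blast
    have "k \<le> ix v" using Suc.prems(2) nx(3) by blast
    then have gt: "\<forall>u\<in>A \<union> B \<union> D. Suc k \<le> ix u" using nx(8) by (meson Suc_leI le_less_trans)
    have lt: "ix u < Suc k + n" using Suc.prems(4) by simp
    consider "u = v" | "u \<noteq> v" "u \<in> A" | "u \<noteq> v" "u \<notin> A" "u \<in> B" | "u \<noteq> v" "u \<notin> A" "u \<notin> B" "u \<in> D"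
      using Suc.prems(3) nx(3) by blast
    then show ?case
    proof cases
      case 1
      then show ?thesis using nx(1) by simp
    next
      case 2
      then show ?thesis using nx(1) Suc.IH[OF nx(5) _ _ lt] gt by (simp del: stepemb.simps(2) add: stepemb.simps(2)[of nx "Suc n"] stepemb.simps(2)[of nx n "(r, H, r', H')"])
    next
      case 3
      then show ?thesis using nx(1) Suc.IH[OF nx(6) _ _ lt] gt by (simp del: stepemb.simps(2) add: stepemb.simps(2)[of nx "Suc n"] stepemb.simps(2)[of nx n "(r, H, r', H')"])
    next
      case 4
      then show ?thesis using nx(1) Suc.IH[OF nx(7) _ _ lt] gt by (simp del: stepemb.simps(2) add: stepemb.simps(2)[of nx "Suc n"] stepemb.simps(2)[of nx n "(r, H, r', H')"])
    qed
  qed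
  let ?q = "(r0, H0, r0', H0')"
  have st: "stepemb nx m ?q u = stepemb nx n ?q u" if "u \<in> H0" "ix u < n" "n \<le> m" for u n m
    using that(3)
  proof (induction m rule: dec_induct)
    case (step m)
    then show ?case using stab[OF R0, of 0 u m] that by simp
  qed simp
  define f where "f u = stepemb nx (Suc (ix u)) ?q u" for u
  have f_eq: "f u = stepemb nx n ?q u" if "u \<in> H0" "ix u < n" for u n
    unfolding f_def using st[of u "Suc (ix u)" n] that by simp
  have fin: "remb f r0 {u\<in>H0. ix u < n} r0' H0'" for n
    by (rule remb_cong[OF main[OF R0, of 0 n, simplified]]) (use f_eq in auto)
  have "remb f r0 H0 r0' H0'"
    unfolding remb_def
  proof (intro conjI ballI)
    show "inj_on f H0"
    proof (rule inj_onI)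
      fix x y assume "x \<in> H0" "y \<in> H0" "f x = f y"
      then show "x = y" using fin[of "Suc (max (ix x) (ix y))"] unfolding remb_def inj_on_def
        by (simp add: less_Suc_eq_le)
    qed
    show "f ` H0 \<subseteq> H0'"
    proof
      fix y assume "y \<in> f ` H0"
      then obtain x where "x \<in> H0" "y = f x" by blast
      then show "y \<in> H0'" using fin[of "Suc (ix x)"] unfolding remb_def by auto
    qed
    show "E u v = E (f u) (f v)" if "u \<in> H0" "v \<in> H0" for u v
      using that fin[of "Suc (max (ix u) (ix v))"] unfolding remb_def by (simp add: less_Suc_eq_le)
    show "E r0 u = E r0' (f u)" if "u \<in> H0" for u
      using that fin[of "Suc (ix u)"] unfolding remb_def by simp
  qed
  then show ?thesis by (auto simp: wle_def)
qed

end

section \<open>Chains and graphs described by terms\<close>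

text \<open>Down-sets of a better-quasi-order satisfy the descending chain condition: elements lost
  at successive stages would form a bad sequence.\<close>

lemma minimal_downset:
  assumes bqo: "bqo le"
    and mono: "\<And>A B. A \<subseteq> B \<Longrightarrow> I A \<subseteq> I B"
    and down: "\<And>A x y. y \<in> I A \<Longrightarrow> le x y \<Longrightarrow> x \<in> I A"
    and P: "P (K :: 'a set)"
  shows "\<exists>M\<subseteq>K. P M \<and> (\<forall>N\<subseteq>M. P N \<longrightarrow> I N = I M)"
proof (rule ccontr)
  assume no: "\<not> ?thesis"
  have step: "\<exists>N. (N \<subseteq> K \<and> P N) \<and> N \<subseteq> M \<and> I N \<subset> I M" if "M \<subseteq> K \<and> P M" for M
  proof -
    have "\<not> (\<forall>N\<subseteq>M. P N \<longrightarrow> I N = I M)" using no \<open>M \<subseteq> K \<and> P M\<close> by blast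
    then obtain N where N: "N \<subseteq> M" "P N" "I N \<noteq> I M" by blast
    then have "I N \<subset> I M" using mono[of N M] by blast
    then show ?thesis using N \<open>M \<subseteq> K \<and> P M\<close> by (intro exI[of _ N]) auto
  qed
  have "\<exists>M. \<forall>n. (M n \<subseteq> K \<and> P (M n)) \<and> (M (Suc n) \<subseteq> M n \<and> I (M (Suc n)) \<subset> I (M n))"
    using P step by (intro dependent_nat_choice) auto
  then obtain M where "\<forall>n. (M n \<subseteq> K \<and> P (M n)) \<and> (M (Suc n) \<subseteq> M n \<and> I (M (Suc n)) \<subset> I (M n))" by (rule exE)
  then have M: "\<And>n. I (M (Suc n)) \<subset> I (M n)" by simp
  then have "\<forall>n. \<exists>x. x \<in> I (M n) \<and> x \<notin> I (M (Suc n))" by blast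
  then obtain x where x: "\<And>n. x n \<in> I (M n)" "\<And>n. x n \<notin> I (M (Suc n))" by metis
  obtain i j where ij: "i < j" "le (x i) (x j)" using bqo_imp_good[OF bqo, of x] by blast
  have "I (M j) \<subseteq> I (M (Suc i))"
  proof (rule lift_Suc_antimono_le[of "\<lambda>n. I (M n)"])
    show "I (M (Suc n)) \<subseteq> I (M n)" for n using M[of n] by (rule psubset_imp_subset)
    show "Suc i \<le> j" using ij(1) by simp
  qed
  then have "x j \<in> I (M (Suc i))" using x(1) by blast
  then show False using down ij(2) x(2) by blast
qed

text \<open>As a letter, \<open>None\<close> stands for the graph that is being described;
  \<open>N\<close> supplies its meaning.\<close>

definition lft :: "('a set \<Rightarrow> bool) \<Rightarrow> ('g \<Rightarrow> 'a set \<Rightarrow> bool) \<Rightarrow> 'g option \<Rightarrow> 'a set \<Rightarrow> bool" where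
  "lft N L = (\<lambda>l. case l of None \<Rightarrow> N | Some b \<Rightarrow> L b)"

lemma lft_simps [simp]: "lft N L None = N" "lft N L (Some b) = L b"
  by (simp_all add: lft_def)

lemma lft_mono:
  assumes "lft N L l C" and N: "\<And>C. N C \<Longrightarrow> N' C" and L: "\<And>b C. L b C \<Longrightarrow> L' b C"
  shows "lft N' L' l C"
proof (cases l)
  case None
  then show ?thesis using assms(1) N by (simp only: lft_simps)
next
  case (Some b)
  then show ?thesis using assms(1) L by (simp only: lft_simps)
qed

context countable_cograph
begin

lemma triD:
  assumes "tri r A C D"
  shows "A \<inter> C = {}" "A \<inter> D = {}" "C \<inter> D = {}"
    "\<And>c c'. c \<in> C \<Longrightarrow> c' \<in> C \<Longrightarrow> E r c = E r c'" "\<And>a c. a \<in> A \<Longrightarrow> c \<in> C \<Longrightarrow> E a c = E r c"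
    "\<And>a d. a \<in> A \<Longrightarrow> d \<in> D \<Longrightarrow> E a d = E r d" "\<And>c d. c \<in> C \<Longrightarrow> d \<in> D \<Longrightarrow> E c d = E r d"
proof -
  note c1 = assms[unfolded tri_def]
  note c2 = conjunct2[OF c1] note c3 = conjunct2[OF c2] note c4 = conjunct2[OF c3]
  note c5 = conjunct2[OF c4] note c6 = conjunct2[OF c5] note c7 = conjunct2[OF c6]
  note t = conjunct1[OF c1] conjunct1[OF c2] conjunct1[OF c3] conjunct1[OF c4] conjunct1[OF c5] conjunct1[OF c6] c7
  show "A \<inter> C = {}" "A \<inter> D = {}" "C \<inter> D = {}" by (fact t)+
  show "E r c = E r c'" if "c \<in> C" "c' \<in> C" for c c' by (rule bspec[OF bspec[OF t(4) that(1)] that(2)])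
  show "E a c = E r c" if "a \<in> A" "c \<in> C" for a c by (rule bspec[OF bspec[OF t(5) that(1)] that(2)])
  show "E a d = E r d" if "a \<in> A" "d \<in> D" for a d by (rule bspec[OF bspec[OF t(6) that(1)] that(2)])
  show "E c d = E r d" if "c \<in> C" "d \<in> D" for c d by (rule bspec[OF bspec[OF t(7) that(1)] that(2)])
qed

text \<open>In both steps \<open>P\<close> interprets proper subwords, and \<open>Y\<close> or
  \<open>Z\<close> interprets the reference of the word to itself.\<close>

definition upstep :: "('l \<Rightarrow> 'a set \<Rightarrow> bool) \<Rightarrow> ('i \<Rightarrow> 'w option \<times> bool \<times> 'l \<times> 'w option) \<Rightarrow>
    ('a \<Rightarrow> 'a set \<Rightarrow> bool) \<Rightarrow> ('w \<Rightarrow> 'a \<Rightarrow> 'a set \<Rightarrow> bool) \<Rightarrow> bool" where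
  "upstep U S Y P \<longleftrightarrow> (\<forall>r H v. Y r H \<longrightarrow> v \<in> H \<longrightarrow> (\<exists>A C D i a b d. H = A \<union> C \<union> D \<and> v \<in> C \<and> tri r A C D \<and>
        S i = (a, E r v, b, d) \<and> U b C \<and> (a = None \<longrightarrow> Y r A) \<and> (\<forall>w. a = Some w \<longrightarrow> P w r A) \<and>
        (d = None \<longrightarrow> Y r D) \<and> (\<forall>w. d = Some w \<longrightarrow> P w r D)))"

definition lostep :: "('l \<Rightarrow> 'a set \<Rightarrow> bool) \<Rightarrow> ('i \<Rightarrow> 'w option \<times> bool \<times> 'l \<times> 'w option) \<Rightarrow>
    ('a \<Rightarrow> 'a set \<Rightarrow> bool) \<Rightarrow> ('w \<Rightarrow> 'a \<Rightarrow> 'a set \<Rightarrow> bool) \<Rightarrow> bool" where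
  "lostep L S Z P \<longleftrightarrow> (\<forall>r H i a e b d. Z r H \<longrightarrow> S i = (a, e, b, d) \<longrightarrow> (\<exists>A C D. A \<union> C \<union> D \<subseteq> H \<and> C \<noteq> {} \<and>
        tri r A C D \<and> (\<forall>c\<in>C. E r c = e) \<and> L b C \<and> (a = None \<longrightarrow> Z r A) \<and> (\<forall>w. a = Some w \<longrightarrow> P w r A) \<and>
        (d = None \<longrightarrow> Z r D) \<and> (\<forall>w. d = Some w \<longrightarrow> P w r D)))"

lemma upstepD:
  assumes "upstep U S Y P" "Y r H" "v \<in> H"
  obtains A C D i a b d where "H = A \<union> C \<union> D" "v \<in> C" "tri r A C D"
     "S i = (a, E r v, b, d)" "U b C" "a = None \<longrightarrow> Y r A" "\<forall>w. a = Some w \<longrightarrow> P w r A"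
     "d = None \<longrightarrow> Y r D" "\<forall>w. d = Some w \<longrightarrow> P w r D"
proof -
  from assms(1)[unfolded upstep_def, THEN spec, THEN spec, THEN spec, THEN mp, THEN mp, OF assms(2,3)]
  show thesis by (elim exE conjE) (rule that)
qed

lemma lostepD:
  assumes "lostep L S Z P" "Z r H" "S i = (a, e, b, d)"
  obtains A C D where "A \<union> C \<union> D \<subseteq> H" "C \<noteq> {}" "tri r A C D" "\<forall>c\<in>C. E r c = e" "L b C"
     "a = None \<longrightarrow> Z r A" "\<forall>w. a = Some w \<longrightarrow> P w r A" "d = None \<longrightarrow> Z r D" "\<forall>w. d = Some w \<longrightarrow> P w r D"
proof -
  from assms(1)[unfolded lostep_def, THEN spec, THEN spec, THEN spec, THEN spec, THEN spec, THEN spec, THEN spec,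
      THEN mp, THEN mp, OF assms(2,3)]
  show thesis by (elim exE conjE) (rule that)
qed

lemma upstepI:
  assumes "\<And>r H v. Y r H \<Longrightarrow> v \<in> H \<Longrightarrow> \<exists>A C D i a b d. H = A \<union> C \<union> D \<and> v \<in> C \<and> tri r A C D \<and>
        S i = (a, E r v, b, d) \<and> U b C \<and> (a = None \<longrightarrow> Y r A) \<and> (\<forall>w. a = Some w \<longrightarrow> P w r A) \<and>
        (d = None \<longrightarrow> Y r D) \<and> (\<forall>w. d = Some w \<longrightarrow> P w r D)"
  shows "upstep U S Y P"
  unfolding upstep_def by (intro allI impI, rule assms)

lemma lostepI:
  assumes "\<And>r H i a e b d. Z r H \<Longrightarrow> S i = (a, e, b, d) \<Longrightarrow> \<exists>A C D. A \<union> C \<union> D \<subseteq> H \<and> C \<noteq> {} \<and>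
        tri r A C D \<and> (\<forall>c\<in>C. E r c = e) \<and> L b C \<and> (a = None \<longrightarrow> Z r A) \<and> (\<forall>w. a = Some w \<longrightarrow> P w r A) \<and>
        (d = None \<longrightarrow> Z r D) \<and> (\<forall>w. d = Some w \<longrightarrow> P w r D)"
  shows "lostep L S Z P"
  unfolding lostep_def by (intro allI impI, rule assms)

lemma upstep_mono_letters:
  assumes up: "upstep U S Y P" and P: "\<And>w r A. P w r A \<Longrightarrow> P' w r A" and U: "\<And>b C. U b C \<Longrightarrow> U' b C"
  shows "upstep U' S Y P'"
proof (rule upstepI)
  fix r H v assume H: "Y r H" "v \<in> H"
  obtain A C D i a b d where "H = A \<union> C \<union> D" "v \<in> C" "tri r A C D"
     "S i = (a, E r v, b, d)" "U b C" "a = None \<longrightarrow> Y r A" "\<forall>w. a = Some w \<longrightarrow> P w r A"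
     "d = None \<longrightarrow> Y r D" "\<forall>w. d = Some w \<longrightarrow> P w r D" by (rule upstepD[OF up H])
  then show "\<exists>A C D i a b d. H = A \<union> C \<union> D \<and> v \<in> C \<and> tri r A C D \<and>
        S i = (a, E r v, b, d) \<and> U' b C \<and> (a = None \<longrightarrow> Y r A) \<and> (\<forall>w. a = Some w \<longrightarrow> P' w r A) \<and>
        (d = None \<longrightarrow> Y r D) \<and> (\<forall>w. d = Some w \<longrightarrow> P' w r D)"
    by (intro exI[of _ A] exI[of _ C] exI[of _ D] exI[of _ i] exI[of _ a] exI[of _ b] exI[of _ d] conjI impI allI)
      (simp_all add: P U)
qed

lemma lostep_mono_letters:
  assumes lo: "lostep L S Z P" and P: "\<And>w r A. P w r A \<Longrightarrow> P' w r A" and L: "\<And>b C. L b C \<Longrightarrow> L' b C"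
  shows "lostep L' S Z P'"
proof (rule lostepI)
  fix r H i a e b d assume H: "Z r H" "S i = (a, e, b, d)"
  obtain A C D where "A \<union> C \<union> D \<subseteq> H" "C \<noteq> {}" "tri r A C D" "\<forall>c\<in>C. E r c = e" "L b C"
     "a = None \<longrightarrow> Z r A" "\<forall>w. a = Some w \<longrightarrow> P w r A" "d = None \<longrightarrow> Z r D" "\<forall>w. d = Some w \<longrightarrow> P w r D"
    by (rule lostepD[OF lo H])
  then show "\<exists>A C D. A \<union> C \<union> D \<subseteq> H \<and> C \<noteq> {} \<and>
        tri r A C D \<and> (\<forall>c\<in>C. E r c = e) \<and> L' b C \<and> (a = None \<longrightarrow> Z r A) \<and> (\<forall>w. a = Some w \<longrightarrow> P' w r A) \<and>
        (d = None \<longrightarrow> Z r D) \<and> (\<forall>w. d = Some w \<longrightarrow> P' w r D)"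
    by (intro exI[of _ A] exI[of _ C] exI[of _ D] conjI impI allI) (simp_all add: P L)
qed

text \<open>A greatest fixed point, written as the existence of a relation consistent with the step.
  The self-reference may be unfolded forever, whereas \<open>UpW\<close> descends to proper subwords
  inductively.\<close>

definition upfix where "upfix U S P r H \<longleftrightarrow> (\<exists>Y. Y r H \<and> upstep U S Y P)"
definition lofix where "lofix L S P r H \<longleftrightarrow> (\<exists>Z. Z r H \<and> lostep L S Z P)"

lemma upfix_mono [mono]:
  assumes "\<And>w r A. P w r A \<longrightarrow> P' w r A"
  shows "upfix U S P r H \<longrightarrow> upfix U S P' r H"
proof
  assume "upfix U S P r H"
  then obtain Y where Y: "Y r H" "upstep U S Y P" unfolding upfix_def by (elim exE conjE)
  have "upstep U S Y P'" by (rule upstep_mono_letters[OF Y(2)], erule assms[rule_format])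
  with Y(1) show "upfix U S P' r H" unfolding upfix_def by (intro exI[of _ Y] conjI)
qed

lemma lofix_mono [mono]:
  assumes "\<And>w r A. P w r A \<longrightarrow> P' w r A"
  shows "lofix L S P r H \<longrightarrow> lofix L S P' r H"
proof
  assume "lofix L S P r H"
  then obtain Z where Z: "Z r H" "lostep L S Z P" unfolding lofix_def by (elim exE conjE)
  have "lostep L S Z P'" by (rule lostep_mono_letters[OF Z(2)], erule assms[rule_format])
  with Z(1) show "lofix L S P' r H" unfolding lofix_def by (intro exI[of _ Z] conjI)
qed

text \<open>\<open>UpW\<close> bounds a chain from above by a word: every class occurs in a context of the word.  \<open>LoW\<close> bounds it from
  below: every context of the word occurs.  So what is below a word embeds into what is above it.\<close>

inductive UpW :: "('l \<Rightarrow> 'a set \<Rightarrow> bool) \<Rightarrow> ('i, 'l) wt \<Rightarrow> 'a \<Rightarrow> 'a set \<Rightarrow> bool" for U where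
  UpW_Emp: "UpW U WEmp r {}"
| UpW_upfix: "upfix U S (UpW U) r H \<Longrightarrow> UpW U (WFix S) r H"

inductive LoW :: "('l \<Rightarrow> 'a set \<Rightarrow> bool) \<Rightarrow> ('i, 'l) wt \<Rightarrow> 'a \<Rightarrow> 'a set \<Rightarrow> bool" for L where
  LoW_Emp: "LoW L WEmp r H"
| LoW_lofix: "lofix L S (LoW L) r H \<Longrightarrow> LoW L (WFix S) r H"

lemma UpW_FixI: "Y r H \<Longrightarrow> upstep U S Y (UpW U) \<Longrightarrow> UpW U (WFix S) r H"
  by (rule UpW_upfix) (auto simp: upfix_def)

lemma LoW_FixI: "Z r H \<Longrightarrow> lostep L S Z (LoW L) \<Longrightarrow> LoW L (WFix S) r H"
  by (rule LoW_lofix) (auto simp: lofix_def)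

lemma UpW_E [consumes 1, case_names Up_Emp Up_Fix]:
  assumes "UpW U w r H"
  obtains "w = WEmp" "H = {}" | Y S where "w = WFix S" "Y r H" "upstep U S Y (UpW U)"
  using assms
proof (cases rule: UpW.cases)
  case (UpW_upfix S)
  then obtain Y where "Y r H" "upstep U S Y (UpW U)" unfolding upfix_def by (elim exE conjE)
  with UpW_upfix(1) show thesis by (rule that(2))
qed (rule that(1))

lemma LoW_E [consumes 1, case_names Lo_Emp Lo_Fix]:
  assumes "LoW L w r H"
  obtains "w = WEmp" | Z S where "w = WFix S" "Z r H" "lostep L S Z (LoW L)"
  using assms
proof (cases rule: LoW.cases)
  case (LoW_lofix S)
  then obtain Z where "Z r H" "lostep L S Z (LoW L)" unfolding lofix_def by (elim exE conjE)
  with LoW_lofix(1) show thesis by (rule that(2))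
qed (rule that(1))

lemma UpW_mono_letters:
  assumes "UpW U w r H" and U: "\<And>b C. U b C \<Longrightarrow> U' b C"
  shows "UpW U' w r H"
  using assms(1)
proof induction
  case (UpW_Emp r)
  show ?case by (rule UpW.UpW_Emp)
next
  case (UpW_upfix S r H)
  then obtain Y where Y: "Y r H" "upstep U S Y (\<lambda>w r H. UpW U w r H \<and> UpW U' w r H)"
    unfolding upfix_def by (elim exE conjE)
  have "upstep U' S Y (UpW U')"
    by (rule upstep_mono_letters[OF Y(2)]) (simp_all add: U)
  then show ?case by (rule UpW_FixI[where Y = Y, OF Y(1)])
qed

lemma LoW_mono_letters:
  assumes "LoW L w r H" and L: "\<And>b C. L b C \<Longrightarrow> L' b C"
  shows "LoW L' w r H"
  using assms(1)
proof induction
  case (LoW_Emp r H)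
  show ?case by (rule LoW.LoW_Emp)
next
  case (LoW_lofix S r H)
  then obtain Z where Z: "Z r H" "lostep L S Z (\<lambda>w r H. LoW L w r H \<and> LoW L' w r H)"
    unfolding lofix_def by (elim exE conjE)
  have "lostep L' S Z (LoW L')"
    by (rule lostep_mono_letters[OF Z(2)]) (simp_all add: L)
  then show ?case by (rule LoW_FixI[where Z = Z, OF Z(1)])
qed

text \<open>Closing the witnessing relation upwards under inclusion gives a witness for the larger
  set.\<close>

lemma LoW_mono:
  assumes "LoW L w r A" "A \<subseteq> H"
  shows "LoW L w r H"
  using assms(1)
proof (cases rule: LoW_E)
  case Lo_Emp
  then show ?thesis using LoW.LoW_Emp by simp
next
  case (Lo_Fix Z S)
  show ?thesis
    unfolding Lo_Fix(1)
  proof (rule LoW_FixI[of "\<lambda>r H. \<exists>A\<subseteq>H. Z r A"])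
    show "\<exists>A\<subseteq>H. Z r A" using Lo_Fix(2) assms(2) by blast
    show "lostep L S (\<lambda>r H. \<exists>A\<subseteq>H. Z r A) (LoW L)"
    proof (rule lostepI)
      fix r H i a e b d assume "\<exists>A\<subseteq>H. Z r A" and Si: "S i = (a, e, b, d)"
      then obtain A0 where A0: "A0 \<subseteq> H" "Z r A0" by blast
      obtain A C D where t: "A \<union> C \<union> D \<subseteq> A0" "C \<noteq> {}" "tri r A C D" "\<forall>c\<in>C. E r c = e" "L b C"
        "a = None \<longrightarrow> Z r A" "\<forall>w. a = Some w \<longrightarrow> LoW L w r A" "d = None \<longrightarrow> Z r D" "\<forall>w. d = Some w \<longrightarrow> LoW L w r D"
        by (rule lostepD[OF Lo_Fix(3) A0(2) Si])
      show "\<exists>A C D. A \<union> C \<union> D \<subseteq> H \<and> C \<noteq> {} \<and> tri r A C D \<and> (\<forall>c\<in>C. E r c = e) \<and> L b C \<and>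
          (a = None \<longrightarrow> (\<exists>A'\<subseteq>A. Z r A')) \<and> (\<forall>w. a = Some w \<longrightarrow> LoW L w r A) \<and>
          (d = None \<longrightarrow> (\<exists>D'\<subseteq>D. Z r D')) \<and> (\<forall>w. d = Some w \<longrightarrow> LoW L w r D)"
      proof -
        have "A \<union> C \<union> D \<subseteq> H" using t(1) A0(1) by blast
        moreover have "a = None \<longrightarrow> (\<exists>A'\<subseteq>A. Z r A')" "d = None \<longrightarrow> (\<exists>D'\<subseteq>D. Z r D')" using t(6,8) by blast+
        ultimately show ?thesis using t(2-5,7,9)
          by - (rule exI[of _ A], rule exI[of _ C], rule exI[of _ D], intro conjI)
      qed
    qed
  qed
qed

lemma UpW_lft_mono [mono]:
  assumes "\<And>b C. U b C \<longrightarrow> U' b C"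
  shows "UpW (lft X U) w r H \<longrightarrow> UpW (lft X U') w r H"
proof
  assume "UpW (lft X U) w r H"
  then show "UpW (lft X U') w r H"
  proof (rule UpW_mono_letters)
    show "lft X U' b C" if "lft X U b C" for b C
      by (rule lft_mono[OF that], assumption, erule assms[rule_format])
  qed
qed

lemma LoW_lft_mono [mono]:
  assumes "\<And>b C. L b C \<longrightarrow> L' b C"
  shows "LoW (lft X L) w r H \<longrightarrow> LoW (lft X L') w r H"
proof
  assume "LoW (lft X L) w r H"
  then show "LoW (lft X L') w r H"
  proof (rule LoW_mono_letters)
    show "lft X L' b C" if "lft X L b C" for b C
      by (rule lft_mono[OF that], assumption, erule assms[rule_format])
  qed
qed

text \<open>The relation \<open>X\<close> that is required of the whole graph also interprets the
  letter \<open>None\<close> inside its words.\<close>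

definition upfixG where
  "upfixG S P K \<longleftrightarrow> (\<exists>X. X K \<and> (\<forall>K. X K \<longrightarrow> (\<forall>x\<in>K. \<exists>i. UpW (lft X P) (S i) x (K - {x}))))"
definition lofixG where
  "lofixG S P K \<longleftrightarrow> (\<exists>N. N K \<and> (\<forall>K. N K \<longrightarrow> (\<forall>i. \<exists>x\<in>K. LoW (lft N P) (S i) x (K - {x}))))"

lemma upfixG_mono [mono]:
  assumes "\<And>b C. P b C \<longrightarrow> P' b C"
  shows "upfixG S P K \<longrightarrow> upfixG S P' K"
proof
  assume "upfixG S P K"
  then obtain X where X: "X K" "\<forall>K. X K \<longrightarrow> (\<forall>x\<in>K. \<exists>i. UpW (lft X P) (S i) x (K - {x}))"
    unfolding upfixG_def by (elim exE conjE)
  have "UpW (lft X P') w r H" if "UpW (lft X P) w r H" for w r H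
    using UpW_lft_mono[OF assms] that by (rule mp)
  then have "\<forall>K. X K \<longrightarrow> (\<forall>x\<in>K. \<exists>i. UpW (lft X P') (S i) x (K - {x}))" using X(2) by meson
  with X(1) show "upfixG S P' K" unfolding upfixG_def by (intro exI[of _ X] conjI)
qed

lemma lofixG_mono [mono]:
  assumes "\<And>b C. P b C \<longrightarrow> P' b C"
  shows "lofixG S P K \<longrightarrow> lofixG S P' K"
proof
  assume "lofixG S P K"
  then obtain N where N: "N K" "\<forall>K. N K \<longrightarrow> (\<forall>i. \<exists>x\<in>K. LoW (lft N P) (S i) x (K - {x}))"
    unfolding lofixG_def by (elim exE conjE)
  have "LoW (lft N P') w r H" if "LoW (lft N P) w r H" for w r H
    using LoW_lft_mono[OF assms] that by (rule mp)
  then have "\<forall>K. N K \<longrightarrow> (\<forall>i. \<exists>x\<in>K. LoW (lft N P') (S i) x (K - {x}))" using N(2) by meson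
  with N(1) show "lofixG S P' K" unfolding lofixG_def by (intro exI[of _ N] conjI)
qed

inductive UpG :: "'i gt \<Rightarrow> 'a set \<Rightarrow> bool" where
  UpG_Emp: "UpG GEmp {}"
| UpG_upfix: "upfixG S UpG K \<Longrightarrow> UpG (GFix S) K"

inductive LoG :: "'i gt \<Rightarrow> 'a set \<Rightarrow> bool" where
  LoG_Emp: "LoG GEmp K"
| LoG_lofix: "lofixG S LoG K \<Longrightarrow> LoG (GFix S) K"

lemma UpG_FixI:
  "X K \<Longrightarrow> \<forall>K. X K \<longrightarrow> (\<forall>x\<in>K. \<exists>i. UpW (lft X UpG) (S i) x (K - {x})) \<Longrightarrow> UpG (GFix S) K"
  by (rule UpG_upfix, unfold upfixG_def, rule exI[of _ X], rule conjI)

lemma LoG_FixI: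
  "N K \<Longrightarrow> \<forall>K. N K \<longrightarrow> (\<forall>i. \<exists>x\<in>K. LoW (lft N LoG) (S i) x (K - {x})) \<Longrightarrow> LoG (GFix S) K"
  by (rule LoG_lofix, unfold lofixG_def, rule exI[of _ N], rule conjI)

lemma UpG_E [consumes 1, case_names UpG_Emp UpG_Fix]:
  assumes "UpG b K"
  obtains "b = GEmp" "K = {}" | X S where "b = GFix S" "X K"
    "\<forall>K. X K \<longrightarrow> (\<forall>x\<in>K. \<exists>i. UpW (lft X UpG) (S i) x (K - {x}))"
  using assms
proof (cases rule: UpG.cases)
  case (UpG_upfix S)
  then obtain X where "X K" "\<forall>K. X K \<longrightarrow> (\<forall>x\<in>K. \<exists>i. UpW (lft X UpG) (S i) x (K - {x}))"
    unfolding upfixG_def by (elim exE conjE)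
  with UpG_upfix(1) show thesis by (rule that(2))
qed (rule that(1))

lemma LoG_E [consumes 1, case_names LoG_Emp LoG_Fix]:
  assumes "LoG b K"
  obtains "b = GEmp" | N S where "b = GFix S" "N K"
    "\<forall>K. N K \<longrightarrow> (\<forall>i. \<exists>x\<in>K. LoW (lft N LoG) (S i) x (K - {x}))"
  using assms
proof (cases rule: LoG.cases)
  case (LoG_lofix S)
  then obtain N where "N K" "\<forall>K. N K \<longrightarrow> (\<forall>i. \<exists>x\<in>K. LoW (lft N LoG) (S i) x (K - {x}))"
    unfolding lofixG_def by (elim exE conjE)
  with LoG_lofix(1) show thesis by (rule that(2))
qed (rule that(1))

lemma LoG_mono:
  assumes "LoG b A" "A \<subseteq> K"
  shows "LoG b K"
  using assms(1)
proof (cases rule: LoG_E)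
  case LoG_Emp
  then show ?thesis using LoG.LoG_Emp by simp
next
  case (LoG_Fix N S)
  show ?thesis
    unfolding LoG_Fix(1)
  proof (rule LoG_FixI[of "\<lambda>K. \<exists>A\<subseteq>K. N A"])
    show "\<exists>A\<subseteq>K. N A" using LoG_Fix(2) assms(2) by blast
    show "\<forall>K. (\<exists>A\<subseteq>K. N A) \<longrightarrow> (\<forall>i. \<exists>x\<in>K. LoW (lft (\<lambda>K. \<exists>A\<subseteq>K. N A) LoG) (S i) x (K - {x}))"
    proof (intro allI impI)
      fix K i assume "\<exists>A\<subseteq>K. N A"
      then obtain A where A: "A \<subseteq> K" "N A" by blast
      then obtain x where x: "x \<in> A" "LoW (lft N LoG) (S i) x (A - {x})" using LoG_Fix(3) by blast
      have "LoW (lft (\<lambda>K. \<exists>A\<subseteq>K. N A) LoG) (S i) x (A - {x})"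
      proof (rule LoW_mono_letters[OF x(2)])
        show "lft (\<lambda>K. \<exists>A\<subseteq>K. N A) LoG b C" if "lft N LoG b C" for b C
          using that by (rule lft_mono) auto
      qed
      then have "LoW (lft (\<lambda>K. \<exists>A\<subseteq>K. N A) LoG) (S i) x (K - {x})"
        by (rule LoW_mono) (use A(1) in blast)
      then show "\<exists>x\<in>K. LoW (lft (\<lambda>K. \<exists>A\<subseteq>K. N A) LoG) (S i) x (K - {x})" using x(1) A(1) by blast
    qed
  qed
qed

text \<open>All contexts of a word are realised, hence by induction on subwords all letters are.
  This is what puts graph subterms below a graph term in the order \<open>leG\<close>.\<close>

lemma LoW_letter:
  "LoW L w r H \<Longrightarrow> b \<in> set_wt w \<Longrightarrow> \<exists>C\<subseteq>H. L b C"
proof (induction w arbitrary: r H rule: wfp_induct_rule[OF wf_subw])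
  case (1 w)
  show ?case
    using 1(2)
  proof (cases rule: LoW_E)
    case Lo_Emp
    then show ?thesis using 1(3) by simp
  next
    case (Lo_Fix Z S)
    obtain i where i: "b \<in> (case S i of (a, e, b, d) \<Rightarrow>
        insert b (\<Union>(set_wt ` set_option a) \<union> \<Union>(set_wt ` set_option d)))"
      using 1(3) unfolding Lo_Fix(1) set_wt_WFix by (elim UN_E)
    obtain a e b' d where Si: "S i = (a, e, b', d)" by (cases "S i")
    have mem: "b \<in> insert b' (\<Union>(set_wt ` set_option a) \<union> \<Union>(set_wt ` set_option d))"
      using i unfolding Si by simp
    obtain A C D where t: "A \<union> C \<union> D \<subseteq> H" "L b' C"
       "\<forall>w. a = Some w \<longrightarrow> LoW L w r A" "\<forall>w. d = Some w \<longrightarrow> LoW L w r D"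
      by (rule lostepD[OF Lo_Fix(3,2) Si])
    consider "b = b'" | w' where "a = Some w'" "b \<in> set_wt w'" | w' where "d = Some w'" "b \<in> set_wt w'"
      using mem by auto
    then show ?thesis
    proof cases
      case 1
      then show ?thesis using t by auto
    next
      case (2 w')
      have "subw w' w" unfolding subw_def Lo_Fix(1) using Si 2(1) by blast
      then obtain C' where "C' \<subseteq> A" "L b C'" using 1(1)[of w' r A] t(3) 2 by blast
      then show ?thesis using t(1) by blast
    next
      case (3 w')
      have "subw w' w" unfolding subw_def Lo_Fix(1) using Si 3(1) by blast
      then obtain C' where "C' \<subseteq> D" "L b C'" using 1(1)[of w' r D] t(4) 3 by blast
      then show ?thesis using t(1) by blast
    qed
  qed
qed

text \<open>Coinductive because the splitting of outer parts need not end; \<open>Q\<close> is the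
  obligation left for the middle blocks.\<close>

coinductive sim :: "('a set \<Rightarrow> 'a set \<Rightarrow> bool) \<Rightarrow> 'a \<Rightarrow> 'a set \<Rightarrow> 'a \<Rightarrow> 'a set \<Rightarrow> bool" for Q where
  sim: "(\<forall>v\<in>H. \<exists>A C D A' C' D'. H = A \<union> C \<union> D \<and> v \<in> C \<and> tri r A C D \<and>
      A' \<union> C' \<union> D' \<subseteq> H' \<and> C' \<noteq> {} \<and> tri r' A' C' D' \<and> (\<forall>c\<in>C. \<forall>c'\<in>C'. E r c = E r' c') \<and>
      sim Q r A r' A' \<and> Q C C' \<and> sim Q r D r' D') \<Longrightarrow> sim Q r H r' H'"

lemma simD:
  assumes "sim Q r H r' H'" "v \<in> H"
  shows "\<exists>A C D A' C' D'. H = A \<union> C \<union> D \<and> v \<in> C \<and> tri r A C D \<and>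
      A' \<union> C' \<union> D' \<subseteq> H' \<and> C' \<noteq> {} \<and> tri r' A' C' D' \<and> (\<forall>c\<in>C. \<forall>c'\<in>C'. E r c = E r' c') \<and>
      sim Q r A r' A' \<and> Q C C' \<and> sim Q r D r' D'"
  using assms(1)
proof (cases rule: sim.cases)
  case sim
  then show ?thesis using assms(2) by (rule bspec)
qed

lemma sim_coinduct:
  assumes X: "X r H r' H'" and step: "\<And>r H r' H' v. X r H r' H' \<Longrightarrow> v \<in> H \<Longrightarrow>
    \<exists>A C D A' C' D'. H = A \<union> C \<union> D \<and> v \<in> C \<and> tri r A C D \<and>
      A' \<union> C' \<union> D' \<subseteq> H' \<and> C' \<noteq> {} \<and> tri r' A' C' D' \<and> (\<forall>c\<in>C. \<forall>c'\<in>C'. E r c = E r' c') \<and>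
      X r A r' A' \<and> Q C C' \<and> X r D r' D'"
  shows "sim Q r H r' H'"
proof (rule sim.coinduct[of X, OF X])
  fix r H r' H' assume X: "X r H r' H'"
  have "\<forall>v\<in>H. \<exists>A C D A' C' D'. H = A \<union> C \<union> D \<and> v \<in> C \<and> tri r A C D \<and>
      A' \<union> C' \<union> D' \<subseteq> H' \<and> C' \<noteq> {} \<and> tri r' A' C' D' \<and> (\<forall>c\<in>C. \<forall>c'\<in>C'. E r c = E r' c') \<and>
      (X r A r' A' \<or> sim Q r A r' A') \<and> Q C C' \<and> (X r D r' D' \<or> sim Q r D r' D')"
  proof
    fix v assume "v \<in> H"
    from step[OF X this] show "\<exists>A C D A' C' D'. H = A \<union> C \<union> D \<and> v \<in> C \<and> tri r A C D \<and>
      A' \<union> C' \<union> D' \<subseteq> H' \<and> C' \<noteq> {} \<and> tri r' A' C' D' \<and> (\<forall>c\<in>C. \<forall>c'\<in>C'. E r c = E r' c') \<and>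
      (X r A r' A' \<or> sim Q r A r' A') \<and> Q C C' \<and> (X r D r' D' \<or> sim Q r D r' D')"
      apply (elim exE conjE)
      subgoal for A C D A' C' D'
        by (rule exI[of _ A], rule exI[of _ C], rule exI[of _ D], rule exI[of _ A'], rule exI[of _ C'],
            rule exI[of _ D'], intro conjI) (assumption | rule disjI1)+
      done
  qed
  then show "\<exists>Ha ra H'a r'a. r = ra \<and> H = Ha \<and> r' = r'a \<and> H' = H'a \<and>
     (\<forall>v\<in>Ha. \<exists>A C D A' C' D'. Ha = A \<union> C \<union> D \<and> v \<in> C \<and> tri ra A C D \<and>
      A' \<union> C' \<union> D' \<subseteq> H'a \<and> C' \<noteq> {} \<and> tri r'a A' C' D' \<and> (\<forall>c\<in>C. \<forall>c'\<in>C'. E ra c = E r'a c') \<and>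
      (X ra A r'a A' \<or> sim Q ra A r'a A') \<and> Q C C' \<and> (X ra D r'a D' \<or> sim Q ra D r'a D'))"
    by - (rule exI[of _ H], rule exI[of _ r], rule exI[of _ H'], rule exI[of _ r'], intro conjI refl)
qed

text \<open>The word mediates: a vertex of \<open>H\<close> occurs in one of its contexts, and
  \<open>H'\<close> realises that context. The outer parts either return to the fixed point or
  belong to a proper subword, where the induction hypothesis applies.\<close>

lemma sound_word:
  assumes "UpW U w r H" "LoW L w r' H'" "\<And>b C C'. b \<in> set_wt w \<Longrightarrow> U b C \<Longrightarrow> L b C' \<Longrightarrow> Q C C'"
  shows "sim Q r H r' H'"
  using assms
proof (induction w arbitrary: r H r' H' rule: wfp_induct_rule[OF wf_subw])
  case (1 w)
  note IH = 1(1) and up = 1(2) and lo = 1(3) and lett = 1(4)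
  show ?case
    using up
  proof (cases rule: UpW_E)
    case Up_Emp
    then show ?thesis by (auto intro: sim.intros)
  next
    case (Up_Fix Y S)
    from lo show ?thesis
    proof (cases rule: LoW_E)
      case Lo_Emp
      then show ?thesis using Up_Fix(1) by simp
    next
      case (Lo_Fix Z S')
      have SS: "S' = S" using Up_Fix(1) Lo_Fix(1) by simp
      show ?thesis
      proof (rule sim_coinduct[of "\<lambda>r H r' H'. (Y r H \<and> Z r' H') \<or> sim Q r H r' H'"])
        show "(Y r H \<and> Z r' H') \<or> sim Q r H r' H'" using Up_Fix(2) Lo_Fix(2) by blast
      next
        fix r H r' H' v assume sim: "(Y r H \<and> Z r' H') \<or> sim Q r H r' H'" and v: "v \<in> H"
        show "\<exists>A C D A' C' D'. H = A \<union> C \<union> D \<and> v \<in> C \<and> tri r A C D \<and>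
          A' \<union> C' \<union> D' \<subseteq> H' \<and> C' \<noteq> {} \<and> tri r' A' C' D' \<and> (\<forall>c\<in>C. \<forall>c'\<in>C'. E r c = E r' c') \<and>
          (Y r A \<and> Z r' A' \<or> sim Q r A r' A') \<and> Q C C' \<and> (Y r D \<and> Z r' D' \<or> sim Q r D r' D')"
        proof (cases "sim Q r H r' H'")
          case True
          from simD[OF this v] show ?thesis
            apply (elim exE conjE)
            subgoal for A C D A' C' D'
              by (rule exI[of _ A], rule exI[of _ C], rule exI[of _ D], rule exI[of _ A'], rule exI[of _ C'],
                  rule exI[of _ D'], intro conjI) (assumption | rule disjI2)+
            done
        next
          case False
          then have YZ: "Y r H" "Z r' H'" using sim by auto
          obtain A C D i a b d where u: "H = A \<union> C \<union> D" "v \<in> C" "tri r A C D" "S i = (a, E r v, b, d)" "U b C"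
            "a = None \<longrightarrow> Y r A" "\<forall>w. a = Some w \<longrightarrow> UpW U w r A"
            "d = None \<longrightarrow> Y r D" "\<forall>w. d = Some w \<longrightarrow> UpW U w r D"
            by (rule upstepD[OF Up_Fix(3) YZ(1) v])
          have Si: "S' i = (a, E r v, b, d)" using u(4) SS by simp
          obtain A' C' D' where l: "A' \<union> C' \<union> D' \<subseteq> H'" "C' \<noteq> {}" "tri r' A' C' D'" "\<forall>c\<in>C'. E r' c = E r v" "L b C'"
            "a = None \<longrightarrow> Z r' A'" "\<forall>w. a = Some w \<longrightarrow> LoW L w r' A'"
            "d = None \<longrightarrow> Z r' D'" "\<forall>w. d = Some w \<longrightarrow> LoW L w r' D'"
            by (rule lostepD[OF Lo_Fix(3) YZ(2) Si])
          have bs: "b \<in> set_wt w" unfolding Up_Fix(1) set_wt_WFix by (intro UN_I[of i]) (auto simp: u(4))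
          have sub: "sim Q r X r' X'" if w': "subw w' w" "UpW U w' r X" "LoW L w' r' X'" for w' X X'
            using IH[OF w'] lett set_wt_subw[OF w'(1)] by blast
          have 1: "Y r A \<and> Z r' A' \<or> sim Q r A r' A'"
          proof (cases a)
            case (Some w')
            then have "subw w' w" unfolding subw_def Up_Fix(1) using u(4) by blast
            then show ?thesis using sub Some u(7) l(7) by blast
          qed (use u(6) l(6) in blast)
          have 2: "Y r D \<and> Z r' D' \<or> sim Q r D r' D'"
          proof (cases d)
            case (Some w')
            then have "subw w' w" unfolding subw_def Up_Fix(1) using u(4) by blast
            then show ?thesis using sub Some u(9) l(9) by blast
          qed (use u(8) l(8) in blast)
          have "E r c = E r' c'" if "c \<in> C" "c' \<in> C'" for c c'
            using triD(4)[OF u(3) that(1) u(2)] l(4) that(2) by simp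
          then have "\<forall>c\<in>C. \<forall>c'\<in>C'. E r c = E r' c'" by blast
          moreover have "Q C C'" using lett[OF bs u(5) l(5)] .
          ultimately show ?thesis using u(1-3) l(1-3) 1 2
            by - (rule exI[of _ A], rule exI[of _ C], rule exI[of _ D], rule exI[of _ A'],
                rule exI[of _ C'], rule exI[of _ D'], intro conjI)
        qed
      qed
    qed
  qed
qed

lemma tri_rtri:
  assumes "tri r A C D" "v \<in> C"
  shows "rtri r v A (C - {v}) D"
proof -
  note t = triD[OF assms(1)]
  have "\<forall>a\<in>A. E a v = E r v" using t(5) assms(2) by blast
  moreover have "\<forall>b\<in>C - {v}. E r b = E r v" using t(4) assms(2) by blast
  moreover have "\<forall>a\<in>A. \<forall>b\<in>C - {v}. E a b = E r v" using t(4,5) assms(2) by (metis DiffD1)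
  moreover have "v \<notin> A" "v \<notin> D" "A \<inter> (C - {v}) = {}" "(C - {v}) \<inter> D = {}" using t(1,3) assms(2) by blast+
  moreover have "\<forall>d\<in>D. E v d = E r d" "\<forall>a\<in>A. \<forall>d\<in>D. E a d = E r d" "\<forall>c\<in>C - {v}. \<forall>d\<in>D. E c d = E r d"
    using t(6,7) assms(2) by blast+
  ultimately show ?thesis unfolding rtri_def using t(2) by (intro conjI) (assumption | simp)+
qed

text \<open>The simulation is closed under expansion at any vertex \<open>v\<close>:
  \<open>Q\<close> supplies a partner \<open>v'\<close> in the other middle block and a simulation
  between the rests of both blocks, rooted at \<open>v\<close> and \<open>v'\<close>. So
  \<open>wle_limit\<close> applies.\<close>

lemma sim_wle:
  assumes sim: "sim Q r H r' H'" and H: "H \<subseteq> V"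
    and Q: "\<And>C C' x. Q C C' \<Longrightarrow> C \<subseteq> V \<Longrightarrow> x \<in> C \<Longrightarrow> \<exists>x'\<in>C'. sim Q x (C - {x}) x' (C' - {x'})"
  shows "wle r H r' H'"
proof (rule wle_limit[of "\<lambda>r H r' H'. H \<subseteq> V \<and> sim Q r H r' H'"], goal_cases)
  case (1 r H r' H' v)
  then have HV: "H \<subseteq> V" and s: "sim Q r H r' H'" by auto
  obtain A C D A' C' D' where t: "H = A \<union> C \<union> D" "v \<in> C" "tri r A C D"
      "A' \<union> C' \<union> D' \<subseteq> H'" "C' \<noteq> {}" "tri r' A' C' D'" "\<forall>c\<in>C. \<forall>c'\<in>C'. E r c = E r' c'"
      "sim Q r A r' A'" "Q C C'" "sim Q r D r' D'"
    using simD[OF s 1(2)] by (elim exE conjE)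
  obtain v' where v': "v' \<in> C'" "sim Q v (C - {v}) v' (C' - {v'})" using Q[OF t(9) _ t(2)] t(1) HV by blast
  show ?case
  proof (intro exI conjI)
    show "H = insert v (A \<union> (C - {v}) \<union> D)" using t(1,2) by blast
    show "rtri r v A (C - {v}) D" using tri_rtri t(2,3) by blast
    show "rtri r' v' A' (C' - {v'}) D'" using tri_rtri t(6) v'(1) by blast
    show "sim Q v (C - {v}) v' (C' - {v'})" by (rule v'(2))
    show "E r v = E r' v'" using t(2,7) v'(1) by blast
  qed (use t v' HV in auto)
qed (use sim H in auto)

text \<open>An embedding is itself a simulation, since it carries the splitting at a class to a
  splitting of its image.\<close>

lemma wle_sim:
  assumes "wle r H r' H'" "\<And>C C'. gle C C' \<Longrightarrow> Q C C'"
  shows "sim Q r H r' H'"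
proof (rule sim_coinduct[of wle, OF assms(1)])
  fix r H r' H' v assume sim: "wle r H r' H'" and v: "v \<in> H"
  then obtain f where f: "remb f r H r' H'" by (auto simp: wle_def)
  show "\<exists>A C D A' C' D'. H = A \<union> C \<union> D \<and> v \<in> C \<and> tri r A C D \<and>
          A' \<union> C' \<union> D' \<subseteq> H' \<and> C' \<noteq> {} \<and> tri r' A' C' D' \<and> (\<forall>c\<in>C. \<forall>c'\<in>C'. E r c = E r' c') \<and>
          wle r A r' A' \<and> Q C C' \<and> wle r D r' D'"
  proof -
    define A C D where "A = {u\<in>H. lt r H u v}" and "C = cls r H v" and "D = {u\<in>H. lt r H v u}"
    have t: "tri r A C D" "H = A \<union> C \<union> D" using tri_cls[OF v, of r] by (simp_all add: A_def C_def D_def)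
    have inj: "inj_on f H" and im: "f ` H \<subseteq> H'" and fE: "\<And>u v. u \<in> H \<Longrightarrow> v \<in> H \<Longrightarrow> E (f u) (f v) = E u v"
      and fl: "\<And>u. u \<in> H \<Longrightarrow> E r' (f u) = E r u" using f by (auto simp: remb_def)
    have subs: "A \<subseteq> H" "C \<subseteq> H" "D \<subseteq> H" using t(2) by auto
    have lab: "E r c = E r v" if "c \<in> C" for c using that cls_label by (simp add: C_def)
    have cross: "E (f x) (f y) = E r' (f y)" if "x \<in> H" "y \<in> H" "E x y = E r y" for x y
      using that fE fl by simp
    have AC: "\<And>a c. a \<in> A \<Longrightarrow> c \<in> C \<Longrightarrow> E a c = E r c" and AD: "\<And>a d. a \<in> A \<Longrightarrow> d \<in> D \<Longrightarrow> E a d = E r d"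
      and CD: "\<And>c d. c \<in> C \<Longrightarrow> d \<in> D \<Longrightarrow> E c d = E r d" using triD[OF t(1)] by blast+
    have "tri r' (f ` A) (f ` C) (f ` D)"
      unfolding tri_def
    proof (intro conjI)
      show "f ` A \<inter> f ` C = {}" "f ` A \<inter> f ` D = {}" "f ` C \<inter> f ` D = {}"
        using triD(1-3)[OF t(1)] inj_on_image_Int[OF inj subs(1,2)] inj_on_image_Int[OF inj subs(1,3)]
          inj_on_image_Int[OF inj subs(2,3)] by simp_all
      show "\<forall>c\<in>f ` C. \<forall>c'\<in>f ` C. E r' c = E r' c'" using lab fl subs(2) by (simp add: subset_iff)
      show "\<forall>a\<in>f ` A. \<forall>c\<in>f ` C. E a c = E r' c"
        using cross AC subs(1,2) by (simp add: subset_iff)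
      show "\<forall>a\<in>f ` A. \<forall>d\<in>f ` D. E a d = E r' d"
        using cross AD subs(1,3) by (simp add: subset_iff)
      show "\<forall>c\<in>f ` C. \<forall>d\<in>f ` D. E c d = E r' d"
        using cross CD subs(2,3) by (simp add: subset_iff)
    qed
    moreover have "f ` A \<union> f ` C \<union> f ` D \<subseteq> H'" using im t(2) by blast
    moreover have vC: "v \<in> C" unfolding C_def using v by (rule cls_self)
    moreover have "\<forall>c\<in>C. \<forall>c'\<in>f ` C. E r c = E r' c'"
      using lab fl subs(2) by (simp add: subset_iff)
    moreover have "wle r X r' (f ` X)" if "X \<subseteq> H" for X
      unfolding wle_def remb_def using that inj_on_subset[OF inj that] fE fl
      by (intro exI[of _ f]) (simp add: subset_iff)
    moreover have "gle C (f ` C)"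
      unfolding gle_def using subs(2) inj_on_subset[OF inj subs(2)] fE by (intro exI[of _ f]) (simp add: subset_iff)
    ultimately show ?thesis using t subs assms(2)
      by - (rule exI[of _ A], rule exI[of _ C], rule exI[of _ D], rule exI[of _ "f ` A"],
          rule exI[of _ "f ` C"], rule exI[of _ "f ` D"], intro conjI, (assumption | blast)+)
  qed
qed

lemma wle_gle:
  assumes "wle x (K - {x}) x' (K' - {x'})" "x' \<in> K'"
  shows "gle K K'"
proof -
  obtain f where f: "remb f x (K - {x}) x' (K' - {x'})" using assms(1) by (auto simp: wle_def)
  define g where "g = f(x := x')"
  have 1: "g u = f u \<and> f u \<in> K' \<and> f u \<noteq> x' \<and> E x u = E x' (f u)" if "u \<in> K" "u \<noteq> x" for u
    using f that by (auto simp: g_def remb_def)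
  have 2: "E u v = E (f u) (f v) \<and> (f u = f v \<longrightarrow> u = v)" if "u \<in> K" "u \<noteq> x" "v \<in> K" "v \<noteq> x" for u v
    using f that by (auto simp: remb_def inj_on_def)
  have gx: "g x = x'" by (simp add: g_def)
  have "inj_on g K"
  proof (rule inj_onI)
    fix u v assume "u \<in> K" "v \<in> K" "g u = g v"
    then show "u = v" using 1 2 gx by metis
  qed
  moreover have "g u \<in> K'" if "u \<in> K" for u using 1[OF that] gx assms(2) by (cases "u = x") simp_all
  moreover have "E u v = E (g u) (g v)" if "u \<in> K" "v \<in> K" for u v
  proof (cases "u = x"; cases "v = x")
    assume "u = x" "v = x"
    then show ?thesis using E_irrefl by simp
  next
    assume "u = x" "v \<noteq> x"
    then show ?thesis using 1[OF that(2)] gx by simp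
  next
    assume "u \<noteq> x" "v = x"
    then show ?thesis using 1[OF that(1)] gx E_sym by metis
  next
    assume "u \<noteq> x" "v \<noteq> x"
    then show ?thesis using 1 2 that by metis
  qed
  ultimately show ?thesis unfolding gle_def by (intro exI[of _ g]) auto
qed

lemma gle_wle:
  assumes "gle K K'" "x \<in> K"
  shows "\<exists>x'\<in>K'. wle x (K - {x}) x' (K' - {x'})"
proof -
  obtain f where f: "inj_on f K" "f ` K \<subseteq> K'" "\<forall>u\<in>K. \<forall>v\<in>K. E u v = E (f u) (f v)"
    using assms(1) by (auto simp: gle_def)
  have "inj_on f (K - {x})" using f(1) by (rule inj_on_subset) blast
  moreover have "f ` (K - {x}) \<subseteq> K' - {f x}"
    using f(1,2) assms(2) by (auto simp: inj_on_def)
  ultimately have "remb f x (K - {x}) (f x) (K' - {f x})" unfolding remb_def using f(3) assms(2) by blast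
  then show ?thesis unfolding wle_def using f(2) assms(2) by blast
qed

lemma sound_graph:
  "UpG b K \<Longrightarrow> LoG b K' \<Longrightarrow> K \<subseteq> V \<Longrightarrow> gle K K'"
proof (induction b arbitrary: K K' rule: wfp_induct_rule[OF wf_subg])
  case (1 b)
  note IH = 1(1) and up = 1(2) and lo = 1(3) and KV = 1(4)
  show ?case
    using up
  proof (cases rule: UpG_E)
    case UpG_Emp
    then show ?thesis by (simp add: gle_def)
  next
    case (UpG_Fix X S)
    from lo show ?thesis
    proof (cases rule: LoG_E)
      case LoG_Emp
      then show ?thesis using UpG_Fix(1) by simp
    next
      case (LoG_Fix N S')
      have SS: "S' = S" using UpG_Fix(1) LoG_Fix(1) by simp
      \<comment> \<open>A nested class is either embedded by the induction hypothesis or is another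
        occurrence of the whole graph. Keeping both options makes \<open>Q\<close> reproduce itself
        one level deeper.\<close>
      define Q where "Q C C' \<longleftrightarrow> (C \<subseteq> V \<longrightarrow> gle C C' \<or> (X C \<and> N C'))" for C C'
      have XN: "\<exists>x'\<in>C'. sim Q x (C - {x}) x' (C' - {x'})" if C: "X C" "N C'" "x \<in> C" for C C' x
      proof -
        obtain i where i: "UpW (lft X UpG) (S i) x (C - {x})" using UpG_Fix(3) C(1,3) by blast
        obtain x' where x': "x' \<in> C'" "LoW (lft N LoG) (S i) x' (C' - {x'})"
          using LoG_Fix(3) C(2) SS by blast
        have "sim Q x (C - {x}) x' (C' - {x'})"
        proof (rule sound_word[OF i x'(2)])
          fix l D D' assume l: "l \<in> set_wt (S i)" "lft X UpG l D" "lft N LoG l D'"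
          show "Q D D'"
          proof (cases l)
            case None
            then show ?thesis using l by (simp add: Q_def)
          next
            case (Some b')
            have "subg b' b" unfolding subg_def UpG_Fix(1) using l(1) Some by blast
            then show ?thesis using IH l Some by (simp add: Q_def)
          qed
        qed
        then show ?thesis using x'(1) by blast
      qed
      have Qp: "\<exists>x'\<in>C'. sim Q x (C - {x}) x' (C' - {x'})" if C: "Q C C'" "C \<subseteq> V" "x \<in> C" for C C' x
      proof (cases "X C \<and> N C'")
        case True
        then show ?thesis using XN C(3) by blast
      next
        case False
        then have "gle C C'" using C by (auto simp: Q_def)
        then obtain x' where "x' \<in> C'" "wle x (C - {x}) x' (C' - {x'})" using gle_wle C(3) by blast
        then show ?thesis using wle_sim[of x "C - {x}" x' "C' - {x'}" Q] by (auto simp: Q_def)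
      qed
      show ?thesis
      proof (cases "K = {}")
        case True
        then show ?thesis by (simp add: gle_def)
      next
        case False
        then obtain x where x: "x \<in> K" by blast
        obtain x' where x': "x' \<in> K'" "sim Q x (K - {x}) x' (K' - {x'})"
          using XN[OF UpG_Fix(2) LoG_Fix(2) x] by blast
        have "wle x (K - {x}) x' (K' - {x'})" by (rule sim_wle[OF x'(2) _ Qp]) (use KV in blast)+
        then show ?thesis using wle_gle x' by blast
      qed
    qed
  qed
qed

end

section \<open>Rooted pieces are well-quasi-ordered\<close>

context countable_cograph
begin

text \<open>A semantic order: what the larger term bounds from below is also bounded by the smaller
  one. Transitivity is immediate, and the other axioms become properties of lower bounds.\<close>

definition leG :: "'i gt \<Rightarrow> 'i gt \<Rightarrow> bool" where
  "leG b b' \<longleftrightarrow> (\<forall>K. LoG b' K \<longrightarrow> LoG b K)"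

text \<open>The meaning \<open>N\<close> of the self-reference letter is arbitrary, because words
  are compared without reference to the graph term that contains them.\<close>

definition leW :: "('i, 'i gt option) wt \<Rightarrow> ('i, 'i gt option) wt \<Rightarrow> bool" where
  "leW w w' \<longleftrightarrow> (\<forall>N r H. LoW (lft N LoG) w' r H \<longrightarrow> LoW (lft N LoG) w r H)"

lemma lft_down: "rel_option leG b b' \<Longrightarrow> lft N LoG b' C \<Longrightarrow> lft N LoG b C"
  by (cases b; cases b') (auto simp: leG_def)

lemma leW_subw:
  assumes "subw a w" shows "leW a w"
  unfolding leW_def
proof (intro allI impI)
  fix N r H assume lo: "LoW (lft N LoG) w r H"
  from lo show "LoW (lft N LoG) a r H"
  proof (cases rule: LoW_E)
    case Lo_Emp
    then show ?thesis using assms by (simp add: subw_def)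
  next
    case (Lo_Fix Z S)
    obtain i e b d where S: "S i = (Some a, e, b, d) \<or> S i = (d, e, b, Some a)"
      using assms unfolding subw_def Lo_Fix(1) by blast
    then show ?thesis
    proof
      assume Si: "S i = (Some a, e, b, d)"
      obtain A C D where "A \<union> C \<union> D \<subseteq> H" "\<forall>w. Some a = Some w \<longrightarrow> LoW (lft N LoG) w r A"
        by (rule lostepD[OF Lo_Fix(3,2) Si])
      then show ?thesis using LoW_mono[of _ a r A H] by blast
    next
      assume Si: "S i = (d, e, b, Some a)"
      obtain A C D where "A \<union> C \<union> D \<subseteq> H" "\<forall>w. Some a = Some w \<longrightarrow> LoW (lft N LoG) w r D"
        by (rule lostepD[OF Lo_Fix(3,2) Si])
      then show ?thesis using LoW_mono[of _ a r D H] by blast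
    qed
  qed
qed

lemma leW_dominates:
  assumes dom: "\<And>i. \<exists>j. ctxle leW (rel_option leG) (S i) (S' j)"
  shows "leW (WFix S) (WFix S')"
  unfolding leW_def
proof (intro allI impI)
  fix N r H assume lo: "LoW (lft N LoG) (WFix S') r H"
  from lo show "LoW (lft N LoG) (WFix S) r H"
  proof (cases rule: LoW_E)
    case (Lo_Fix Z S'')
    then have lo': "lostep (lft N LoG) S' Z (LoW (lft N LoG))" by simp
    show ?thesis
    proof (rule LoW_FixI[of Z, OF Lo_Fix(2)], rule lostepI)
      fix r H i a e b d assume ZrH: "Z r H" and Si: "S i = (a, e, b, d)"
      obtain j where j: "ctxle leW (rel_option leG) (S i) (S' j)" using dom by blast
      obtain a' e' b' d' where S'j: "S' j = (a', e', b', d')" by (cases "S' j")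
      have c: "rel_option leW a a'" "e = e'" "rel_option leG b b'" "rel_option leW d d'"
        using j unfolding Si S'j by simp_all
      obtain A C D where t: "A \<union> C \<union> D \<subseteq> H" "C \<noteq> {}" "tri r A C D" "\<forall>c\<in>C. E r c = e'" "lft N LoG b' C"
        "a' = None \<longrightarrow> Z r A" "\<forall>w. a' = Some w \<longrightarrow> LoW (lft N LoG) w r A"
        "d' = None \<longrightarrow> Z r D" "\<forall>w. d' = Some w \<longrightarrow> LoW (lft N LoG) w r D"
        by (rule lostepD[OF lo' ZrH S'j])
      have sub: "(x = None \<longrightarrow> Z r X) \<and> (\<forall>w. x = Some w \<longrightarrow> LoW (lft N LoG) w r X)"
        if "rel_option leW x x'" "x' = None \<longrightarrow> Z r X" "\<forall>w. x' = Some w \<longrightarrow> LoW (lft N LoG) w r X" for x x' X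
        using that by (cases x; cases x') (auto simp: leW_def)
      have "\<forall>c\<in>C. E r c = e" using t(4) c(2) by simp
      then show "\<exists>A C D. A \<union> C \<union> D \<subseteq> H \<and> C \<noteq> {} \<and> tri r A C D \<and> (\<forall>c\<in>C. E r c = e) \<and> lft N LoG b C \<and>
          (a = None \<longrightarrow> Z r A) \<and> (\<forall>w. a = Some w \<longrightarrow> LoW (lft N LoG) w r A) \<and>
          (d = None \<longrightarrow> Z r D) \<and> (\<forall>w. d = Some w \<longrightarrow> LoW (lft N LoG) w r D)"
        using t(1-3) lft_down[OF c(3) t(5)] sub[OF c(1) t(6,7)] sub[OF c(4) t(8,9)]
        by - (rule exI[of _ A], rule exI[of _ C], rule exI[of _ D], (elim conjE)?, intro conjI)
    qed
  qed simp
qed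

lemma leG_subg:
  assumes "subg a b" shows "leG a b"
  unfolding leG_def
proof (intro allI impI)
  fix K assume lo: "LoG b K"
  obtain S i where b: "b = GFix S" "Some a \<in> set_wt (S i)" using assms unfolding subg_def by blast
  from lo show "LoG a K"
  proof (cases rule: LoG_E)
    case LoG_Emp
    then show ?thesis using b by simp
  next
    case (LoG_Fix N S')
    then obtain x where x: "LoW (lft N LoG) (S i) x (K - {x})" using b by auto
    obtain C where C: "C \<subseteq> K - {x}" "lft N LoG (Some a) C" using LoW_letter[OF x b(2)] by blast
    have "LoG a C" using C(2) by simp
    then show ?thesis by (rule LoG_mono) (use C(1) in blast)
  qed
qed

lemma leG_dominates:
  assumes dom: "\<And>i. \<exists>j. leW (S i) (S' j)"
  shows "leG (GFix S) (GFix S')"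
  unfolding leG_def
proof (intro allI impI)
  fix K assume lo: "LoG (GFix S') K"
  from lo show "LoG (GFix S) K"
  proof (cases rule: LoG_E)
    case (LoG_Fix N S'')
    show ?thesis
    proof (rule LoG_FixI[of N, OF LoG_Fix(2)], intro allI impI)
      fix K i assume "N K"
      obtain j where j: "leW (S i) (S' j)" using dom by blast
      obtain x where "x \<in> K" "LoW (lft N LoG) (S' j) x (K - {x})" using LoG_Fix(1,3) \<open>N K\<close> by auto
      then show "\<exists>x\<in>K. LoW (lft N LoG) (S i) x (K - {x})" using j unfolding leW_def by blast
    qed
  qed simp
qed

lemma graph_order: "graph_order leG leW"
proof (unfold_locales)
  show "leW x z" if "leW x y" "leW y z" for x y z :: "('i, 'i gt option) wt" using that unfolding leW_def by blast
  show "leW WEmp x" for x :: "('i, 'i gt option) wt" unfolding leW_def by (intro allI impI, rule LoW_Emp)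
  show "leG x z" if "leG x y" "leG y z" for x y z :: "'i gt" using that unfolding leG_def by blast
  show "leG GEmp x" for x :: "'i gt" unfolding leG_def by (intro allI impI, rule LoG_Emp)
qed (fact leW_subw leW_dominates leG_subg leG_dominates)+

section \<open>Existence of terms for all chains and graphs\<close>

type_synonym 'b ix = "('b \<times> 'b set) \<times> 'b"
type_synonym 'b wd = "('b ix, 'b ix gt option) wt"

definition TG :: "'a set \<Rightarrow> bool" where
  "TG K \<longleftrightarrow> (\<exists>t :: 'a ix gt. UpG t K \<and> LoG t K)"

text \<open>Badness passes to supersets, and a set that is not bad is describable together with all
  its subsets.\<close>

definition badg :: "'a set \<Rightarrow> bool" where
  "badg K \<longleftrightarrow> (\<exists>K0\<subseteq>K. \<not> TG K0)"

text \<open>The meaning of the self-reference letter while bad graphs inside \<open>M\<close> are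
  assumed possible; once these are excluded it is empty.\<close>

definition NN :: "'a set \<Rightarrow> 'a set \<Rightarrow> bool" where
  "NN M C \<longleftrightarrow> C \<subseteq> M \<and> badg C"

definition TW :: "'a set \<Rightarrow> 'a \<Rightarrow> 'a set \<Rightarrow> bool" where
  "TW M r H \<longleftrightarrow> (\<exists>w :: 'a wd. UpW (lft (NN M) UpG) w r H \<and> LoW (lft (NN M) LoG) w r H)"

definition badw :: "'a set \<Rightarrow> 'a \<Rightarrow> 'a set \<Rightarrow> bool" where
  "badw M r H \<longleftrightarrow> (\<exists>H0\<subseteq>H. \<not> TW M r H0)"

text \<open>A word all of whose bad pieces admit the same contexts is the fixed point of those contexts.\<close>

lemma words_presented:
  assumes HM: "H \<subseteq> M"
  shows "TW M r H"
proof (rule ccontr)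
  assume "\<not> TW M r H"
  then have bad: "badw M r H" by (auto simp: badw_def)
  interpret graph_order "leG :: 'a ix gt \<Rightarrow> _" leW by (rule graph_order)
  let ?L = "lft (NN M) (LoG :: 'a ix gt \<Rightarrow> _)"
  let ?U = "lft (NN M) (UpG :: 'a ix gt \<Rightarrow> _)"
  let ?LW = "LoW ?L :: 'a wd \<Rightarrow> _"
  let ?UW = "UpW ?U :: 'a wd \<Rightarrow> _"
  \<comment> \<open>The contexts occurring in \<open>H\<close>, where \<open>None\<close> marks bad
    outer parts. They grow with \<open>H\<close> and are closed downwards, as
    \<open>minimal_downset\<close> requires.\<close>
  define I where "I H = {(a, e, b, d) |a e b d. \<exists>A C D. A \<union> C \<union> D \<subseteq> H \<and> C \<noteq> {} \<and> tri r A C D \<and>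
      (\<forall>c\<in>C. E r c = e) \<and> ?L b C \<and> (a = None \<longrightarrow> badw M r A) \<and> (\<forall>w. a = Some w \<longrightarrow> ?LW w r A) \<and>
      (d = None \<longrightarrow> badw M r D) \<and> (\<forall>w. d = Some w \<longrightarrow> ?LW w r D)}" for H
  have II: "(a, e, b, d) \<in> I H \<longleftrightarrow> (\<exists>A C D. A \<union> C \<union> D \<subseteq> H \<and> C \<noteq> {} \<and> tri r A C D \<and>
      (\<forall>c\<in>C. E r c = e) \<and> ?L b C \<and> (a = None \<longrightarrow> badw M r A) \<and> (\<forall>w. a = Some w \<longrightarrow> ?LW w r A) \<and>
      (d = None \<longrightarrow> badw M r D) \<and> (\<forall>w. d = Some w \<longrightarrow> ?LW w r D))" for a e b d H
    unfolding I_def by simp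
  have mono: "I A \<subseteq> I B" if "A \<subseteq> B" for A B
  proof
    fix c assume "c \<in> I A"
    moreover obtain a e b d where c: "c = (a, e, b, d)" by (cases c)
    ultimately have "(a, e, b, d) \<in> I A" by simp
    then obtain A' C D where t: "A' \<union> C \<union> D \<subseteq> A" "C \<noteq> {}" "tri r A' C D" "\<forall>c\<in>C. E r c = e" "?L b C"
        "a = None \<longrightarrow> badw M r A'" "\<forall>w. a = Some w \<longrightarrow> ?LW w r A'"
        "d = None \<longrightarrow> badw M r D" "\<forall>w. d = Some w \<longrightarrow> ?LW w r D"
      unfolding II by (elim exE conjE)
    have "A' \<union> C \<union> D \<subseteq> B" using t(1) that by blast
    then show "c \<in> I B" unfolding c II using t(2-9)
      by - (rule exI[of _ A'], rule exI[of _ C], rule exI[of _ D], intro conjI)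
  qed
  have down: "x \<in> I A" if y: "y \<in> I A" and le: "ctxle leW (rel_option leG) x y" for A x y
  proof -
    obtain a e b d where x: "x = (a, e, b, d)" by (cases x)
    obtain a' e' b' d' where y': "y = (a', e', b', d')" by (cases y)
    have c: "rel_option leW a a'" "e = e'" "rel_option leG b b'" "rel_option leW d d'"
      using le unfolding x y' by simp_all
    obtain A' C D where t: "A' \<union> C \<union> D \<subseteq> A" "C \<noteq> {}" "tri r A' C D" "\<forall>c\<in>C. E r c = e'" "?L b' C"
        "a' = None \<longrightarrow> badw M r A'" "\<forall>w. a' = Some w \<longrightarrow> ?LW w r A'"
        "d' = None \<longrightarrow> badw M r D" "\<forall>w. d' = Some w \<longrightarrow> ?LW w r D"
      using y unfolding y' II by (elim exE conjE)
    have sub: "(x = None \<longrightarrow> badw M r X) \<and> (\<forall>w. x = Some w \<longrightarrow> ?LW w r X)"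
        if "rel_option leW x x'" "x' = None \<longrightarrow> badw M r X" "\<forall>w. x' = Some w \<longrightarrow> ?LW w r X" for x x' X
        using that by (cases x; cases x') (auto simp: leW_def)
    have "\<forall>c\<in>C. E r c = e" using t(4) c(2) by simp
    then show ?thesis unfolding x II
      using t(1-3) lft_down[OF c(3) t(5)] sub[OF c(1) t(6,7)] sub[OF c(4) t(8,9)]
      by - (rule exI[of _ A'], rule exI[of _ C], rule exI[of _ D], (elim conjE)?, intro conjI)
  qed
  have "\<exists>H0\<subseteq>H. badw M r H0 \<and> (\<forall>H1\<subseteq>H0. badw M r H1 \<longrightarrow> I H1 = I H0)"
    by (rule minimal_downset[OF bqo_ctx[OF bqo_letters]], erule mono, erule (1) down, rule bad)
  then obtain H0 where H0': "H0 \<subseteq> H" "badw M r H0" "\<forall>H1\<subseteq>H0. badw M r H1 \<longrightarrow> I H1 = I H0"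
    by (elim exE conjE)
  note H0 = H0'(1,2) H0'(3)[rule_format]
  have emp: "TW M r {}" unfolding TW_def using UpW_Emp LoW_Emp by blast
  have H0ne: "H0 \<noteq> {}" using H0(2) emp by (auto simp: badw_def)
  then obtain v0 where v0: "v0 \<in> H0" by blast
  define OK where "OK H1 v c \<longleftrightarrow> (\<exists>A C D a b d. c = (a, E r v, b, d) \<and> H1 = A \<union> C \<union> D \<and> v \<in> C \<and> tri r A C D \<and>
      ?U b C \<and> ?L b C \<and> (a = None \<longrightarrow> badw M r A) \<and> (\<forall>w. a = Some w \<longrightarrow> ?UW w r A \<and> ?LW w r A) \<and>
      (d = None \<longrightarrow> badw M r D) \<and> (\<forall>w. d = Some w \<longrightarrow> ?UW w r D \<and> ?LW w r D))" for H1 v c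
  have exOK: "\<exists>c. OK H1 v c" if H1: "H1 \<subseteq> H0" "v \<in> H1" for H1 v
  proof -
    define A C D where "A = {u\<in>H1. lt r H1 u v}" and "C = cls r H1 v" and "D = {u\<in>H1. lt r H1 v u}"
    have t: "tri r A C D" "H1 = A \<union> C \<union> D" using tri_cls[OF H1(2), of r] by (simp_all add: A_def C_def D_def)
    have vC: "v \<in> C" unfolding C_def using H1(2) by (rule cls_self)
    have ex: "\<exists>a. (a = None \<longrightarrow> badw M r X) \<and> (\<forall>w. a = Some w \<longrightarrow> ?UW w r X \<and> ?LW w r X)" for X
    proof (cases "badw M r X")
      case True
      then show ?thesis by (intro exI[of _ None]) simp
    next
      case False
      then have "TW M r X" by (auto simp: badw_def)
      then obtain w where "?UW w r X" "?LW w r X" unfolding TW_def by blast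
      then show ?thesis by (intro exI[of _ "Some w"]) simp
    qed
    obtain b where b: "?U b C" "?L b C"
    proof (cases "badg C")
      case True
      then have "NN M C" using t(2) H1 H0(1) HM by (auto simp: NN_def)
      then show thesis by (intro that[of None]) simp_all
    next
      case False
      then have "TG C" by (auto simp: badg_def)
      then obtain t where "UpG (t :: 'a ix gt) C" "LoG t C" unfolding TG_def by blast
      then show thesis by (intro that[of "Some t"]) simp_all
    qed
    obtain a d where a: "a = None \<longrightarrow> badw M r A" "\<forall>w. a = Some w \<longrightarrow> ?UW w r A \<and> ?LW w r A"
      and d: "d = None \<longrightarrow> badw M r D" "\<forall>w. d = Some w \<longrightarrow> ?UW w r D \<and> ?LW w r D"
      using ex[of A] ex[of D] by (elim exE conjE)
    show ?thesis unfolding OK_def using t vC a b d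
      by - (rule exI[of _ "(a, E r v, b, d)"], rule exI[of _ A], rule exI[of _ C], rule exI[of _ D],
          rule exI[of _ a], rule exI[of _ b], rule exI[of _ d], intro conjI refl)
  qed
  have OKI: "c \<in> I H0" if okc: "OK H1 v c" "H1 \<subseteq> H0" "badw M r H1" for H1 v c
  proof -
    obtain A C D a b d where k: "c = (a, E r v, b, d)" "H1 = A \<union> C \<union> D" "v \<in> C" "tri r A C D"
      "?U b C" "?L b C" "a = None \<longrightarrow> badw M r A" "\<forall>w. a = Some w \<longrightarrow> ?UW w r A \<and> ?LW w r A"
      "d = None \<longrightarrow> badw M r D" "\<forall>w. d = Some w \<longrightarrow> ?UW w r D \<and> ?LW w r D"
      using okc(1) unfolding OK_def by (elim exE conjE)
    have "\<forall>c\<in>C. E r c = E r v" using triD(4)[OF k(4) _ k(3)] by blast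
    moreover have "A \<union> C \<union> D \<subseteq> H1" using k(2) by simp
    moreover have "\<forall>w. a = Some w \<longrightarrow> ?LW w r A" "\<forall>w. d = Some w \<longrightarrow> ?LW w r D" "C \<noteq> {}" using k(3,8,10) by auto
    ultimately have "c \<in> I H1" unfolding k(1) II using k(4,6,7,9)
      by - (rule exI[of _ A], rule exI[of _ C], rule exI[of _ D], intro conjI)
    then show ?thesis using H0(3)[OF okc(2,3)] by simp
  qed
  define cx where "cx H1 v = (SOME c. OK H1 v c)" for H1 v
  have cx: "OK H1 v (cx H1 v)" if "H1 \<subseteq> H0" "v \<in> H1" for H1 v
    unfolding cx_def using exOK[OF that] by (rule someI_ex)
  \<comment> \<open>An index consists of a root, a piece and a vertex, so each context that is
    needed has its own index; every other index gets the context at \<open>v0\<close>.\<close>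
  define S :: "'a ix \<Rightarrow> 'a wd option \<times> bool \<times> 'a ix gt option \<times> 'a wd option"
    where "S i = (let H1 = snd (fst i); v = snd i in if H1 \<subseteq> H0 \<and> badw M r H1 \<and> v \<in> H1 then cx H1 v else cx H0 v0)" for i
  have cxI: "cx H1 v \<in> I H0" if "H1 \<subseteq> H0" "badw M r H1" "v \<in> H1" for H1 v
    by (rule OKI[OF cx[OF that(1,3)] that(1,2)])
  have SI: "S i \<in> I H0" for i
    unfolding S_def Let_def using cxI[OF order_refl H0(2) v0] by (simp add: cxI)
  have up: "UpW ?U (WFix S) r H1" if H1: "H1 \<subseteq> H0" "badw M r H1" for H1
  proof (rule UpW_FixI[of "\<lambda>r' H'. r' = r \<and> H' \<subseteq> H0 \<and> badw M r H'"])
    show "r = r \<and> H1 \<subseteq> H0 \<and> badw M r H1" using H1 by simp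
    show "upstep ?U S (\<lambda>r' H'. r' = r \<and> H' \<subseteq> H0 \<and> badw M r H') (UpW ?U)"
    proof (rule upstepI)
      fix r' H' v assume "r' = r \<and> H' \<subseteq> H0 \<and> badw M r H'" and v: "v \<in> H'"
      then have r': "r' = r" and H': "H' \<subseteq> H0" "badw M r H'" by auto
      have "S ((r, H'), v) = cx H' v" using H' v by (simp add: S_def)
      then have "OK H' v (S ((r, H'), v))" using cx[OF H'(1) v] by simp
      then obtain A C D a b d where k: "S ((r, H'), v) = (a, E r v, b, d)" "H' = A \<union> C \<union> D" "v \<in> C" "tri r A C D"
        "?U b C" "?L b C" "a = None \<longrightarrow> badw M r A" "\<forall>w. a = Some w \<longrightarrow> ?UW w r A \<and> ?LW w r A"
        "d = None \<longrightarrow> badw M r D" "\<forall>w. d = Some w \<longrightarrow> ?UW w r D \<and> ?LW w r D"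
        unfolding OK_def by (elim exE conjE)
      have "a = None \<longrightarrow> r = r \<and> A \<subseteq> H0 \<and> badw M r A" "d = None \<longrightarrow> r = r \<and> D \<subseteq> H0 \<and> badw M r D"
        using k(2,7,9) H'(1) by auto
      moreover have "\<forall>w. a = Some w \<longrightarrow> ?UW w r A" "\<forall>w. d = Some w \<longrightarrow> ?UW w r D" using k(8,10) by auto
      ultimately show "\<exists>A C D i a b d. H' = A \<union> C \<union> D \<and> v \<in> C \<and> tri r' A C D \<and> S i = (a, E r' v, b, d) \<and> ?U b C \<and>
         (a = None \<longrightarrow> r' = r \<and> A \<subseteq> H0 \<and> badw M r A) \<and> (\<forall>w. a = Some w \<longrightarrow> ?UW w r' A) \<and>
         (d = None \<longrightarrow> r' = r \<and> D \<subseteq> H0 \<and> badw M r D) \<and> (\<forall>w. d = Some w \<longrightarrow> ?UW w r' D)"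
        unfolding r' using k(1-5)
        by - (rule exI[of _ A], rule exI[of _ C], rule exI[of _ D], rule exI[of _ "((r, H'), v)"],
          rule exI[of _ a], rule exI[of _ b], rule exI[of _ d], intro conjI)
    qed
  qed
  have lo: "LoW ?L (WFix S) r H1" if H1: "H1 \<subseteq> H0" "badw M r H1" for H1
  proof (rule LoW_FixI[of "\<lambda>r' H'. r' = r \<and> H' \<subseteq> H0 \<and> badw M r H'"])
    show "r = r \<and> H1 \<subseteq> H0 \<and> badw M r H1" using H1 by simp
    show "lostep ?L S (\<lambda>r' H'. r' = r \<and> H' \<subseteq> H0 \<and> badw M r H') (LoW ?L)"
    proof (rule lostepI)
      fix r' H' i a e b d assume "r' = r \<and> H' \<subseteq> H0 \<and> badw M r H'" and Si: "S i = (a, e, b, d)"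
      then have r': "r' = r" and H': "H' \<subseteq> H0" "badw M r H'" by auto
      \<comment> \<open>Minimality of \<open>H0\<close>: a context taken from one bad subset occurs
        in all of them.\<close>
      have "(a, e, b, d) \<in> I H'" using SI[of i] H0(3)[OF H'] Si by simp
      then obtain A C D where t: "A \<union> C \<union> D \<subseteq> H'" "C \<noteq> {}" "tri r A C D" "\<forall>c\<in>C. E r c = e" "?L b C"
        "a = None \<longrightarrow> badw M r A" "\<forall>w. a = Some w \<longrightarrow> ?LW w r A"
        "d = None \<longrightarrow> badw M r D" "\<forall>w. d = Some w \<longrightarrow> ?LW w r D"
        unfolding II by (elim exE conjE)
      have "a = None \<longrightarrow> r = r \<and> A \<subseteq> H0 \<and> badw M r A" "d = None \<longrightarrow> r = r \<and> D \<subseteq> H0 \<and> badw M r D"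
        using t(1,6,8) H'(1) by auto
      then show "\<exists>A C D. A \<union> C \<union> D \<subseteq> H' \<and> C \<noteq> {} \<and> tri r' A C D \<and> (\<forall>c\<in>C. E r' c = e) \<and> ?L b C \<and>
         (a = None \<longrightarrow> r' = r \<and> A \<subseteq> H0 \<and> badw M r A) \<and> (\<forall>w. a = Some w \<longrightarrow> ?LW w r' A) \<and>
         (d = None \<longrightarrow> r' = r \<and> D \<subseteq> H0 \<and> badw M r D) \<and> (\<forall>w. d = Some w \<longrightarrow> ?LW w r' D)"
        unfolding r' using t(1-5,7,9) by - (rule exI[of _ A], rule exI[of _ C], rule exI[of _ D], intro conjI)
    qed
  qed
  \<comment> \<open>Bad subsets of \<open>H0\<close> are described by the fixed point and the other
    subsets by definition, against the badness of \<open>H0\<close>.\<close>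
  have "TW M r H1" if "H1 \<subseteq> H0" for H1
  proof (cases "badw M r H1")
    case True
    then show ?thesis using up[OF that] lo[OF that] unfolding TW_def by blast
  next
    case False
    then show ?thesis by (auto simp: badw_def)
  qed
  then show False using H0(2) by (auto simp: badw_def)
qed

text \<open>The fixed-point argument one level higher: \<open>I K\<close> consists of the words that
  bound the chain of some vertex of \<open>K\<close> from below, and all bad subsets of a minimal
  \<open>m\<close> share it.\<close>

lemma graphs_presented: "\<not> badg K"
proof
  assume bad: "badg K"
  interpret graph_order "leG :: 'a ix gt \<Rightarrow> _" leW by (rule graph_order)
  let ?L = "\<lambda>M. lft (NN M) (LoG :: 'a ix gt \<Rightarrow> _)"
  let ?U = "\<lambda>M. lft (NN M) (UpG :: 'a ix gt \<Rightarrow> _)"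
  have NNmono: "NN B C" if "NN A C" "A \<subseteq> B" for A B C using that by (auto simp: NN_def)
  have Lmono: "LoW (?L B) w x H" if "LoW (?L A) w x H" "A \<subseteq> B" for A B w x H
    by (rule LoW_mono_letters[OF that(1)], erule lft_mono, erule NNmono[OF _ that(2)], assumption)
  have Umono: "UpW (?U B) w x H" if "UpW (?U A) w x H" "A \<subseteq> B" for A B w x H
    by (rule UpW_mono_letters[OF that(1)], erule lft_mono, erule NNmono[OF _ that(2)], assumption)
  define I where "I K = {w :: 'a wd. \<exists>x\<in>K. LoW (?L K) w x (K - {x})}" for K
  have mono: "I A \<subseteq> I B" if "A \<subseteq> B" for A B
  proof
    fix w assume "w \<in> I A"
    then obtain x where x: "x \<in> A" "LoW (?L A) w x (A - {x})" by (auto simp: I_def)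
    have "LoW (?L B) w x (A - {x})" by (rule Lmono[OF x(2) that])
    then have "LoW (?L B) w x (B - {x})" by (rule LoW_mono) (use that in blast)
    then show "w \<in> I B" using x(1) that by (auto simp: I_def)
  qed
  have down: "w \<in> I A" if "w' \<in> I A" "leW w w'" for A w w'
    using that unfolding I_def leW_def by blast
  have "\<exists>m\<subseteq>K. badg m \<and> (\<forall>K1\<subseteq>m. badg K1 \<longrightarrow> I K1 = I m)"
    by (rule minimal_downset[OF bqo_words[OF bqo_letters]], erule mono, erule (1) down, rule bad)
  then obtain m where m': "m \<subseteq> K" "badg m" "\<forall>K1\<subseteq>m. badg K1 \<longrightarrow> I K1 = I m"
    by (elim exE conjE)
  note m = m'(1,2) m'(3)[rule_format]
  have "TG {}" unfolding TG_def using UpG_Emp LoG_Emp by blast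
  then have "m \<noteq> {}" using m(2) by (auto simp: badg_def)
  then obtain x0 where x0: "x0 \<in> m" by blast
  \<comment> \<open>Words are chosen relative to \<open>K1\<close>, where
    \<open>words_presented\<close> applies, and are carried to \<open>m\<close> by monotonicity of
    \<open>NN\<close>.\<close>
  define wf where "wf K1 x = (SOME w :: 'a wd. UpW (?U K1) w x (K1 - {x}) \<and> LoW (?L K1) w x (K1 - {x}))" for K1 x
  have wf: "UpW (?U K1) (wf K1 x) x (K1 - {x}) \<and> LoW (?L K1) (wf K1 x) x (K1 - {x})" for K1 x
    unfolding wf_def by (rule someI_ex) (use words_presented[of "K1 - {x}" K1 x] in \<open>auto simp: TW_def\<close>)
  define S :: "'a ix \<Rightarrow> 'a wd" where
    "S i = (let K1 = snd (fst i); x = snd i in if K1 \<subseteq> m \<and> badg K1 \<and> x \<in> K1 then wf K1 x else wf m x0)" for i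
  have wfI: "wf K1 x \<in> I m" if "K1 \<subseteq> m" "badg K1" "x \<in> K1" for K1 x
    using m(3)[OF that(1,2)] wf[of K1 x] that(3) unfolding I_def by blast
  have SI: "S i \<in> I m" for i
    unfolding S_def Let_def using wfI x0 m(2) by (auto split: if_splits)
  have NNm: "K1 \<subseteq> m \<and> badg K1" if "NN m K1" for K1 using that by (simp add: NN_def)
  have up: "UpG (GFix S) K1" if K1: "K1 \<subseteq> m" "badg K1" for K1
  proof (rule UpG_FixI[of "NN m"])
    show "NN m K1" using K1 by (simp add: NN_def)
    show "\<forall>K. NN m K \<longrightarrow> (\<forall>x\<in>K. \<exists>i. UpW (?U m) (S i) x (K - {x}))"
    proof (intro allI impI ballI)
      fix K x assume K: "NN m K" and x: "x \<in> K"
      have "S ((x, K), x) = wf K x" using NNm[OF K] x by (simp add: S_def)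
      moreover have "UpW (?U m) (wf K x) x (K - {x})" using wf[of K x] NNm[OF K] Umono by blast
      ultimately show "\<exists>i. UpW (?U m) (S i) x (K - {x})" by metis
    qed
  qed
  have lo: "LoG (GFix S) K1" if K1: "K1 \<subseteq> m" "badg K1" for K1
  proof (rule LoG_FixI[of "NN m"])
    show "NN m K1" using K1 by (simp add: NN_def)
    show "\<forall>K. NN m K \<longrightarrow> (\<forall>i. \<exists>x\<in>K. LoW (?L m) (S i) x (K - {x}))"
    proof (intro allI impI)
      fix K i assume K: "NN m K"
      have "S i \<in> I K" using SI[of i] m(3)[of K] NNm[OF K] by simp
      then obtain x where "x \<in> K" "LoW (?L K) (S i) x (K - {x})" by (auto simp: I_def)
      then show "\<exists>x\<in>K. LoW (?L m) (S i) x (K - {x})" using Lmono NNm[OF K] by blast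
    qed
  qed
  have "TG K1" if "K1 \<subseteq> m" for K1
  proof (cases "badg K1")
    case True
    then show ?thesis using up[OF that] lo[OF that] unfolding TG_def by blast
  next
    case False
    then show ?thesis by (auto simp: badg_def)
  qed
  then show False using m(2) by (auto simp: badg_def)
qed

text \<open>The term \<open>w i\<close> bounds the \<open>i\<close>-th piece from above and, being
  below \<open>w j\<close>, also bounds the \<open>j\<close>-th piece from below.\<close>

theorem rooted_wqo:
  assumes H: "\<And>n. H n \<subseteq> V"
  shows "\<exists>i j. i < j \<and> wle (r i) (H i) (r j) (H (j :: nat))"
proof -
  interpret graph_order "leG :: 'a ix gt \<Rightarrow> _" leW by (rule graph_order)
  have NN: "NN V = (\<lambda>_. False)" using graphs_presented by (auto simp: NN_def)
  let ?L = "lft (\<lambda>_. False) (LoG :: 'a ix gt \<Rightarrow> _)"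
  let ?U = "lft (\<lambda>_. False) (UpG :: 'a ix gt \<Rightarrow> _)"
  have "\<forall>n. \<exists>w :: 'a wd. UpW ?U w (r n) (H n) \<and> LoW ?L w (r n) (H n)"
  proof
    fix n show "\<exists>w :: 'a wd. UpW ?U w (r n) (H n) \<and> LoW ?L w (r n) (H n)"
      using words_presented[OF H, of "r n" n] unfolding TW_def NN .
  qed
  from choice[OF this] obtain w :: "nat \<Rightarrow> 'a wd"
    where "\<forall>n. UpW ?U (w n) (r n) (H n) \<and> LoW ?L (w n) (r n) (H n)" by (rule exE)
  then have w: "UpW ?U (w n) (r n) (H n)" "LoW ?L (w n) (r n) (H n)" for n by simp_all
  have "bqo (leW :: 'a wd \<Rightarrow> _)" by (rule bqo_words[OF bqo_letters])
  then have "\<exists>i j. i < j \<and> leW (w i) (w j)" by (rule bqo_imp_good)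
  then obtain i j where ij: "i < j" "leW (w i) (w j)" by (elim exE conjE)
  have lo: "LoW ?L (w i) (r j) (H j)" using ij(2) w(2)[of j] by (simp add: leW_def)
  define Q where "Q C C' \<longleftrightarrow> (C \<subseteq> V \<longrightarrow> gle C C')" for C C'
  have "sim Q (r i) (H i) (r j) (H j)"
  proof (rule sound_word[OF w(1) lo])
    fix b C C' assume "?U b C" "?L b C'"
    then show "Q C C'" using sound_graph by (cases b) (auto simp: Q_def)
  qed
  then have "wle (r i) (H i) (r j) (H j)"
  proof (rule sim_wle[OF _ H])
    fix C C' x assume "Q C C'" "C \<subseteq> V" "x \<in> C"
    then obtain x' where "x' \<in> C'" "wle x (C - {x}) x' (C' - {x'})" using gle_wle unfolding Q_def by blast
    then show "\<exists>x'\<in>C'. sim Q x (C - {x}) x' (C' - {x'})" using wle_sim[of _ _ _ _ Q] unfolding Q_def by blast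
  qed
  then show ?thesis using ij(1) by blast
qed

end

section \<open>Counting isomorphism types\<close>

text \<open>\<open>Ks R U v n\<close> is the \<open>n\<close>-th class after \<open>v\<close>, when the classes after \<open>v\<close> follow each other with alternating colours;
  then \<open>u \<in> nxt R U v\<close> fails for a later \<open>u\<close> of the colour of the next class, since two classes lie between.\<close>

definition lz :: "('v \<Rightarrow> 'v \<Rightarrow> bool) \<Rightarrow> 'v \<Rightarrow> bool \<Rightarrow> 'v \<Rightarrow> 'v \<Rightarrow> bool" where
  "lz F r d u v \<longleftrightarrow> F r u \<noteq> F r v \<and> (if d then F u v = F r v else F u v = F r u)"

definition nxt :: "('v \<Rightarrow> 'v \<Rightarrow> bool) \<Rightarrow> 'v set \<Rightarrow> 'v \<Rightarrow> 'v set" where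
  "nxt R U v = {u \<in> U. R v u \<and> \<not> (\<exists>w\<in>U. \<exists>w'\<in>U. R v w \<and> R w w' \<and> R w' u)}"

primrec Ks :: "('v \<Rightarrow> 'v \<Rightarrow> bool) \<Rightarrow> 'v set \<Rightarrow> 'v \<Rightarrow> nat \<Rightarrow> 'v set" where
  "Ks R U v 0 = {v}"
| "Ks R U v (Suc n) = (\<Union>a\<in>Ks R U v n. nxt R U a)"

text \<open>It depends only on the graph, a root, a direction and a start vertex, so a countable
  graph has countably many spectra. \<open>d\<close> false reads the chain backwards, for descending
  runs. Index 0 yields only the start vertex, so sizes are read from index 1 on.\<close>

definition spec :: "'v set \<Rightarrow> ('v \<Rightarrow> 'v \<Rightarrow> bool) \<Rightarrow> 'v \<Rightarrow> bool \<Rightarrow> 'v \<Rightarrow> nat set" where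
  "spec W F r d v = {n. card (Ks (lz F r d) (W - {r}) v n) = 2}"

lemma nxt_subset: "nxt R U a \<subseteq> U"
  by (auto simp: nxt_def)

lemma Ks_subset: "v \<in> U \<Longrightarrow> Ks R U v n \<subseteq> U"
  by (cases n) (auto dest: subsetD[OF nxt_subset])

lemma nxt_image:
  assumes f: "bij_betw f U U'" and R: "\<And>u v. u \<in> U \<Longrightarrow> v \<in> U \<Longrightarrow> R' (f u) (f v) = R u v" and a: "a \<in> U"
  shows "nxt R' U' (f a) = f ` nxt R U a"
proof -
  have U': "U' = f ` U" using f by (simp add: bij_betw_def)
  have "f u \<in> nxt R' U' (f a) \<longleftrightarrow> u \<in> nxt R U a" if "u \<in> U" for u
    unfolding nxt_def U' using that a R by simp
  then show ?thesis using nxt_subset[of R' U' "f a"] nxt_subset[of R U a] unfolding U' by blast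
qed

lemma Ks_image:
  assumes f: "bij_betw f U U'" and R: "\<And>u v. u \<in> U \<Longrightarrow> v \<in> U \<Longrightarrow> R' (f u) (f v) = R u v" and v: "v \<in> U"
  shows "Ks R' U' (f v) n = f ` Ks R U v n"
proof (induction n)
  case (Suc n)
  have "nxt R' U' (f a) = f ` nxt R U a" if "a \<in> Ks R U v n" for a
    using nxt_image[of f U U' R' R a, OF f R] Ks_subset[OF v, of R n] that by blast
  then show ?case using Suc by (simp add: image_UN)
qed simp

lemma spec_iso:
  assumes f: "bij_betw f W W'" and F: "\<And>u v. u \<in> W \<Longrightarrow> v \<in> W \<Longrightarrow> F u v = F' (f u) (f v)"
    and r: "r \<in> W" and v: "v \<in> W - {r}"
  shows "spec W' F' (f r) d (f v) = spec W F r d v"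
proof -
  have inj: "inj_on f W" and W': "W' = f ` W" using f by (auto simp: bij_betw_def)
  have "W' - {f r} = f ` (W - {r})" unfolding W' using inj r by (auto simp: inj_on_def)
  then have b: "bij_betw f (W - {r}) (W' - {f r})" using inj by (auto simp: bij_betw_def intro: inj_on_subset)
  have "Ks (lz F' (f r) d) (W' - {f r}) (f v) n = f ` Ks (lz F r d) (W - {r}) v n" for n
    by (rule Ks_image[OF b _ v]) (use F r in \<open>simp add: lz_def\<close>)
  moreover have "card (f ` Ks (lz F r d) (W - {r}) v n) = card (Ks (lz F r d) (W - {r}) v n)" for n
    by (rule card_image) (use inj Ks_subset[OF v] in \<open>auto intro: inj_on_subset\<close>)
  ultimately show ?thesis by (simp add: spec_def)
qed

text \<open>A run is an infinite sequence of consecutive classes of alternating colours; \<open>D\<close> is its set of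
  vertices and \<open>pos\<close> the position of the class.\<close>

lemma Ks_run:
  assumes D: "D \<subseteq> U" and ne: "\<And>p. \<exists>a\<in>D. pos a = p"
    and R: "\<And>a b. a \<in> D \<Longrightarrow> b \<in> D \<Longrightarrow> R a b \<longleftrightarrow> even (pos a :: nat) \<noteq> even (pos b) \<and> pos a < pos b"
    and out: "\<And>a c d. a \<in> D \<Longrightarrow> c \<in> U - D \<Longrightarrow> R a c \<Longrightarrow> d \<in> D \<Longrightarrow> even (pos d) = even (pos a) \<Longrightarrow> R d c"
    and o1: "\<And>a c u. a \<in> D \<Longrightarrow> c \<in> U - D \<Longrightarrow> R a c \<Longrightarrow> u \<in> D \<Longrightarrow> \<not> R c u"
    and o2: "\<And>a c c' u. a \<in> D \<Longrightarrow> c \<in> U - D \<Longrightarrow> c' \<in> U - D \<Longrightarrow> R a c \<Longrightarrow> R c c' \<Longrightarrow> u \<in> D \<Longrightarrow> \<not> R c' u"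
    and v: "v \<in> D" "pos v = 0"
  shows "Ks R U v (Suc n) = {a \<in> D. pos a = Suc n}"
proof -
  \<comment> \<open>Positions of equal parity are incomparable. A position three or more ahead has
    two run classes in between, the next one has none, and the hypotheses on outside vertices keep
    these from interfering.\<close>
  have nx: "nxt R U a = {b \<in> D. pos b = Suc (pos a)}" if a: "a \<in> D" for a
  proof (intro equalityI subsetI)
    fix u assume u: "u \<in> nxt R U a"
    then have uU: "u \<in> U" and au: "R a u" and no: "\<And>w w'. w \<in> U \<Longrightarrow> w' \<in> U \<Longrightarrow> R a w \<Longrightarrow> R w w' \<Longrightarrow> \<not> R w' u"
      by (auto simp: nxt_def)
    obtain w where w: "w \<in> D" "pos w = Suc (pos a)" using ne by blast
    obtain w' where w': "w' \<in> D" "pos w' = Suc (Suc (pos a))" using ne by blast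
    have aw: "R a w" "R w w'" using R a w w' by auto
    have wU: "w \<in> U" "w' \<in> U" using w w' D by auto
    have uD: "u \<in> D"
    proof (rule ccontr)
      assume "u \<notin> D"
      then have "R w' u" using out[OF a _ au w'(1)] uU w'(2) by simp
      then show False using no[OF wU aw] by blast
    qed
    have 1: "even (pos a) \<noteq> even (pos u)" "pos a < pos u" using R[OF a uD] au by auto
    have "\<not> R w' u" using no[OF wU aw] .
    then have "\<not> (even (pos w') \<noteq> even (pos u) \<and> pos w' < pos u)" using R[OF w'(1) uD] by simp
    then have "\<not> Suc (Suc (pos a)) < pos u" using 1(1) w'(2) by simp
    moreover have "pos u \<noteq> Suc (Suc (pos a))" using 1(1) by auto
    ultimately have "pos u = Suc (pos a)" using 1(2) by linarith
    then show "u \<in> {b \<in> D. pos b = Suc (pos a)}" using uD by simp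
  next
    fix u assume "u \<in> {b \<in> D. pos b = Suc (pos a)}"
    then have u: "u \<in> D" "pos u = Suc (pos a)" by auto
    have "R a u" using R[OF a u(1)] u(2) by simp
    moreover have False if w: "w \<in> U" "w' \<in> U" "R a w" "R w w'" "R w' u" for w w'
    proof (cases "w \<in> D")
      case wD: True
      show False
      proof (cases "w' \<in> D")
        case True
        then show False using R[OF a wD] R[OF wD True] R[OF True u(1)] w u(2) by simp
      next
        case False
        then show False using o1[OF wD _ w(4) u(1)] w by blast
      qed
    next
      case wD: False
      show False
      proof (cases "w' \<in> D")
        case True
        then show False using o1[OF a _ w(3) True] wD w by blast
      next
        case False
        then show False using o2[OF a _ _ w(3,4) u(1)] wD w by blast
      qed
    qed
    ultimately show "u \<in> nxt R U a" using u(1) D by (auto simp: nxt_def)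
  qed
  show ?thesis
  proof (induction n)
    case 0
    show ?case using nx[OF v(1)] v(2) by simp
  next
    case (Suc n)
    obtain b where b: "b \<in> D" "pos b = Suc n" using ne by blast
    have "Ks R U v (Suc (Suc n)) = (\<Union>a\<in>{a \<in> D. pos a = Suc n}. nxt R U a)" using Suc by simp
    also have "\<dots> = (\<Union>a\<in>{a \<in> D. pos a = Suc n}. {b \<in> D. pos b = Suc (Suc n)})"
      using nx by (intro SUP_cong) auto
    also have "\<dots> = {b \<in> D. pos b = Suc (Suc n)}" using b by auto
    finally show ?case .
  qed
qed

lemma uncountable_nat_sets: "uncountable (UNIV :: nat set set)"
proof
  assume "countable (UNIV :: nat set set)"
  then have "range (from_nat_into (UNIV :: nat set set)) = UNIV" by (intro range_from_nat_into) auto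
  then show False using Cantors_theorem[of "UNIV :: nat set"] by (metis Pow_UNIV)
qed

text \<open>\<open>A\<close> is determined by the representative of its class and its number within
  the class. So all sets of numbers inject into representatives times \<open>nat\<close>, and the
  infinite set of representatives absorbs the factor \<open>nat\<close>.\<close>

lemma transversal:
  assumes refl: "\<And>A. eq A A" and sym: "\<And>A B. eq A B \<Longrightarrow> eq B A" and trans: "\<And>A B C. eq A B \<Longrightarrow> eq B C \<Longrightarrow> eq A C"
    and cnt: "\<And>A :: nat set. countable {B. eq A B}"
  shows "\<exists>h :: nat set \<Rightarrow> nat set. \<forall>A B. A \<noteq> B \<longrightarrow> \<not> eq (h A) (h B)"
proof -
  define rep where "rep A = (SOME B. eq A B)" for A
  have rep: "eq A (rep A)" for A unfolding rep_def using refl by (rule someI)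
  have rep_eq: "rep A = rep B" if "eq A B" for A B
  proof -
    have "eq A = eq B" using that sym trans by blast
    then show ?thesis by (simp add: rep_def)
  qed
  let ?T = "range rep"
  define g where "g A = (rep A, to_nat_on {B. eq (rep A) B} A)" for A
  have "inj g"
  proof (rule injI)
    fix A B assume eq: "g A = g B"
    have A: "A \<in> {C. eq (rep A) C}" "B \<in> {C. eq (rep B) C}" using rep sym by auto
    have "rep A = rep B" "to_nat_on {C. eq (rep A) C} A = to_nat_on {C. eq (rep A) C} B"
      using eq by (auto simp: g_def)
    then show "A = B" using A inj_on_to_nat_on[OF cnt, of "rep A"] by (metis inj_onD)
  qed
  then have le: "(card_of (UNIV :: nat set set), card_of (?T \<times> (UNIV :: nat set))) \<in> ordLeq"
    unfolding card_of_ordLeq[symmetric] by (intro exI[of _ g]) (auto simp: g_def)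
  have infT: "infinite ?T"
  proof
    assume "finite ?T"
    then have "countable (?T \<times> (UNIV :: nat set))" by (simp add: countable_finite)
    moreover have "g ` UNIV \<subseteq> ?T \<times> (UNIV :: nat set)" by (auto simp: g_def)
    ultimately have "countable (range g)" using countable_subset by blast
    then have "countable (UNIV :: nat set set)" using \<open>inj g\<close> by (rule countable_image_inj_on)
    then show False using uncountable_nat_sets by blast
  qed
  have "(card_of (?T \<times> (UNIV :: nat set)), card_of (?T)) \<in> ordLeq"
  proof -
    have "(card_of (UNIV :: nat set), card_of ?T) \<in> ordLeq" using infT infinite_iff_card_of_nat by blast
    then have "(card_of (?T \<times> (UNIV :: nat set)), card_of ?T) \<in> ordIso"
      using infT by (intro card_of_Times_infinite_simps(1)) auto
    then show ?thesis by (rule ordIso_imp_ordLeq)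
  qed
  then have "(card_of (UNIV :: nat set set), card_of (?T)) \<in> ordLeq" by (rule ordLeq_transitive[OF le])
  then have "\<exists>h :: nat set \<Rightarrow> nat set. inj_on h UNIV \<and> h ` UNIV \<subseteq> ?T" by (rule iffD2[OF card_of_ordLeq])
  then obtain h :: "nat set \<Rightarrow> nat set" where h: "inj_on h UNIV" "h ` UNIV \<subseteq> ?T" by (elim exE conjE)
  have "h A = h B" if "eq (h A) (h B)" for A B
  proof -
    have "h A \<in> ?T" "h B \<in> ?T" using h(2) by (simp_all only: image_subset_iff UNIV_I)
    then obtain C D where CD: "h A = rep C" "h B = rep D" by (elim rangeE)
    have "eq C (rep D)" using trans[OF rep[of C]] \<open>eq (h A) (h B)\<close> CD by simp
    then have "eq C D" by (rule trans) (rule sym[OF rep[of D]])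
    then show ?thesis using rep_eq CD by simp
  qed
  then show ?thesis using h(1) by (metis injD)
qed

section \<open>Isomorphism, embedding and transport to the natural numbers\<close>

lemma rtranclp_stays:
  assumes "R\<^sup>*\<^sup>* a b" "a \<in> K" "\<And>u v. u \<in> K \<Longrightarrow> R u v \<Longrightarrow> v \<in> K"
  shows "b \<in> K"
  using assms by (induction) auto

lemma graph_iso_refl: "graph_iso V E V E"
  unfolding graph_iso_def by (intro exI[of _ id]) auto

lemma graph_iso_sym:
  assumes "graph_iso V E V' E'" shows "graph_iso V' E' V E"
proof -
  obtain f where f: "bij_betw f V V'" "\<forall>x\<in>V. \<forall>y\<in>V. E x y = E' (f x) (f y)"
    using assms by (auto simp: graph_iso_def)
  let ?g = "inv_into V f"
  have g: "bij_betw ?g V' V" using f(1) by (rule bij_betw_inv_into)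
  have "E' x y = E (?g x) (?g y)" if "x \<in> V'" "y \<in> V'" for x y
  proof -
    have "?g x \<in> V" "?g y \<in> V" "f (?g x) = x" "f (?g y) = y"
      using that f(1) g by (auto simp: bij_betw_def f_inv_into_f)
    then show ?thesis using f(2) by simp
  qed
  then show ?thesis using g by (auto simp: graph_iso_def)
qed

lemma graph_iso_trans:
  assumes "graph_iso V E V' E'" "graph_iso V' E' V'' E''" shows "graph_iso V E V'' E''"
proof -
  obtain f where f: "bij_betw f V V'" "\<forall>x\<in>V. \<forall>y\<in>V. E x y = E' (f x) (f y)"
    using assms(1) by (auto simp: graph_iso_def)
  obtain g where g: "bij_betw g V' V''" "\<forall>x\<in>V'. \<forall>y\<in>V'. E' x y = E'' (g x) (g y)"
    using assms(2) by (auto simp: graph_iso_def)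
  have "bij_betw (g \<circ> f) V V''" using f(1) g(1) by (rule bij_betw_trans)
  moreover have "\<forall>x\<in>V. \<forall>y\<in>V. E x y = E'' ((g \<circ> f) x) ((g \<circ> f) y)"
    using f g(2) by (auto simp: bij_betw_def)
  ultimately show ?thesis unfolding graph_iso_def by blast
qed

lemma graph_iso_embeds: "graph_iso V E V' E' \<Longrightarrow> embeds V E V' E'"
  unfolding graph_iso_def embeds_def bij_betw_def by blast

lemma embeds_trans:
  assumes "embeds V E V' E'" "embeds V' E' V'' E''" shows "embeds V E V'' E''"
proof -
  obtain f where f: "inj_on f V" "f ` V \<subseteq> V'" "\<forall>x\<in>V. \<forall>y\<in>V. E x y = E' (f x) (f y)"
    using assms(1) by (auto simp: embeds_def)
  obtain g where g: "inj_on g V'" "g ` V' \<subseteq> V''" "\<forall>x\<in>V'. \<forall>y\<in>V'. E' x y = E'' (g x) (g y)"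
    using assms(2) by (auto simp: embeds_def)
  have "inj_on (g \<circ> f) V" using f g(1) by (auto intro: comp_inj_on inj_on_subset)
  moreover have fV: "f x \<in> V'" if "x \<in> V" for x using f(2) that by blast
  moreover have "g (f x) \<in> V''" if "x \<in> V" for x using g(2) fV[OF that] by blast
  ultimately show ?thesis unfolding embeds_def using f(3) g(3) by (intro exI[of _ "g \<circ> f"]) auto
qed

lemma graph_connected_iso:
  assumes "graph_iso V E V' E'" "graph_connected V E" "\<And>a b. E a b \<Longrightarrow> b \<in> V"
  shows "graph_connected V' E'"
proof -
  obtain f where f: "bij_betw f V V'" "\<forall>x\<in>V. \<forall>y\<in>V. E x y = E' (f x) (f y)"
    using assms(1) by (auto simp: graph_iso_def)
  have V': "V' = f ` V" using f(1) by (simp add: bij_betw_def)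
  have "b \<in> V \<and> E'\<^sup>*\<^sup>* (f a) (f b)" if "E\<^sup>*\<^sup>* a b" "a \<in> V" for a b
    using that
  proof induction
    case (step b c)
    then have b: "b \<in> V" "E'\<^sup>*\<^sup>* (f a) (f b)" by blast+
    have c: "c \<in> V" using step(2) by (rule assms(3))
    then have "E' (f b) (f c)" using f(2) b(1) step(2) by blast
    with b(2) c show ?case by (auto intro: rtranclp.rtrancl_into_rtrancl)
  qed simp
  then show ?thesis using assms(2) unfolding graph_connected_def V' by blast
qed

lemma compl_graph_iso:
  assumes "graph_iso V E V' E'" shows "graph_iso V (compl_graph V E) V' (compl_graph V' E')"
proof -
  obtain f where f: "bij_betw f V V'" "\<forall>x\<in>V. \<forall>y\<in>V. E x y = E' (f x) (f y)"
    using assms(1) by (auto simp: graph_iso_def)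
  have "compl_graph V E x y = compl_graph V' E' (f x) (f y)" if "x \<in> V" "y \<in> V" for x y
    using f that by (auto simp: compl_graph_def bij_betw_def inj_on_def)
  then show ?thesis unfolding graph_iso_def using f(1) by blast
qed

lemma graph_on_nat:
  assumes "countable W" "is_graph W F"
  shows "\<exists>(U :: nat set) D. is_graph U D \<and> graph_iso W F U D"
proof -
  let ?g = "to_nat_on W"
  have g: "inj_on ?g W" using assms(1) by (rule inj_on_to_nat_on)
  define D where "D i j \<longleftrightarrow> (\<exists>u\<in>W. \<exists>v\<in>W. i = ?g u \<and> j = ?g v \<and> F u v)" for i j
  have "is_graph (?g ` W) D"
    unfolding is_graph_def
  proof (intro allI impI)
    fix i j assume "D i j"
    then obtain u v where "u \<in> W" "v \<in> W" "i = ?g u" "j = ?g v" "F u v" by (auto simp: D_def)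
    then show "i \<in> ?g ` W \<and> j \<in> ?g ` W \<and> i \<noteq> j \<and> D j i"
      using assms(2) g unfolding is_graph_def D_def by (metis imageI inj_onD)
  qed
  moreover have "F u v = D (?g u) (?g v)" if "u \<in> W" "v \<in> W" for u v
    unfolding D_def using that g by (metis inj_onD)
  then have "graph_iso W F (?g ` W) D"
    unfolding graph_iso_def using g by (intro exI[of _ ?g]) (auto simp: bij_betw_def)
  ultimately show ?thesis by blast
qed

text \<open>An isomorphism carries the root and the start vertex of a code for \<open>B\<close> into
  \<open>W A\<close>. So \<open>B\<close> is one of the countably many sets decodable there,
  isomorphism classes are countable, and \<open>transversal\<close> applies.\<close>

lemma continuum_many:
  fixes W :: "nat set \<Rightarrow> 'w set" and F :: "nat set \<Rightarrow> 'w \<Rightarrow> 'w \<Rightarrow> bool"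
  assumes G: "\<And>A. countable (W A)" "\<And>A. is_graph (W A) (F A)" "\<And>A. equimorphic (W A) (F A) V E"
    "\<And>A. graph_connected (W A) (F A)" "\<And>A. graph_connected (W A) (compl_graph (W A) (F A))"
    and code: "\<And>A. \<exists>r\<in>W A. \<exists>v\<in>W A - {r}. \<exists>d. A = dec (spec (W A) (F A) r d v)"
  shows "\<exists>(GV :: nat set \<Rightarrow> nat set) GE.
    (\<forall>A. is_graph (GV A) (GE A) \<and> equimorphic (GV A) (GE A) V E \<and> graph_connected (GV A) (GE A) \<and>
       graph_connected (GV A) (compl_graph (GV A) (GE A))) \<and>
    (\<forall>A B. A \<noteq> B \<longrightarrow> \<not> graph_iso (GV A) (GE A) (GV B) (GE B))"
proof -
  let ?eq = "\<lambda>A B. graph_iso (W A) (F A) (W B) (F B)"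
  have cnt: "countable {B. ?eq A B}" for A
  proof -
    let ?S = "(\<lambda>(r, v, d). dec (spec (W A) (F A) r d v)) ` (W A \<times> W A \<times> (UNIV :: bool set))"
    have "{B. ?eq A B} \<subseteq> ?S"
    proof
      fix B assume "B \<in> {B. ?eq A B}"
      then have "graph_iso (W B) (F B) (W A) (F A)" by (auto intro: graph_iso_sym)
      then obtain f where f: "bij_betw f (W B) (W A)" "\<forall>x\<in>W B. \<forall>y\<in>W B. F B x y = F A (f x) (f y)"
        by (auto simp: graph_iso_def)
      obtain r v d where r: "r \<in> W B" "v \<in> W B - {r}" "B = dec (spec (W B) (F B) r d v)"
        using code[of B] by (elim bexE exE)
      have "spec (W A) (F A) (f r) d (f v) = spec (W B) (F B) r d v"
        by (rule spec_iso[OF f(1) _ r(1,2)]) (use f(2) in blast)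
      then have "B = dec (spec (W A) (F A) (f r) d (f v))" using r(3) by simp
      moreover have "f r \<in> W A" "f v \<in> W A" using f(1) r by (auto simp: bij_betw_def)
      ultimately show "B \<in> ?S" by (intro image_eqI[of _ _ "(f r, f v, d)"]) auto
    qed
    moreover have "countable ?S" using G(1)[of A] by (intro countable_image countable_SIGMA) auto
    ultimately show ?thesis by (rule countable_subset)
  qed
  have "\<exists>h :: nat set \<Rightarrow> nat set. \<forall>A B. A \<noteq> B \<longrightarrow> \<not> ?eq (h A) (h B)"
  proof (rule transversal[of ?eq])
    show "?eq A A" for A by (rule graph_iso_refl)
    show "?eq A B \<Longrightarrow> ?eq B A" for A B by (rule graph_iso_sym)
    show "?eq A B \<Longrightarrow> ?eq B C \<Longrightarrow> ?eq A C" for A B C by (rule graph_iso_trans)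
  qed (rule cnt)
  then obtain h :: "nat set \<Rightarrow> nat set" where h: "\<forall>A B. A \<noteq> B \<longrightarrow> \<not> ?eq (h A) (h B)" by (rule exE)
  have "\<forall>A. \<exists>U D. is_graph (U :: nat set) D \<and> graph_iso (W (h A)) (F (h A)) U D"
    using graph_on_nat[OF G(1,2)] by blast
  then have "\<forall>A. \<exists>G. is_graph (fst G :: nat set) (snd G) \<and> graph_iso (W (h A)) (F (h A)) (fst G) (snd G)" by simp
  from choice[OF this] obtain G' where
    G': "\<forall>A. is_graph (fst (G' A) :: nat set) (snd (G' A)) \<and> graph_iso (W (h A)) (F (h A)) (fst (G' A)) (snd (G' A))"
    by (rule exE)
  define GV GE where "GV A = fst (G' A)" and "GE A = snd (G' A)" for A
  have N: "is_graph (GV A) (GE A)" "graph_iso (W (h A)) (F (h A)) (GV A) (GE A)" for A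
    using G' by (simp_all add: GV_def GE_def)
  have "equimorphic (GV A) (GE A) V E" for A
    using N(2)[of A] G(3)[of "h A"] graph_iso_embeds graph_iso_sym embeds_trans unfolding equimorphic_def by metis
  moreover have "graph_connected (GV A) (GE A)" for A
    by (rule graph_connected_iso[OF N(2) G(4)]) (use G(2)[of "h A"] in \<open>auto simp: is_graph_def\<close>)
  moreover have "graph_connected (GV A) (compl_graph (GV A) (GE A))" for A
    by (rule graph_connected_iso[OF compl_graph_iso[OF N(2)] G(5)]) (auto simp: compl_graph_def)
  moreover have "\<not> graph_iso (GV A) (GE A) (GV B) (GE B)" if "A \<noteq> B" for A B
  proof
    assume "graph_iso (GV A) (GE A) (GV B) (GE B)"
    then have "?eq (h A) (h B)" using N(2) graph_iso_sym graph_iso_trans by metis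
    then show False using h that by blast
  qed
  ultimately show ?thesis using N(1) by blast
qed

section \<open>Connected graphs with connected complement\<close>

locale connected_cograph = countable_cograph +
  fixes x :: 'a
  assumes x_V: "x \<in> V" and connected: "graph_connected V E" and co_connected: "graph_connected V (compl_graph V E)"
begin

definition H :: "'a set" where "H = V - {x}"

definition L :: "'a \<Rightarrow> 'a \<Rightarrow> bool" where "L = lt x H"

definition cedge :: "bool \<Rightarrow> 'a \<Rightarrow> 'a \<Rightarrow> bool" where
  "cedge e u v \<longleftrightarrow> u \<in> V \<and> v \<in> V \<and> u \<noteq> v \<and> E u v = e"

lemma L_label: "L u v \<Longrightarrow> E u v = E x v"
  unfolding L_def by (rule lt_label)

lemma L_asym: "L u v \<Longrightarrow> \<not> L v u"
  unfolding L_def by (rule lt_asym)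

lemma L_irrefl: "\<not> L u u"
  using L_asym by blast

lemma L_negtrans: "L u w \<Longrightarrow> u \<in> H \<Longrightarrow> w \<in> H \<Longrightarrow> L u v \<or> L v w"
  unfolding L_def by (rule lt_negtrans)

lemma L_trans: "L u v \<Longrightarrow> L v w \<Longrightarrow> u \<in> H \<Longrightarrow> v \<in> H \<Longrightarrow> L u w"
  unfolding L_def by (rule lt_trans)

lemma L_le_trans: "L u v \<Longrightarrow> \<not> L w v \<Longrightarrow> u \<in> H \<Longrightarrow> v \<in> H \<Longrightarrow> L u w"
  using L_negtrans by blast

lemma le_L_trans: "\<not> L v u \<Longrightarrow> L v w \<Longrightarrow> v \<in> H \<Longrightarrow> w \<in> H \<Longrightarrow> L u w"
  using L_negtrans by blast

lemma L_iff_lt0: "E x u \<noteq> E x v \<Longrightarrow> L u v \<longleftrightarrow> lt0 x u v"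
  unfolding L_def lt_def by auto

lemma L_mid: "L u v \<Longrightarrow> E x u = E x v \<Longrightarrow> \<exists>w\<in>H. E x w \<noteq> E x u \<and> L u w \<and> L w v"
proof -
  assume "L u v" "E x u = E x v"
  then obtain w where w: "w \<in> H" "lt0 x u w" "lt0 x w v" unfolding L_def lt_def lt0_def by blast
  then have "E x w \<noteq> E x u" "E x w \<noteq> E x v" by (auto simp: lt0_def)
  then show ?thesis using w L_iff_lt0[of u w] L_iff_lt0[of w v] by blast
qed

lemma cedge_path: "u \<in> V \<Longrightarrow> (cedge e)\<^sup>*\<^sup>* u x"
proof -
  assume "u \<in> V"
  then have "E\<^sup>*\<^sup>* u x" "(compl_graph V E)\<^sup>*\<^sup>* u x"
    using connected co_connected x_V unfolding graph_connected_def by blast+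
  moreover have "E = cedge True"
    using graph unfolding cedge_def is_graph_def by (intro ext) blast
  moreover have "compl_graph V E = cedge False"
    unfolding cedge_def compl_graph_def by (intro ext) blast
  ultimately show ?thesis by (cases e) auto
qed

text \<open>No pair of colour \<open>\<not> e\<close> would leave \<open>K\<close>, so in the
  connected graph of that colour \<open>x\<close> would be unreachable from
  \<open>K\<close>.\<close>

lemma not_homogeneous:
  assumes "K \<subseteq> H" "u \<in> K" "\<And>k w. k \<in> K \<Longrightarrow> w \<in> V \<Longrightarrow> w \<notin> K \<Longrightarrow> E w k = e"
  shows False
proof -
  have "x \<in> K"
  proof (rule rtranclp_stays[OF cedge_path[of u "\<not> e"] assms(2)])
    show "u \<in> V" using assms(1,2) by (auto simp: H_def)
    show "v \<in> K" if "k \<in> K" "cedge (\<not> e) k v" for k v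
      using that assms(3)[of k v] E_sym[of k v] by (auto simp: cedge_def)
  qed
  then show False using assms(1) by (auto simp: H_def)
qed

text \<open>Otherwise the vertices after \<open>u\<close>, or the class of \<open>u\<close> if it is
  the last one, would have one colour towards all vertices outside, against
  \<open>not_homogeneous\<close>.\<close>

lemma later_label:
  assumes u: "u \<in> H"
  shows "\<exists>v\<in>H. L u v \<and> E x v = e"
proof (rule ccontr)
  assume no: "\<not> ?thesis"
  show False
  proof (cases "\<exists>v\<in>H. L u v")
    case True
    then obtain v where v: "v \<in> H" "L u v" by blast
    show False
    proof (rule not_homogeneous[of "{v\<in>H. L u v}" v "\<not> e"])
      fix k w assume k: "k \<in> {v\<in>H. L u v}" and w: "w \<in> V" "w \<notin> {v\<in>H. L u v}"
      have lab: "E x k = (\<not> e)" using k no by auto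
      show "E w k = (\<not> e)"
      proof (cases "w = x")
        case False
        then have "L w k" using L_negtrans[of u k w] k w u by (auto simp: H_def)
        then show ?thesis using L_label lab by simp
      qed (use lab in simp)
    qed (use v in auto)
  next
    case False
    show False
    proof (rule not_homogeneous[of "cls x H u" u "E x u"])
      show "u \<in> cls x H u" using u by (rule cls_self)
      fix k w assume k: "k \<in> cls x H u" and w: "w \<in> V" "w \<notin> cls x H u"
      have lab: "E x k = E x u" using k by (rule cls_label)
      show "E w k = E x u"
      proof (cases "w = x")
        case w_x: False
        then have wH: "w \<in> H" using w by (simp add: H_def)
        then have "L w u" using w(2) False by (auto simp: cls_def L_def)
        then have "L w k" using L_negtrans[of w u k] k wH u by (auto simp: cls_def L_def)
        then show ?thesis using L_label lab by simp
      qed (use lab in simp)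
    qed (auto simp: cls_def)
  qed
qed

lemma countable_H: "countable H"
  using countable_V by (simp add: H_def)

lemma cofinal_sequence:
  assumes "H \<noteq> {}"
  shows "\<exists>z :: nat \<Rightarrow> 'a. (\<forall>n. z n \<in> H) \<and> (\<forall>n. L (z n) (z (Suc n))) \<and> (\<forall>u\<in>H. \<exists>n. L u (z n))"
proof -
  let ?h = "from_nat_into H"
  have h: "?h n \<in> H" for n using assms by (rule from_nat_into)
  have step: "\<exists>w. w \<in> H \<and> (L u w \<and> L (?h n) w)" if u: "u \<in> H" for u n
  proof -
    obtain v1 where v1: "v1 \<in> H" "L u v1" using later_label[OF u] by blast
    obtain v2 where v2: "v2 \<in> H" "L (?h n) v2" using later_label[OF h] by blast
    show ?thesis
    proof (cases "L v1 v2")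
      case True
      then show ?thesis using L_trans[OF v1(2) True u v1(1)] v2 by blast
    next
      case False
      then show ?thesis using L_negtrans[OF v2(2) h v2(1), of v1] v1 by blast
    qed
  qed
  have "\<exists>z. \<forall>n. z n \<in> H \<and> (L (z n) (z (Suc n)) \<and> L (?h n) (z (Suc n)))"
    by (rule dependent_nat_choice[where P = "\<lambda>n v. v \<in> H" and Q = "\<lambda>n v w. L v w \<and> L (?h n) w"])
      (use assms step in auto)
  then obtain z where z: "\<And>n. z n \<in> H" "\<And>n. L (z n) (z (Suc n))" "\<And>n. L (?h n) (z (Suc n))" by blast
  have "\<exists>n. L u (z n)" if "u \<in> H" for u
  proof -
    have "\<exists>n. ?h n = u" using countable_H that by (rule from_nat_into_surj)
    then show ?thesis using z(3) by blast
  qed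
  then show ?thesis using z(1,2) by blast
qed

definition tail :: "'a \<Rightarrow> 'a set" where
  "tail v = {u \<in> H. \<not> L u v}"

lemma tail_mono: "L v w \<Longrightarrow> v \<in> H \<Longrightarrow> w \<in> H \<Longrightarrow> tail w \<subseteq> tail v"
  unfolding tail_def using L_trans by blast

text \<open>Otherwise there is a sequence of tails none of which embeds into its successor. A
  comparison with any later tail is also one with the successor, which contains that tail.\<close>

lemma exists_stable_tail:
  fixes z :: "nat \<Rightarrow> 'a"
  assumes z: "\<And>n. z n \<in> H" "\<And>n. L (z n) (z (Suc n))"
  shows "\<exists>k. \<forall>n. wle x (tail (z k)) x (tail (z n))"
proof (rule ccontr)
  assume "\<not> ?thesis"
  then have no: "\<And>k. \<exists>n. \<not> wle x (tail (z k)) x (tail (z n))" by blast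
  have mono: "tail (z m) \<subseteq> tail (z n)" if "n \<le> m" for m n
    using that by (rule lift_Suc_antimono_le[of "\<lambda>n. tail (z n)", rotated]) (use tail_mono z in blast)
  have wmono: "wle x (tail (z k)) x (tail (z n))" if "wle x (tail (z k)) x (tail (z m))" "n \<le> m" for k m n
    using that(1) mono[OF that(2)] unfolding wle_def remb_def by (meson subset_trans)
  have "\<exists>s. \<forall>i. (True :: bool) \<and> (s i < s (Suc i) \<and> \<not> wle x (tail (z (s i))) x (tail (z (s (Suc i)))))"
  proof (rule dependent_nat_choice[where P = "\<lambda>n v. True" and Q = "\<lambda>n v w. v < w \<and> \<not> wle x (tail (z v)) x (tail (z w))"])
    fix k :: nat
    obtain n where n: "\<not> wle x (tail (z k)) x (tail (z n))" using no by blast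
    then have "\<not> wle x (tail (z k)) x (tail (z (max n (Suc k))))" using wmono[of k "max n (Suc k)" n] by auto
    then show "\<exists>w. True \<and> (k < w \<and> \<not> wle x (tail (z k)) x (tail (z w)))" by (intro exI[of _ "max n (Suc k)"]) auto
  qed simp
  then obtain s :: "nat \<Rightarrow> nat" where s: "\<And>i. s i < s (Suc i)" "\<And>i. \<not> wle x (tail (z (s i))) x (tail (z (s (Suc i))))"
    by blast
  have sm: "strict_mono s" using s(1) by (simp add: strict_mono_Suc_iff)
  obtain i j where ij: "i < j" "wle x (tail (z (s i))) x (tail (z (s j)))"
    using rooted_wqo[of "\<lambda>n. tail (z (s n))" "\<lambda>_. x"] by (auto simp: tail_def H_def)
  have "s (Suc i) \<le> s j" using ij(1) sm by (simp add: strict_mono_less_eq)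
  then show False using wmono[OF ij(2)] s(2) by blast
qed

end

section \<open>Inserting classes into the chain\<close>

lemma graph_connectedI:
  assumes "q \<in> W" "\<And>u v. R u v \<Longrightarrow> R v u" "\<And>u. u \<in> W \<Longrightarrow> R\<^sup>*\<^sup>* u q"
  shows "graph_connected W R"
proof -
  have "symp R\<^sup>*\<^sup>*" using assms(2) by (intro symp_rtranclp sympI)
  then have "R\<^sup>*\<^sup>* u v" if "u \<in> W" "v \<in> W" for u v
    using assms(3) that by (meson rtranclp_trans sympD)
  then show ?thesis using assms(1) by (auto simp: graph_connected_def)
qed

text \<open>\<open>beyond\<close> ties each new vertex to the old graph in both colours; this keeps
  the new graph and its complement connected.\<close>

locale insertion = connected_cograph +
  fixes cut :: "nat \<Rightarrow> 'a set" and lam :: "nat \<Rightarrow> bool" and d :: bool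
  assumes cut_H: "cut i \<subseteq> H" and beyond: "\<exists>u\<in>H - cut i. E x u = e"
begin

text \<open>Into the chain of the root \<open>x\<close> a class of colour \<open>lam i\<close> is inserted at the cut \<open>cut i\<close>, for every \<open>i\<close>;
  it has two elements if \<open>i \<in> S\<close> and one otherwise.  Classes with a common cut are ordered by index,
  increasingly or decreasingly according to \<open>d\<close>.\<close>

definition W :: "nat set \<Rightarrow> ('a + nat \<times> bool) set" where
  "W S = Inl ` V \<union> Inr ` {(i, b). b \<longrightarrow> i \<in> S}"

text \<open>The rule of the chain: a pair has the colour of its later member. Two members of one new
  class get the colour of the class, so they may be sent to two successive vertices of that
  colour.\<close>

fun col :: "'a + nat \<times> bool \<Rightarrow> 'a + nat \<times> bool \<Rightarrow> bool" where
  "col (Inl u) (Inl v) = E u v"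
| "col (Inl u) (Inr (i, b)) = (if u = x \<or> u \<in> cut i then lam i else E x u)"
| "col (Inr (i, b)) (Inl u) = (if u = x \<or> u \<in> cut i then lam i else E x u)"
| "col (Inr (i, b)) (Inr (j, c)) = lam (if d then max i j else min i j)"

definition F :: "nat set \<Rightarrow> 'a + nat \<times> bool \<Rightarrow> 'a + nat \<times> bool \<Rightarrow> bool" where
  "F S p q \<longleftrightarrow> p \<in> W S \<and> q \<in> W S \<and> p \<noteq> q \<and> col p q"

lemma W_cases:
  assumes "p \<in> W S"
  obtains u where "p = Inl u" "u \<in> V" | i b where "p = Inr (i, b)" "b \<longrightarrow> i \<in> S"
  using assms by (auto simp: W_def)

lemma W_Inl: "Inl u \<in> W S \<longleftrightarrow> u \<in> V"
  by (auto simp: W_def)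

lemma W_Inr: "Inr (i, b) \<in> W S \<longleftrightarrow> (b \<longrightarrow> i \<in> S)"
  by (auto simp: W_def)

lemma col_sym: "col p q = col q p"
  by (cases p; cases q) (auto simp: E_sym max.commute min.commute)

lemma F_graph: "is_graph (W S) (F S)"
  unfolding is_graph_def F_def using col_sym by blast

lemma F_countable: "countable (W S)"
  unfolding W_def using countable_V by (intro countable_Un countable_image) auto

lemma embeds_inserted: "embeds V E (W S) (F S)"
  unfolding embeds_def by (intro exI[of _ Inl]) (auto simp: F_def W_Inl E_irrefl)

lemma inserted_path:
  assumes p: "p \<in> W S"
  shows "(\<lambda>p q. p \<in> W S \<and> q \<in> W S \<and> p \<noteq> q \<and> col p q = e)\<^sup>*\<^sup>* p (Inl x)"
proof -
  define R where "R = (\<lambda>p q. p \<in> W S \<and> q \<in> W S \<and> p \<noteq> q \<and> col p q = e)"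
  have old: "R\<^sup>*\<^sup>* (Inl u) (Inl v)" if "(cedge e)\<^sup>*\<^sup>* u v" for u v
    using that
  proof (induction rule: rtranclp_induct)
    case (step v w)
    have "R (Inl v) (Inl w)" using step(2) by (auto simp: cedge_def W_Inl R_def)
    then show ?case using step(3) by (rule rtranclp.rtrancl_into_rtrancl[rotated])
  qed simp
  have "R\<^sup>*\<^sup>* p (Inl x)" using p
  proof (cases rule: W_cases)
    case (1 u)
    show ?thesis unfolding 1(1) by (rule old[OF cedge_path[OF 1(2)]])
  next
    case (2 i b)
    obtain u where u: "u \<in> H" "u \<notin> cut i" "E x u = e" using beyond[of i e] by blast
    have uV: "u \<in> V" "u \<noteq> x" using u(1) by (auto simp: H_def)
    have "R p (Inl u)" using u uV 2 by (auto simp: R_def W_Inl W_Inr)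
    then show ?thesis using old[OF cedge_path[OF uV(1)]] by (rule converse_rtranclp_into_rtranclp)
  qed
  then show ?thesis by (simp only: R_def)
qed

lemma F_connected: "graph_connected (W S) (F S)"
proof (rule graph_connectedI[of "Inl x"])
  show "Inl x \<in> W S" using x_V by (simp add: W_Inl)
  show "F S q p" if "F S p q" for p q using that col_sym by (auto simp: F_def)
  have "F S = (\<lambda>p q. p \<in> W S \<and> q \<in> W S \<and> p \<noteq> q \<and> col p q = True)" by (auto simp: F_def fun_eq_iff)
  then show "(F S)\<^sup>*\<^sup>* p (Inl x)" if "p \<in> W S" for p using inserted_path[OF that, of True] by simp
qed

lemma F_co_connected: "graph_connected (W S) (compl_graph (W S) (F S))"
proof (rule graph_connectedI[of "Inl x"])
  show "Inl x \<in> W S" using x_V by (simp add: W_Inl)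
  show "compl_graph (W S) (F S) q p" if "compl_graph (W S) (F S) p q" for p q
    using that col_sym by (auto simp: F_def compl_graph_def)
  have "compl_graph (W S) (F S) = (\<lambda>p q. p \<in> W S \<and> q \<in> W S \<and> p \<noteq> q \<and> col p q = False)"
    by (auto simp: F_def compl_graph_def fun_eq_iff)
  then show "(compl_graph (W S) (F S))\<^sup>*\<^sup>* p (Inl x)" if "p \<in> W S" for p using inserted_path[OF that, of False] by simp
qed

text \<open>Colours and order determine pairs, so it suffices to place the images in the right
  colours and the right order. Only pairs of old vertices may instead be preserved directly, as
  inside a part moved by an embedding.\<close>

lemma inserted_embeds:
  assumes psi: "\<And>u. u \<in> H \<Longrightarrow> psi u \<in> H" "\<And>u. u \<in> H \<Longrightarrow> E x (psi u) = E x u"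
    and loc: "\<And>u v. u \<in> H \<Longrightarrow> v \<in> H \<Longrightarrow>
      L u v \<and> L (psi u) (psi v) \<or> L v u \<and> L (psi v) (psi u) \<or> E u v = E (psi u) (psi v) \<and> (psi u = psi v \<longrightarrow> u = v)"
    and g: "\<And>i b. g i b \<in> H" "\<And>i b. E x (g i b) = lam i"
    and below: "\<And>u i b. u \<in> cut i \<Longrightarrow> L (psi u) (g i b)"
    and above: "\<And>u i b. u \<in> H \<Longrightarrow> u \<notin> cut i \<Longrightarrow> L (g i b) (psi u)"
    and g_less: "\<And>i j b c. i < j \<Longrightarrow> (if d then L (g i b) (g j c) else L (g j c) (g i b))"
    and g_eq: "\<And>i. i \<in> S \<Longrightarrow> L (g i False) (g i True) \<or> L (g i True) (g i False)"
  shows "embeds (W S) (F S) V E"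
proof -
  define h where "h p = (case p of Inl u \<Rightarrow> if u = x then x else psi u | Inr (i, b) \<Rightarrow> g i b)" for p
  have h_simps: "h (Inl x) = x" "u \<noteq> x \<Longrightarrow> h (Inl u) = psi u" "h (Inr (i, b)) = g i b" for u i b
    by (simp_all add: h_def)
  have in_H: "u \<in> H" if "u \<in> V" "u \<noteq> x" for u using that by (simp add: H_def)
  have hH: "h p \<in> H" if "p \<in> W S" "p \<noteq> Inl x" for p
    using that(1) by (cases rule: W_cases) (use that(2) psi(1) g(1) in_H h_simps in auto)
  have hlab: "E x (h p) = col (Inl x) p" if "p \<in> W S" "p \<noteq> Inl x" for p
    using that(1) by (cases rule: W_cases) (use that(2) psi(2) g(2) in_H h_simps in auto)
  define ok where "ok p q \<longleftrightarrow> col p q = E (h p) (h q) \<and> h p \<noteq> h q" for p q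
  have ok_sym: "ok p q = ok q p" for p q unfolding ok_def using col_sym E_sym by metis
  have okL: "ok p q" if "L (h p) (h q)" "col p q = E x (h q)" for p q
    unfolding ok_def using that L_label L_irrefl by metis
  have ok_Inl_Inr: "ok (Inl u) (Inr (i, b))" if "u \<in> V" for u i b
  proof (cases "u = x")
    case True
    then show ?thesis using g[of i b] by (auto simp: ok_def h_simps H_def)
  next
    case ux: False
    have uH: "u \<in> H" using in_H that ux by blast
    show ?thesis
    proof (cases "u \<in> cut i")
      case True
      show ?thesis by (rule okL) (use True below g(2) ux h_simps in auto)
    next
      case False
      have "ok (Inr (i, b)) (Inl u)" by (rule okL) (use False above uH psi(2) ux h_simps in auto)
      then show ?thesis using ok_sym by blast
    qed
  qed
  have ok_Inr_Inr: "ok (Inr (i, b)) (Inr (j, c))" if "i < j" for i b j c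
  proof (cases d)
    case True
    show ?thesis
      by (rule okL)
        (use g_less[OF that, of b c] that in \<open>simp_all only: h_simps col.simps g(2) if_P[OF True] max_absorb2[OF less_imp_le[OF that]]\<close>)
  next
    case False
    have "ok (Inr (j, c)) (Inr (i, b))"
      by (rule okL)
        (use g_less[OF that, of b c] that in \<open>simp_all only: h_simps col.simps g(2) if_not_P[OF False] min_absorb2[OF less_imp_le[OF that]]\<close>)
    then show ?thesis using ok_sym by blast
  qed
  have ok_same: "ok (Inr (i, False)) (Inr (i, True))" if "i \<in> S" for i
  proof (cases "L (g i False) (g i True)")
    case True
    show ?thesis by (rule okL) (use True g(2) h_simps in auto)
  next
    case False
    have "ok (Inr (i, True)) (Inr (i, False))" by (rule okL) (use False g_eq[OF that] g(2) h_simps in auto)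
    then show ?thesis using ok_sym by blast
  qed
  have ok_Inl: "ok (Inl u) (Inl v)" if uv: "u \<in> V" "v \<in> V" "u \<noteq> v" for u v
  proof -
    consider "u = x" | "v = x" | "u \<noteq> x" "v \<noteq> x" by blast
    then show ?thesis
    proof cases
      case 1
      then have "v \<in> H" using in_H uv by auto
      then show ?thesis using 1 uv psi[of v] h_simps by (auto simp: ok_def H_def)
    next
      case 2
      then have "u \<in> H" using in_H uv by auto
      then have "ok (Inl v) (Inl u)" using 2 uv psi[of u] h_simps by (auto simp: ok_def H_def)
      then show ?thesis using ok_sym by blast
    next
      case 3
      have uvH: "u \<in> H" "v \<in> H" using in_H uv 3 by auto
      from loc[OF this] show ?thesis
      proof (elim disjE conjE)
        assume *: "L u v" "L (psi u) (psi v)"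
        show ?thesis by (rule okL) (use * L_label[OF *(1)] psi(2)[OF uvH(2)] 3 h_simps in auto)
      next
        assume *: "L v u" "L (psi v) (psi u)"
        have "ok (Inl v) (Inl u)" by (rule okL) (use * L_label[OF *(1)] psi(2)[OF uvH(1)] 3 h_simps in auto)
        then show ?thesis using ok_sym by blast
      next
        assume "E u v = E (psi u) (psi v)" "psi u = psi v \<longrightarrow> u = v"
        then show ?thesis using uv(3) 3 h_simps by (auto simp: ok_def)
      qed
    qed
  qed
  have ok: "ok p q" if p: "p \<in> W S" and q: "q \<in> W S" and ne: "p \<noteq> q" for p q
    using p
  proof (cases rule: W_cases)
    case u: (1 u)
    show ?thesis using q
    proof (cases rule: W_cases)
      case (1 v)
      then show ?thesis using ok_Inl u ne by blast
    next
      case (2 i b)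
      then show ?thesis using ok_Inl_Inr u by blast
    qed
  next
    case i: (2 i b)
    show ?thesis using q
    proof (cases rule: W_cases)
      case (1 v)
      then show ?thesis using ok_Inl_Inr i ok_sym by blast
    next
      case (2 j c)
      consider "i < j" | "j < i" | "i = j" "b \<noteq> c" using 2 i ne by fastforce
      then show ?thesis
      proof cases
        case a: 1
        show ?thesis unfolding 2(1) i(1) using a by (rule ok_Inr_Inr)
      next
        case a: 2
        have "ok q p" unfolding 2(1) i(1) using a by (rule ok_Inr_Inr)
        then show ?thesis using ok_sym by blast
      next
        case 3
        then have "i \<in> S" using 2 i by auto
        then have "ok (Inr (i, False)) (Inr (i, True))" by (rule ok_same)
        moreover have "p = Inr (i, False) \<and> q = Inr (i, True) \<or> p = Inr (i, True) \<and> q = Inr (i, False)" using 3 2 i by auto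
        ultimately show ?thesis using ok_sym by metis
      qed
    qed
  qed
  have "inj_on h (W S)" using ok unfolding ok_def inj_on_def by metis
  moreover have "h ` W S \<subseteq> V"
  proof
    fix v assume "v \<in> h ` W S"
    then obtain p where "p \<in> W S" "v = h p" by blast
    then show "v \<in> V" using hH[of p] x_V h_simps(1) by (cases "p = Inl x") (auto simp: H_def)
  qed
  moreover have "F S p q = E (h p) (h q)" if "p \<in> W S" "q \<in> W S" for p q
    using ok[OF that] that E_irrefl unfolding F_def ok_def by metis
  ultimately show ?thesis unfolding embeds_def by (intro exI[of _ h]) blast
qed

lemma lz_Inl_Inl: "u \<in> H \<Longrightarrow> v \<in> H \<Longrightarrow> lz (F S) (Inl x) e (Inl u) (Inl v) \<longleftrightarrow>
    E x u \<noteq> E x v \<and> (if e then L u v else L v u)"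
proof -
  assume uv: "u \<in> H" "v \<in> H"
  have "u \<in> V" "v \<in> V" "u \<noteq> x" "v \<noteq> x" using uv by (auto simp: H_def)
  moreover have "L u v \<longleftrightarrow> E u v = E x v" "L v u \<longleftrightarrow> E u v = E x u" if "E x u \<noteq> E x v"
    using that L_iff_lt0[of u v] L_iff_lt0[of v u] E_sym[of u v] unfolding lt0_def by auto
  ultimately show ?thesis using x_V by (auto simp: lz_def F_def W_Inl)
qed

lemma lz_Inl_Inr: "u \<in> H \<Longrightarrow> Inr (i, b) \<in> W S \<Longrightarrow> lz (F S) (Inl x) e (Inl u) (Inr (i, b)) \<longleftrightarrow>
    E x u \<noteq> lam i \<and> (u \<in> cut i \<longleftrightarrow> e)"
  using x_V by (auto simp: lz_def F_def W_Inl H_def)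

lemma lz_Inr_Inl: "u \<in> H \<Longrightarrow> Inr (i, b) \<in> W S \<Longrightarrow> lz (F S) (Inl x) e (Inr (i, b)) (Inl u) \<longleftrightarrow>
    E x u \<noteq> lam i \<and> (u \<notin> cut i \<longleftrightarrow> e)"
  using x_V by (auto simp: lz_def F_def W_Inl H_def)

lemma lz_Inr_Inr: "Inr (i, b) \<in> W S \<Longrightarrow> Inr (j, c) \<in> W S \<Longrightarrow> lz (F S) (Inl x) d (Inr (i, b)) (Inr (j, c)) \<longleftrightarrow>
    lam i \<noteq> lam j \<and> i < j"
proof -
  assume W: "Inr (i, b) \<in> W S" "Inr (j, c) \<in> W S"
  have lab: "F S (Inl x) (Inr (i, b)) = lam i" "F S (Inl x) (Inr (j, c)) = lam j"
    using W x_V by (auto simp: F_def W_Inl)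
  have F: "F S (Inr (i, b)) (Inr (j, c)) = lam (if d then max i j else min i j)" if "i \<noteq> j"
    using W that by (simp add: F_def)
  consider "i = j" | "i < j" | "j < i" by linarith
  then show ?thesis
  proof cases
    case 1
    then show ?thesis unfolding lz_def lab by simp
  next
    case 2
    then have F': "F S (Inr (i, b)) (Inr (j, c)) = lam (if d then j else i)" using F by simp
    show ?thesis unfolding lz_def lab F' using 2 by auto
  next
    case 3
    then have F': "F S (Inr (i, b)) (Inr (j, c)) = lam (if d then i else j)" using F by simp
    show ?thesis unfolding lz_def lab F' using 3 by auto
  qed
qed

end

context connected_cograph
begin

definition many_twins :: bool where
  "many_twins \<longleftrightarrow> (\<exists>(GV :: nat set \<Rightarrow> nat set) GE.
    (\<forall>A. is_graph (GV A) (GE A) \<and> equimorphic (GV A) (GE A) V E \<and> graph_connected (GV A) (GE A) \<and>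
       graph_connected (GV A) (compl_graph (GV A) (GE A))) \<and>
    (\<forall>A B. A \<noteq> B \<longrightarrow> \<not> graph_iso (GV A) (GE A) (GV B) (GE B)))"

end

context insertion
begin

lemma many_twinsI:
  fixes S dec :: "nat set \<Rightarrow> nat set"
  assumes "\<And>A. embeds (W (S A)) (F (S A)) V E"
    and "\<And>A. \<exists>v\<in>W (S A) - {Inl x}. \<exists>e. A = dec (spec (W (S A)) (F (S A)) (Inl x) e v)"
  shows many_twins
  unfolding many_twins_def
proof (rule continuum_many[of "\<lambda>A. W (S A)" "\<lambda>A. F (S A)" V E dec])
  show "equimorphic (W (S A)) (F (S A)) V E" for A
    unfolding equimorphic_def using assms(1) embeds_inserted by blast
  show "\<exists>r\<in>W (S A). \<exists>v\<in>W (S A) - {r}. \<exists>e. A = dec (spec (W (S A)) (F (S A)) r e v)" for A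
    by (rule bexI[of _ "Inl x"], rule assms(2)) (use x_V in \<open>simp add: W_Inl\<close>)
qed (rule F_countable F_graph F_connected F_co_connected)+

lemma card_inserted_class: "card {p \<in> W S. \<exists>b. p = Inr (i, b)} = 2 \<longleftrightarrow> i \<in> S"
proof -
  have "{p \<in> W S. \<exists>b. p = Inr (i, b)} = (\<lambda>b. Inr (i, b)) ` (if i \<in> S then UNIV else {False})"
    by (auto simp: W_Inr)
  moreover have "inj (\<lambda>b. Inr (i, b) :: 'a + nat \<times> bool)" by (auto simp: inj_def)
  ultimately show ?thesis by (simp add: card_image)
qed

end

section \<open>A final segment that embeds into every later one\<close>

locale stable_tail = connected_cograph +
  fixes z :: "nat \<Rightarrow> 'a" and k :: nat
  assumes z_H: "z n \<in> H" and z_cofinal: "u \<in> H \<Longrightarrow> \<exists>n. L u (z n)"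
    and stable: "wle x (tail (z k)) x (tail (z n))"
begin

definition T :: "'a set" where "T = tail (z k)"

definition I :: "'a set" where "I = {u \<in> H. L u (z k)}"

lemma T_H: "u \<in> T \<Longrightarrow> u \<in> H"
  by (simp add: T_def tail_def)

lemma I_H: "u \<in> I \<Longrightarrow> u \<in> H"
  by (simp add: I_def)

lemma T_iff: "u \<in> H \<Longrightarrow> u \<in> T \<longleftrightarrow> u \<notin> I"
  by (simp add: T_def tail_def I_def)

lemma L_I_T: "u \<in> I \<Longrightarrow> v \<in> T \<Longrightarrow> L u v"
  using L_le_trans[of u "z k" v] z_H by (auto simp: T_def I_def tail_def)

lemma T_up: "u \<in> T \<Longrightarrow> L u v \<Longrightarrow> v \<in> H \<Longrightarrow> v \<in> T"
  unfolding T_def tail_def using L_trans by blast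

lemma z_T: "z k \<in> T"
  using z_H L_irrefl by (simp add: T_def tail_def)

text \<open>For different colours the order is visible in the coloured graph; for equal colours it
  passes through a vertex in between, which again lies in \<open>T\<close>.\<close>

lemma remb_L:
  assumes f: "remb f x T x K" and K: "K \<subseteq> H" and u: "u \<in> T" and v: "v \<in> T" and uv: "L u v"
  shows "L (f u) (f v)"
proof -
  have fH: "f u \<in> H" if "u \<in> T" for u using f K that by (auto simp: remb_def)
  have step: "L (f u) (f v)" if "u \<in> T" "v \<in> T" "L u v" "E x u \<noteq> E x v" for u v
  proof -
    have l: "E x u = E x (f u)" "E x v = E x (f v)" "E u v = E (f u) (f v)" using f that(1,2) unfolding remb_def by blast+
    have "lt0 x u v" using that(3,4) L_iff_lt0 by blast
    then have "lt0 x (f u) (f v)" unfolding lt0_def l .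
    then show ?thesis using L_iff_lt0[of "f u" "f v"] unfolding lt0_def by blast
  qed
  show ?thesis
  proof (cases "E x u = E x v")
    case False
    then show ?thesis using step u v uv by blast
  next
    case True
    obtain w where w: "w \<in> H" "E x w \<noteq> E x u" "L u w" "L w v" using L_mid[OF uv True] by blast
    have wT: "w \<in> T" using T_up[OF u w(3,1)] .
    have "L (f u) (f w)" using step[OF u wT w(3)] w(2) by simp
    moreover have "L (f w) (f v)" using step[OF wT v w(4)] w(2) True by simp
    ultimately show ?thesis using L_trans fH u wT by blast
  qed
qed

text \<open>By stability \<open>T\<close> can be moved beyond the bound \<open>t\<close>. The places
  of the sequence are then free and receive the new run, which lies between \<open>I\<close> and
  \<open>T\<close>.\<close>

lemma bounded_sequence_many:
  assumes y: "\<And>n. y n \<in> T" "\<And>n :: nat. if d then L (y n) (y (Suc n)) else L (y (Suc n)) (y n)"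
    and t: "t \<in> H" "\<And>n. L (y n) t"
  shows many_twins
proof -
  define Ld where "Ld u v = (if d then L u v else L v u)" for u v
  have Ld_neg: "Ld u v \<or> Ld v w" if "Ld u w" "u \<in> H" "w \<in> H" for u v w
    using that L_negtrans[of u w v] L_negtrans[of w u v] unfolding Ld_def by (auto split: if_splits)
  have Ld_asym: "\<not> Ld v u" if "Ld u v" for u v using that L_asym unfolding Ld_def by (auto split: if_splits)
  have Ld_trans: "Ld u w" if "Ld u v" "Ld v w" "u \<in> H" "v \<in> H" for u v w
    using Ld_neg[OF that(1,3,4), of w] that(2) Ld_asym by blast
  have yH: "y n \<in> H" for n using y(1) T_H by blast
  have ystep: "Ld (y n) (y (Suc n))" for n using y(2) by (simp add: Ld_def)
  have ymono: "Ld (y m) (y n)" if "m < n" for m n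
    using that
  proof (induction n)
    case (Suc n)
    then show ?case using ystep[of n] Ld_trans[of "y m" "y n" "y (Suc n)"] yH by (cases "m = n") auto
  qed simp
  \<comment> \<open>Both colours occur from \<open>y (2 * n)\<close> to
    \<open>y (2 * n + 1)\<close>: if both ends have the wrong colour, \<open>L_mid\<close> gives a
    vertex between them. Taking disjoint pairs of the sequence keeps the choices in order.\<close>
  define P where "P n e w \<longleftrightarrow> w \<in> T \<and> E x w = e \<and> \<not> Ld w (y (2 * n)) \<and> \<not> Ld (y (2 * n + 1)) w" for n e w
  have ex: "\<exists>w. P n e w" for n e
  proof -
    let ?a = "y (2 * n)" and ?b = "y (2 * n + 1)"
    have ab: "Ld ?a ?b" using ystep[of "2 * n"] by simp
    have aa: "\<not> Ld ?a ?a" "\<not> Ld ?b ?b" "\<not> Ld ?b ?a" using ab Ld_asym by blast+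
    consider "E x ?a = e" | "E x ?b = e" | "E x ?a = (\<not> e)" "E x ?b = (\<not> e)" by auto
    then show ?thesis
    proof cases
      case 1
      then have "P n e ?a" unfolding P_def using y(1) aa by blast
      then show ?thesis by blast
    next
      case 2
      then have "P n e ?b" unfolding P_def using y(1) aa by blast
      then show ?thesis by blast
    next
      case 3
      have "\<exists>w\<in>T. E x w = e \<and> Ld ?a w \<and> Ld w ?b"
      proof (cases d)
        case True
        then have "L ?a ?b" using ab by (simp add: Ld_def)
        then obtain w where w: "w \<in> H" "E x w \<noteq> E x ?a" "L ?a w" "L w ?b" using L_mid 3 by blast
        then show ?thesis using T_up[OF y(1) w(3,1)] True 3 by (auto simp: Ld_def)
      next
        case False
        then have "L ?b ?a" using ab by (simp add: Ld_def)
        then obtain w where w: "w \<in> H" "E x w \<noteq> E x ?b" "L ?b w" "L w ?a" using L_mid 3 by blast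
        then show ?thesis using T_up[OF y(1) w(3,1)] False 3 by (auto simp: Ld_def)
      qed
      then obtain w where "w \<in> T" "E x w = e" "Ld ?a w" "Ld w ?b" by blast
      then have "P n e w" unfolding P_def using Ld_asym by blast
      then show ?thesis by blast
    qed
  qed
  define m where "m n e = (SOME w. P n e w)" for n e
  have m: "P n e (m n e)" for n e unfolding m_def using ex by (rule someI_ex)
  have mT: "m n e \<in> T" and mlab: "E x (m n e) = e" for n e using m by (auto simp: P_def)
  have mH: "m n e \<in> H" for n e using mT T_H by blast
  have mt: "L (m n e) t" for n e
  proof (cases d)
    case True
    then have "\<not> L (y (2 * n + 1)) (m n e)" using m[of n e] by (simp add: P_def Ld_def)
    then show ?thesis using le_L_trans[OF _ t(2) yH t(1)] by blast
  next
    case False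
    then have "\<not> L (y (2 * n)) (m n e)" using m[of n e] by (simp add: P_def Ld_def)
    then show ?thesis using le_L_trans[OF _ t(2) yH t(1)] by blast
  qed
  have mmono: "Ld (m n e) (m n' e')" if "n < n'" for n n' e e'
  proof -
    have "Ld (y (2 * n + 1)) (y (2 * n'))" using that by (intro ymono) auto
    then have "Ld (m n e) (y (2 * n'))" using Ld_neg[of "y (2 * n + 1)" "y (2 * n')" "m n e"] yH m[of n e] by (auto simp: P_def)
    then show ?thesis using Ld_neg[of "m n e" "y (2 * n')" "m n' e'"] yH mH m[of n' e'] by (auto simp: P_def)
  qed
  obtain j where j: "L t (z j)" using z_cofinal t(1) by blast
  obtain f where f: "remb f x T x (tail (z j))" using stable[of j] unfolding wle_def T_def by blast
  have fT: "f u \<in> H" "\<not> L (f u) (z j)" "E x (f u) = E x u" if "u \<in> T" for u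
    using f that by (auto simp: remb_def tail_def)
  have t_f: "L t (f u)" if "u \<in> T" for u using L_le_trans[OF j fT(2)[OF that] t(1) z_H] .
  have I_f: "L a (f u)" if "a \<in> I" "u \<in> T" for a u
  proof -
    have "L a t" using L_trans[OF L_I_T[OF that(1) y(1)] t(2)] I_H that(1) yH by blast
    then show ?thesis using L_trans t_f that(2) I_H that(1) t(1) by blast
  qed
  \<comment> \<open>With a common cut the new classes are ordered by their indices alone, and
    \<open>odd\<close> alternates the colours.\<close>
  interpret ins: insertion V E x "\<lambda>_. I" odd d
  proof unfold_locales
    show "\<exists>u\<in>H - I. E x u = e" for e
    proof -
      obtain u where u: "u \<in> H" "L (z k) u" "E x u = e" using later_label[OF z_H] by blast
      then have "u \<notin> I" using L_asym by (auto simp: I_def)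
      then show ?thesis using u by blast
    qed
  qed (simp add: I_def)
  \<comment> \<open>The factor 2 reserves separate places for the two possible members of a
    class.\<close>
  define g where "g i b = m (2 * i + of_bool b) (odd i)" for i b
  define psi where "psi u = (if u \<in> T then f u else u)" for u
  have emb: "embeds (ins.W S) (ins.F S) V E" for S
  proof (rule ins.inserted_embeds[of psi g])
    show "psi u \<in> H" "E x (psi u) = E x u" if "u \<in> H" for u using that fT by (auto simp: psi_def)
    show "L u v \<and> L (psi u) (psi v) \<or> L v u \<and> L (psi v) (psi u) \<or> E u v = E (psi u) (psi v) \<and> (psi u = psi v \<longrightarrow> u = v)"
      if uv: "u \<in> H" "v \<in> H" for u v
    proof -
      consider "u \<in> I" "v \<in> I" | "u \<in> I" "v \<in> T" | "u \<in> T" "v \<in> I" | "u \<in> T" "v \<in> T" using T_iff[OF uv(1)] T_iff[OF uv(2)] by fast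
      then show ?thesis
      proof cases
        case 1
        then show ?thesis using T_iff[OF uv(1)] T_iff[OF uv(2)] by (simp add: psi_def)
      next
        case 2
        then show ?thesis using T_iff[OF uv(1)] T_iff[OF uv(2)] L_I_T I_f by (simp add: psi_def)
      next
        case 3
        then show ?thesis using T_iff[OF uv(1)] T_iff[OF uv(2)] L_I_T I_f by (simp add: psi_def)
      next
        case 4
        then have "E u v = E (f u) (f v)" "f u = f v \<longrightarrow> u = v" using f by (auto simp: remb_def inj_on_def)
        then show ?thesis using 4 by (simp add: psi_def)
      qed
    qed
    show "g i b \<in> H" "E x (g i b) = odd i" for i b using mH mlab by (simp_all add: g_def)
    show "L (psi u) (g i b)" if "u \<in> I" for u i b
      using that T_iff[OF I_H[OF that]] L_I_T[OF that mT] by (simp add: psi_def g_def)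
    show "L (g i b) (psi u)" if "u \<in> H" "u \<notin> I" for u i b
    proof -
      have uT: "u \<in> T" using that T_iff by blast
      have "L (g i b) (f u)" unfolding g_def by (rule L_trans[OF mt t_f[OF uT] mH t(1)])
      then show ?thesis using uT by (simp add: psi_def)
    qed
    show "if d then L (g i b) (g j c) else L (g j c) (g i b)" if "i < j" for i j b c
    proof -
      have "2 * i + of_bool b < 2 * j + of_bool c" using that by (cases b; cases c) auto
      then have "Ld (g i b) (g j c)" unfolding g_def by (rule mmono)
      then show ?thesis by (simp only: Ld_def)
    qed
    show "L (g i False) (g i True) \<or> L (g i True) (g i False)" for i
    proof -
      have "Ld (g i False) (g i True)" unfolding g_def by (rule mmono) simp
      then show ?thesis unfolding Ld_def by (simp split: if_splits)
    qed
  qed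
  have run: "Ks (lz (ins.F S) (Inl x) d) (ins.W S - {Inl x}) (Inr (0, False)) (Suc n) =
      {a \<in> {p \<in> ins.W S. \<not> isl p}. fst (projr a) = Suc n}" for S n
  proof (rule Ks_run)
    let ?D = "{p \<in> ins.W S. \<not> isl p}" and ?U = "ins.W S - {Inl x}"
    have D: "\<exists>i b. a = Inr (i, b) \<and> Inr (i, b) \<in> ins.W S" if "a \<in> ?D" for a using that by (cases a) auto
    have C: "\<exists>u. c = Inl u \<and> u \<in> H" if "c \<in> ?U - ?D" for c using that by (cases c) (auto simp: ins.W_Inl H_def)
    show "?D \<subseteq> ?U" by auto
    show "\<exists>a\<in>?D. fst (projr a) = p" for p by (rule bexI[of _ "Inr (p, False)"]) (auto simp: ins.W_Inr)
    show "lz (ins.F S) (Inl x) d a b \<longleftrightarrow> even (fst (projr a)) \<noteq> even (fst (projr b)) \<and> fst (projr a) < fst (projr b)"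
      if ab: "a \<in> ?D" "b \<in> ?D" for a b
    proof -
      obtain i b' j c' where "a = Inr (i, b')" "b = Inr (j, c')" "Inr (i, b') \<in> ins.W S" "Inr (j, c') \<in> ins.W S"
        using D[OF ab(1)] D[OF ab(2)] by blast
      then show ?thesis using ins.lz_Inr_Inr[of i b' S j c'] by auto
    qed
    show "lz (ins.F S) (Inl x) d a' c"
      if a: "a \<in> ?D" and c: "c \<in> ?U - ?D" and ac: "lz (ins.F S) (Inl x) d a c" and a': "a' \<in> ?D"
        and ev: "even (fst (projr a')) = even (fst (projr a))" for a c a'
    proof -
      obtain i b j b' u where *: "a = Inr (i, b)" "a' = Inr (j, b')" "c = Inl u"
        "Inr (i, b) \<in> ins.W S" "Inr (j, b') \<in> ins.W S" "u \<in> H"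
        using D[OF a] D[OF a'] C[OF c] by blast
      then show ?thesis using ac ev ins.lz_Inr_Inl[of u i b S d] ins.lz_Inr_Inl[of u j b' S d] by auto
    qed
    show "\<not> lz (ins.F S) (Inl x) d c a'"
      if a: "a \<in> ?D" and c: "c \<in> ?U - ?D" and ac: "lz (ins.F S) (Inl x) d a c" and a': "a' \<in> ?D" for a c a'
    proof -
      obtain i b j b' u where *: "a = Inr (i, b)" "a' = Inr (j, b')" "c = Inl u"
        "Inr (i, b) \<in> ins.W S" "Inr (j, b') \<in> ins.W S" "u \<in> H"
        using D[OF a] D[OF a'] C[OF c] by blast
      then show ?thesis using ac ins.lz_Inr_Inl[of u i b S d] ins.lz_Inl_Inr[of u j b' S d] by auto
    qed
    show "\<not> lz (ins.F S) (Inl x) d c' a'"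
      if a: "a \<in> ?D" and c: "c \<in> ?U - ?D" and c': "c' \<in> ?U - ?D" and ac: "lz (ins.F S) (Inl x) d a c"
        and cc: "lz (ins.F S) (Inl x) d c c'" and a': "a' \<in> ?D" for a c c' a'
    proof -
      obtain i b j b' u v where *: "a = Inr (i, b)" "a' = Inr (j, b')" "c = Inl u" "c' = Inl v"
        "Inr (i, b) \<in> ins.W S" "Inr (j, b') \<in> ins.W S" "u \<in> H" "v \<in> H"
        using D[OF a] D[OF a'] C[OF c] C[OF c'] by blast
      have 1: "u \<notin> I \<longleftrightarrow> d" using ac * ins.lz_Inr_Inl[of u i b S d] by auto
      have 2: "if d then L u v else L v u" using cc * ins.lz_Inl_Inl[of u v S d] by auto
      \<comment> \<open>An old vertex after the run in direction \<open>d\<close> lies beyond the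
        cut on that side, and so does any old vertex after it.\<close>
      have "\<not> (v \<in> I \<longleftrightarrow> d)"
        using 1 2 L_I_T[of u v] L_I_T[of v u] T_iff[of u] T_iff[of v] *(7,8) L_asym by (auto split: if_splits)
      then show ?thesis using * ins.lz_Inl_Inr[of v j b' S d] by auto
    qed
  qed (auto simp: ins.W_Inr)
  show ?thesis
  \<comment> \<open>The shift by \<open>Suc\<close> skips the start class, of which
    \<open>Ks\<close> returns only the start vertex.\<close>
  proof (rule ins.many_twinsI[of "\<lambda>A. Suc ` A" "\<lambda>X. {n. Suc n \<in> X}"])
    fix A
    let ?S = "Suc ` A"
    have slot: "{a \<in> {p \<in> ins.W ?S. \<not> isl p}. fst (projr a) = Suc n} = {p \<in> ins.W ?S. \<exists>b. p = Inr (Suc n, b)}" for n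
    proof (intro set_eqI)
      fix a
      show "a \<in> {a \<in> {p \<in> ins.W ?S. \<not> isl p}. fst (projr a) = Suc n} \<longleftrightarrow> a \<in> {p \<in> ins.W ?S. \<exists>b. p = Inr (Suc n, b)}"
        by (cases a) auto
    qed
    have "Suc n \<in> spec (ins.W ?S) (ins.F ?S) (Inl x) d (Inr (0, False)) \<longleftrightarrow> n \<in> A" for n
      unfolding spec_def mem_Collect_eq[of "Suc n"] run slot ins.card_inserted_class by (rule inj_image_mem_iff) simp
    then have "A = {n. Suc n \<in> spec (ins.W ?S) (ins.F ?S) (Inl x) d (Inr (0, False))}" by (simp only: Collect_mem_eq)
    then show "\<exists>v\<in>ins.W ?S - {Inl x}. \<exists>e. A = {n. Suc n \<in> spec (ins.W ?S) (ins.F ?S) (Inl x) e v}"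
      by - (rule bexI[of _ "Inr (0, False)"], rule exI[of _ d], assumption, simp add: ins.W_Inr)
  qed (rule emb)
qed

end

context stable_tail
begin

text \<open>No bounded part of \<open>T\<close> has infinitely many classes, so the new ones are
  spread out. Two are put after each class of \<open>T\<close>, since a single one between classes
  of different colours would repeat a colour. Room is gained by moving each class of
  \<open>T\<close> with its own embedding into ever later tails.\<close>

lemma ranked_many:
  fixes rk :: "'a \<Rightarrow> nat"
  assumes rk: "\<And>u v. u \<in> T \<Longrightarrow> v \<in> T \<Longrightarrow> L u v \<longleftrightarrow> rk u < rk v"
    and rk_onto: "\<And>n. \<exists>u\<in>T. rk u = n" and rk_label: "\<And>u. u \<in> T \<Longrightarrow> E x u \<longleftrightarrow> (even (rk u) \<longleftrightarrow> e0)"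
  shows many_twins
proof -
  \<comment> \<open>The position of the \<open>j\<close>-th new class: those of \<open>T\<close>
    occupy the multiples of 3, the new ones the residues 1 and 2. As \<open>3 * n\<close> has the
    parity of \<open>n\<close>, colours alternate along all positions.\<close>
  define P where "P j = j + j div 2 + 1" for j :: nat
  define lam where "lam j \<longleftrightarrow> (even (P j) \<longleftrightarrow> e0)" for j
  define cut where "cut j = I \<union> {u \<in> T. 3 * rk u < P j}" for j
  have P_less: "P i < P j" if "i < j" for i j using that div_le_mono[of i j 2] by (simp add: P_def)
  have P_less_iff: "P i < P j \<longleftrightarrow> i < j" for i j using P_less[of i j] P_less[of j i] by (cases i j rule: linorder_cases) auto
  have P_even: "P (2 * i) = 3 * i + 1" "P (2 * i + 1) = 3 * i + 2" for i by (simp_all add: P_def)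
  have j_cases: "\<exists>i. j = 2 * i \<or> j = 2 * i + 1" for j :: nat by presburger
  have P_rk: "3 * n < P j \<longleftrightarrow> n \<le> j div 2" for n j using j_cases[of j] by (auto simp: P_def)
  have P_eq: "P j = Suc (3 * i) \<longleftrightarrow> j = 2 * i" for i j
  proof -
    obtain q where "j = 2 * q \<or> j = 2 * q + 1" using j_cases by blast
    then show ?thesis by (auto simp: P_def)
  qed
  interpret ins: insertion V E x cut lam True
  proof unfold_locales
    show "cut j \<subseteq> H" for j using T_H I_H by (auto simp: cut_def)
    show "\<exists>u\<in>H - cut j. E x u = e" for j e
    proof -
      obtain w where w: "w \<in> T" "rk w = P j" using rk_onto by blast
      obtain u where u: "u \<in> H" "L w u" "E x u = e" using later_label[OF T_H[OF w(1)]] by blast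
      have uT: "u \<in> T" using T_up w u by blast
      then have "rk w < rk u" using rk w u by blast
      then have "u \<notin> cut j" using T_iff[OF u(1)] uT w(2) by (simp add: cut_def)
      then show ?thesis using u by blast
    qed
  qed
  define f where "f n = (SOME f. remb f x T x (tail (z n)))" for n
  have f: "remb (f n) x T x (tail (z n))" for n
    unfolding f_def using stable[of n] unfolding wle_def T_def by (rule someI_ex)
  have fH: "f n u \<in> H" "\<not> L (f n u) (z n)" "E x (f n u) = E x u" if "u \<in> T" for n u
    using f[of n] that by (auto simp: remb_def tail_def)
  \<comment> \<open>One stage: after the image of the class of rank \<open>i\<close> come two
    vertices for the new class \<open>2 * i\<close>, which may have two members, and one for the new
    class \<open>2 * i + 1\<close>, all before \<open>z N'\<close>.\<close>
  define Q where "Q i N N' g \<longleftrightarrow> (\<forall>t. g t \<in> H) \<and> (\<forall>u\<in>T. rk u = i \<longrightarrow> L (f N u) (g 0)) \<and> L (g 0) (g 1) \<and> L (g 1) (g 2) \<and>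
      E x (g 0) = lam (2 * i) \<and> E x (g 1) = lam (2 * i) \<and> E x (g 2) = lam (2 * i + 1) \<and> L (g 2) (z N')"
    for i N N' and g :: "nat \<Rightarrow> 'a"
  have Q_ex: "\<exists>N' g. Q i N N' g" for i N
  proof -
    \<comment> \<open>The image of a vertex of the next rank bounds the images of the whole class of
      rank \<open>i\<close>.\<close>
    obtain w where w: "w \<in> T" "rk w = Suc i" using rk_onto by blast
    obtain p0 where p0: "p0 \<in> H" "L (f N w) p0" "E x p0 = lam (2 * i)" using later_label[OF fH(1)[OF w(1)]] by blast
    obtain p1 where p1: "p1 \<in> H" "L p0 p1" "E x p1 = lam (2 * i)" using later_label[OF p0(1)] by blast
    obtain q where q: "q \<in> H" "L p1 q" "E x q = lam (2 * i + 1)" using later_label[OF p1(1)] by blast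
    obtain N' where N': "L q (z N')" using z_cofinal q(1) by blast
    define g where "g t = (if t = 0 then p0 else if t = 1 then p1 else q)" for t :: nat
    have "L (f N u) p0" if "u \<in> T" "rk u = i" for u
    proof -
      have "L u w" using rk that w by simp
      then have "L (f N u) (f N w)" using remb_L[OF f _ that(1) w(1)] by (auto simp: tail_def)
      then show ?thesis using L_trans p0(2) fH(1) that(1) w(1) by blast
    qed
    then have "Q i N N' g" unfolding Q_def g_def using p0 p1 q N' by simp
    then show ?thesis by blast
  qed
  have "\<exists>N. \<forall>i. (i = 0 \<longrightarrow> N i = k) \<and> (\<exists>g. Q i (N i) (N (Suc i)) g)"
    by (rule dependent_nat_choice[where P = "\<lambda>i N. i = 0 \<longrightarrow> N = k" and Q = "\<lambda>i N N'. \<exists>g. Q i N N' g"])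
      (use Q_ex in auto)
  then obtain N where N0: "N 0 = k" and "\<And>i. \<exists>g. Q i (N i) (N (Suc i)) g" by blast
  then have "\<exists>G. \<forall>i. Q i (N i) (N (Suc i)) (G i)" by (intro choice allI)
  then obtain G where G: "\<And>i. Q i (N i) (N (Suc i)) (G i)" by blast
  have GH: "G i t \<in> H" for i t using G[of i] by (simp add: Q_def)
  have G_less: "L (G i 0) (G i 1)" "L (G i 1) (G i 2)" "L (G i 0) (G i 2)" for i
    using G[of i] L_trans[of "G i 0" "G i 1" "G i 2"] GH by (auto simp: Q_def)
  have G_label: "E x (G i 0) = lam (2 * i)" "E x (G i 1) = lam (2 * i)" "E x (G i 2) = lam (2 * i + 1)" for i
    using G[of i] by (auto simp: Q_def)
  have f_G0: "L (f (N (rk u)) u) (G (rk u) 0)" if "u \<in> T" for u using G[of "rk u"] that by (simp add: Q_def)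
  have f_G: "L (f (N (rk u)) u) (G (rk u) t)" if "u \<in> T" "t \<in> {0, 1, 2}" for u t
    using f_G0[OF that(1)] that(2) G_less[of "rk u"] L_trans fH(1)[OF that(1)] GH by blast
  \<comment> \<open>The stages are disjoint intervals of the chain; comparing stages replaces
    comparing the different embeddings \<open>f (N i)\<close>.\<close>
  define st where "st i a \<longleftrightarrow> a \<in> H \<and> \<not> L a (z (N i)) \<and> L a (z (N (Suc i)))" for i a
  have st_G: "st i (G i t)" if t: "t \<in> {0, 1, 2}" for i t
  proof -
    obtain u where u: "u \<in> T" "rk u = i" using rk_onto by blast
    have "L (f (N i) u) (G i t)" using f_G[OF u(1) t] u(2) by simp
    then have "\<not> L (G i t) (z (N i))" using L_trans fH(1,2)[OF u(1)] GH by blast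
    moreover have "L (G i 2) (z (N (Suc i)))" using G[of i] by (simp add: Q_def)
    then have "L (G i t) (z (N (Suc i)))" using t G_less[of i] L_trans GH by blast
    ultimately show ?thesis using GH by (simp add: st_def)
  qed
  have st_f: "st (rk u) (f (N (rk u)) u)" if "u \<in> T" for u
    using fH[OF that] f_G0[OF that] st_G[of 0 "rk u"] L_trans GH unfolding st_def by blast
  have zN: "L (z (N i)) (z (N (Suc i)))" for i
    using st_G[of 0 i] le_L_trans[of "G i 0" "z (N i)" "z (N (Suc i))"] z_H unfolding st_def by blast
  have zN_mono: "\<not> L (z (N j)) (z (N i))" if "i \<le> j" for i j
    using that
  proof (induction j)
    case (Suc j)
    show ?case
    proof (cases "i = Suc j")
      case False
      then have "\<not> L (z (N j)) (z (N i))" using Suc by simp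
      then show ?thesis using zN[of j] L_trans z_H by blast
    qed (simp add: L_irrefl)
  qed (simp add: L_irrefl)
  have st_less: "L a b" if "i < j" "st i a" "st j b" for i j a b
  proof -
    have "L a (z (N j))" using L_le_trans[of a "z (N (Suc i))" "z (N j)"] zN_mono[of "Suc i" j] that z_H by (auto simp: st_def)
    then show ?thesis using L_le_trans[of a "z (N j)" b] that z_H by (simp add: st_def)
  qed
  have I_st: "L a b" if "a \<in> I" "st i b" for i a b
  proof -
    have "L a (z (N i))" using L_le_trans[of a "z k" "z (N i)"] zN_mono[of 0 i] N0 that z_H by (auto simp: I_def)
    then show ?thesis using L_le_trans[of a "z (N i)" b] that z_H I_H by (simp add: st_def)
  qed
  define g where "g j b = G (j div 2) (if odd j then 2 else of_bool b)" for j b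
  have g_st: "st (j div 2) (g j b)" for j b unfolding g_def by (rule st_G) auto
  define psi where "psi u = (if u \<in> T then f (N (rk u)) u else u)" for u
  have psi_st: "st (rk u) (psi u)" if "u \<in> T" for u using st_f[OF that] that by (simp add: psi_def)
  have I_T: "u \<notin> T" if "u \<in> I" for u using T_iff[OF I_H[OF that]] that by blast
  \<comment> \<open>Only even indices may be doubled: for odd \<open>j\<close> both values of
    \<open>g j\<close> are the same vertex.\<close>
  have emb: "embeds (ins.W S) (ins.F S) V E" if S: "\<And>j. j \<in> S \<Longrightarrow> even j" for S
  proof (rule ins.inserted_embeds[of psi g])
    show "psi u \<in> H" "E x (psi u) = E x u" if "u \<in> H" for u using that fH by (auto simp: psi_def)
    show "L u v \<and> L (psi u) (psi v) \<or> L v u \<and> L (psi v) (psi u) \<or> E u v = E (psi u) (psi v) \<and> (psi u = psi v \<longrightarrow> u = v)"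
      if uv: "u \<in> H" "v \<in> H" for u v
    proof -
      consider "u \<in> I" "v \<in> I" | "u \<in> I" "v \<in> T" | "u \<in> T" "v \<in> I" | "u \<in> T" "v \<in> T" "rk u < rk v"
        | "u \<in> T" "v \<in> T" "rk v < rk u" | "u \<in> T" "v \<in> T" "rk u = rk v"
        using T_iff[OF uv(1)] T_iff[OF uv(2)] by (metis nat_neq_iff)
      then show ?thesis
      proof cases
        case 1
        then show ?thesis using I_T by (simp add: psi_def)
      next
        case 2
        then show ?thesis using I_T L_I_T I_st[OF 2(1) psi_st[OF 2(2)]] by (simp add: psi_def)
      next
        case 3
        then show ?thesis using I_T L_I_T I_st[OF 3(2) psi_st[OF 3(1)]] by (simp add: psi_def)
      next
        case 4
        then show ?thesis using rk st_less psi_st by blast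
      next
        case 5
        then show ?thesis using rk st_less psi_st by blast
      next
        case 6
        then have "E u v = E (f (N (rk u)) u) (f (N (rk u)) v)" "f (N (rk u)) u = f (N (rk u)) v \<longrightarrow> u = v"
          using f[of "N (rk u)"] by (auto simp: remb_def inj_on_def)
        then show ?thesis using 6 by (simp add: psi_def)
      qed
    qed
    show "g i b \<in> H" for i b using GH by (simp add: g_def)
    show "E x (g i b) = lam i" for i b using G_label[of "i div 2"] by (cases "odd i") (auto simp: g_def elim: evenE oddE)
    show "L (psi u) (g i b)" if u: "u \<in> cut i" for u i b
    proof (cases "u \<in> I")
      case True
      then show ?thesis using I_st[OF True g_st] I_T by (simp add: psi_def)
    next
      case False
      then have uT: "u \<in> T" and le: "rk u \<le> i div 2" using u P_rk by (auto simp: cut_def)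
      show ?thesis
      proof (cases "rk u = i div 2")
        case True
        have "L (f (N (rk u)) u) (G (rk u) (if odd i then 2 else of_bool b))" by (rule f_G[OF uT]) auto
        then show ?thesis using uT True by (simp add: psi_def g_def)
      next
        case False
        then show ?thesis using st_less[OF _ psi_st[OF uT] g_st] le by simp
      qed
    qed
    show "L (g i b) (psi u)" if u: "u \<in> H" "u \<notin> cut i" for u i b
    proof -
      have uT: "u \<in> T" using u T_iff[OF u(1)] by (auto simp: cut_def)
      then have "i div 2 < rk u" using u(2) P_rk[of "rk u" i] by (auto simp: cut_def)
      then show ?thesis by (rule st_less[OF _ g_st psi_st[OF uT]])
    qed
    show "if True then L (g i b) (g j c) else L (g j c) (g i b)" if ij: "i < j" for i j b c
    proof (cases "i div 2 < j div 2")
      case True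
      then show ?thesis using st_less[OF True g_st g_st] by simp
    next
      case False
      then have "i div 2 = j div 2" "even i" "odd j" using ij by presburger+
      then show ?thesis using G_less[of "j div 2"] by (cases b) (auto simp: g_def)
    qed
    show "L (g i False) (g i True) \<or> L (g i True) (g i False)" if "i \<in> S" for i
      using S[OF that] G_less by (simp add: g_def)
  qed
  define pos where "pos p = (case p of Inl u \<Rightarrow> 3 * rk u | Inr (j, b) \<Rightarrow> P j)" for p :: "'a + nat \<times> bool"
  have pos_simps: "pos (Inl u) = 3 * rk u" "pos (Inr (j, b)) = P j" for u j b by (simp_all add: pos_def)
  obtain y0 where y0: "y0 \<in> T" "rk y0 = 0" using rk_onto by blast
  have run: "Ks (lz (ins.F S) (Inl x) True) (ins.W S - {Inl x}) (Inl y0) (Suc n) =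
      {a \<in> Inl ` T \<union> {p \<in> ins.W S. \<not> isl p}. pos a = Suc n}" for S n
  proof -
    let ?D = "Inl ` T \<union> {p \<in> ins.W S. \<not> isl p}" and ?U = "ins.W S - {Inl x}" and ?R = "lz (ins.F S) (Inl x) True"
    have TV: "u \<in> V" "u \<noteq> x" if "u \<in> T" for u using T_H[OF that] by (auto simp: H_def)
    have D: "(\<exists>u. a = Inl u \<and> u \<in> T) \<or> (\<exists>i b. a = Inr (i, b) \<and> Inr (i, b) \<in> ins.W S)" if "a \<in> ?D" for a
      using that by (cases a) auto
    have C: "\<exists>u. c = Inl u \<and> u \<in> I" if "c \<in> ?U - ?D" for c
    proof (cases c)
      case (Inl u)
      then have "u \<in> H" "u \<notin> T" using that by (auto simp: ins.W_Inl H_def)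
      then show ?thesis using Inl T_iff by blast
    qed (use that in auto)
    \<comment> \<open>The run contains all of \<open>T\<close>, so the old vertices outside it lie
      in \<open>I\<close> and precede it; the conditions of \<open>Ks_run\<close> on outside
      vertices hold vacuously.\<close>
    have vac: "\<not> ?R a c" if a: "a \<in> ?D" and c: "c \<in> ?U - ?D" for a c
    proof -
      obtain w where w: "c = Inl w" "w \<in> I" using C[OF c] by blast
      from D[OF a] show ?thesis
      proof (elim disjE exE conjE)
        fix u assume u: "a = Inl u" "u \<in> T"
        have "\<not> L u w" using L_asym[OF L_I_T[OF w(2) u(2)]] .
        then show ?thesis using u w T_H I_H ins.lz_Inl_Inl[of u w S True] by simp
      next
        fix i b assume i: "a = Inr (i, b)" "Inr (i, b) \<in> ins.W S"
        show ?thesis using i w I_H ins.lz_Inr_Inl[of w i b S True] by (simp add: cut_def)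
      qed
    qed
    have DD: "?R a b \<longleftrightarrow> even (pos a) \<noteq> even (pos b) \<and> pos a < pos b" if a: "a \<in> ?D" and b: "b \<in> ?D" for a b
      using D[OF a] D[OF b]
    proof (elim disjE exE conjE)
      fix u v assume *: "a = Inl u" "u \<in> T" "b = Inl v" "v \<in> T"
      show ?thesis using * T_H ins.lz_Inl_Inl[of u v S True] rk rk_label by (auto simp: pos_simps)
    next
      fix u i b' assume *: "a = Inl u" "u \<in> T" "b = Inr (i, b')" "Inr (i, b') \<in> ins.W S"
      have "u \<notin> I" using * I_T by blast
      then show ?thesis using * T_H ins.lz_Inl_Inr[of u i b' S True] rk_label by (auto simp: pos_simps cut_def lam_def)
    next
      fix u i b' assume *: "a = Inr (i, b')" "Inr (i, b') \<in> ins.W S" "b = Inl u" "u \<in> T"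
      have "u \<notin> I" using * I_T by blast
      then have "?R a b \<longleftrightarrow> even (rk u) \<noteq> even (P i) \<and> \<not> 3 * rk u < P i"
        using * T_H ins.lz_Inr_Inl[of u i b' S True] rk_label by (auto simp: cut_def lam_def)
      moreover have "P i \<noteq> 3 * rk u" if "even (rk u) \<noteq> even (P i)" using that by auto
      ultimately show ?thesis using * by (auto simp: pos_simps)
    next
      fix i b' j c' assume *: "a = Inr (i, b')" "Inr (i, b') \<in> ins.W S" "b = Inr (j, c')" "Inr (j, c') \<in> ins.W S"
      show ?thesis using * ins.lz_Inr_Inr[of i b' S j c'] by (auto simp: pos_simps lam_def P_less_iff)
    qed
    have ne: "\<exists>a\<in>?D. pos a = p" for p
    proof -
      consider i where "p = 3 * i" | i where "p = 3 * i + 1" | i where "p = 3 * i + 2"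
      proof -
        have "p = 3 * (p div 3) \<or> p = 3 * (p div 3) + 1 \<or> p = 3 * (p div 3) + 2" by presburger
        then show thesis using that by blast
      qed
      then show ?thesis
      proof cases
        case 1
        obtain u where "u \<in> T" "rk u = i" using rk_onto by blast
        then show ?thesis using 1 by (intro bexI[of _ "Inl u"]) (auto simp: pos_simps)
      next
        case 2
        then show ?thesis by (intro bexI[of _ "Inr (2 * i, False)"]) (auto simp: pos_simps P_even ins.W_Inr)
      next
        case 3
        then show ?thesis by (intro bexI[of _ "Inr (2 * i + 1, False)"]) (simp only: pos_simps P_even, simp add: ins.W_Inr)
      qed
    qed
    show ?thesis
    proof (rule Ks_run[where D = ?D and pos = pos, OF _ ne DD])
      show "?D \<subseteq> ?U" using TV by (auto simp: ins.W_Inl)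
      show "Inl y0 \<in> ?D" "pos (Inl y0) = 0" using y0 by (auto simp: pos_simps)
    qed (use vac in blast)+
  qed
  have slot: "{a \<in> Inl ` T \<union> {p \<in> ins.W S. \<not> isl p}. pos a = Suc (3 * i)} = {p \<in> ins.W S. \<exists>b. p = Inr (2 * i, b)}" for S i
  proof -
    have "pos a = Suc (3 * i) \<longleftrightarrow> (\<exists>b. a = Inr (2 * i, b))" for a
    proof (cases a)
      case (Inl u)
      have "3 * rk u \<noteq> Suc (3 * i)" by presburger
      then show ?thesis using Inl by (simp add: pos_simps)
    next
      case (Inr jb)
      then obtain j b where jb: "a = Inr (j, b)" by (cases jb) auto
      then show ?thesis by (simp add: pos_simps P_eq)
    qed
    then show ?thesis by auto
  qed
  show ?thesis
  \<comment> \<open>Membership of \<open>i\<close> is read at position \<open>3 * i + 1\<close>, the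
    place of the new class \<open>2 * i\<close>.\<close>
  proof (rule ins.many_twinsI[of "\<lambda>A. (\<lambda>i. 2 * i) ` A" "\<lambda>X. {i. Suc (3 * i) \<in> X}"])
    fix A :: "nat set"
    let ?S = "(\<lambda>i. 2 * i) ` A"
    show "embeds (ins.W ?S) (ins.F ?S) V E" by (rule emb) auto
    have "Suc (3 * i) \<in> spec (ins.W ?S) (ins.F ?S) (Inl x) True (Inl y0) \<longleftrightarrow> i \<in> A" for i
      unfolding spec_def mem_Collect_eq[of "Suc (3 * i)"] run slot ins.card_inserted_class by (rule inj_image_mem_iff) (simp add: inj_def)
    then have "A = {i. Suc (3 * i) \<in> spec (ins.W ?S) (ins.F ?S) (Inl x) True (Inl y0)}" by (simp only: Collect_mem_eq)
    then show "\<exists>v\<in>ins.W ?S - {Inl x}. \<exists>e. A = {i. Suc (3 * i) \<in> spec (ins.W ?S) (ins.F ?S) (Inl x) e v}"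
      by - (rule bexI[of _ "Inl y0"], rule exI[of _ True], assumption, use T_H[OF y0(1)] in \<open>simp add: ins.W_Inl H_def\<close>)
  qed
qed

text \<open>Without descending sequences there are a least class and successor classes. A vertex
  missed by iterating successors would bound an ascending sequence, so the classes have order type
  omega; by \<open>L_mid\<close> neighbours differ in colour.\<close>

lemma tail_ranking:
  assumes noD: "\<And>y :: nat \<Rightarrow> 'a. (\<And>n. y n \<in> T) \<Longrightarrow> \<exists>n. \<not> L (y (Suc n)) (y n)"
    and noB: "\<And>(y :: nat \<Rightarrow> 'a) t. (\<And>n. y n \<in> T) \<Longrightarrow> (\<And>n. L (y n) (y (Suc n))) \<Longrightarrow> t \<in> H \<Longrightarrow> \<exists>n. \<not> L (y n) t"
  shows "\<exists>rk e0. (\<forall>u\<in>T. \<forall>v\<in>T. L u v \<longleftrightarrow> rk u < (rk v :: nat)) \<and> (\<forall>n. \<exists>u\<in>T. rk u = n) \<and>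
    (\<forall>u\<in>T. E x u \<longleftrightarrow> (even (rk u) \<longleftrightarrow> e0))"
proof -
  have "wf {(a, b). a \<in> T \<and> b \<in> T \<and> L a b}"
    unfolding wf_iff_no_infinite_down_chain
  proof
    assume "\<exists>y. \<forall>n. (y (Suc n), y n) \<in> {(a, b). a \<in> T \<and> b \<in> T \<and> L a b}"
    then obtain y where "\<And>n. y n \<in> T" "\<And>n. L (y (Suc n)) (y n)" by auto
    then show False using noD by blast
  qed
  then have least: "\<exists>v\<in>S. \<forall>u\<in>S. \<not> L u v" if "S \<subseteq> T" "S \<noteq> {}" for S
    using that by (elim wfE_min') blast+
  have "\<exists>y. \<forall>n. (y n \<in> T \<and> (n = 0 \<longrightarrow> (\<forall>u\<in>T. \<not> L u (y n)))) \<and> (L (y n) (y (Suc n)) \<and> (\<forall>u\<in>T. L (y n) u \<longrightarrow> \<not> L u (y (Suc n))))"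
  proof (rule dependent_nat_choice[where P = "\<lambda>n v. v \<in> T \<and> (n = 0 \<longrightarrow> (\<forall>u\<in>T. \<not> L u v))"
        and Q = "\<lambda>n v w. L v w \<and> (\<forall>u\<in>T. L v u \<longrightarrow> \<not> L u w)"])
    have "T \<noteq> {}" using z_T by blast
    then show "\<exists>v. v \<in> T \<and> (0 = (0 :: nat) \<longrightarrow> (\<forall>u\<in>T. \<not> L u v))" using least[of T] by blast
    fix v and n :: nat assume "v \<in> T \<and> (n = 0 \<longrightarrow> (\<forall>u\<in>T. \<not> L u v))"
    then have v: "v \<in> T" ..
    obtain w where w: "w \<in> H" "L v w" using later_label[OF T_H[OF v]] by blast
    have "{u\<in>T. L v u} \<noteq> {}" using T_up[OF v w(2,1)] w by blast
    then show "\<exists>w. (w \<in> T \<and> (Suc n = 0 \<longrightarrow> (\<forall>u\<in>T. \<not> L u w))) \<and> (L v w \<and> (\<forall>u\<in>T. L v u \<longrightarrow> \<not> L u w))"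
      using least[of "{u\<in>T. L v u}"] by blast
  qed
  then obtain y where y: "\<And>n. y n \<in> T" "\<And>u. u \<in> T \<Longrightarrow> \<not> L u (y 0)" "\<And>n. L (y n) (y (Suc n))"
    "\<And>n u. u \<in> T \<Longrightarrow> L (y n) u \<Longrightarrow> \<not> L u (y (Suc n))" by blast
  have yH: "y n \<in> H" for n using y(1) T_H by blast
  have y_mono: "L (y m) (y n)" if "m < n" for m n
    using that
  proof (induction n)
    case (Suc n)
    then show ?case using y(3)[of n] L_trans[of "y m" "y n" "y (Suc n)"] yH by (cases "m = n") auto
  qed simp
  have y_iff: "L (y m) (y n) \<longleftrightarrow> m < n" for m n
    using y_mono[of m n] y_mono[of n m] L_asym L_irrefl by (metis nat_neq_iff)
  have ex: "\<exists>n. \<not> L u (y n) \<and> \<not> L (y n) u" if u: "u \<in> T" for u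
  proof (rule ccontr)
    assume no: "\<not> ?thesis"
    have "L (y n) u" for n
    proof (induction n)
      case 0
      then show ?case using no y(2)[OF u] by blast
    next
      case (Suc n)
      then show ?case using no y(4)[OF u Suc] by blast
    qed
    then show False using noB[of y u] y(1,3) T_H[OF u] by blast
  qed
  define rk where "rk u = (SOME n. \<not> L u (y n) \<and> \<not> L (y n) u)" for u
  have rk: "\<not> L u (y (rk u))" "\<not> L (y (rk u)) u" if "u \<in> T" for u
    using someI_ex[OF ex[OF that]] unfolding rk_def by blast+
  have 1: "L u v \<longleftrightarrow> rk u < rk v" if uv: "u \<in> T" "v \<in> T" for u v
  proof -
    have "L u v \<longleftrightarrow> L (y (rk u)) (y (rk v))"
    proof
      assume "L u v"
      then have "L (y (rk u)) v" using L_negtrans[of u v "y (rk u)"] rk[OF uv(1)] T_H uv by blast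
      then show "L (y (rk u)) (y (rk v))" using L_negtrans[of "y (rk u)" v "y (rk v)"] rk[OF uv(2)] T_H uv yH by blast
    next
      assume "L (y (rk u)) (y (rk v))"
      then have "L u (y (rk v))" using L_negtrans[of "y (rk u)" "y (rk v)" u] rk[OF uv(1)] yH by blast
      then show "L u v" using L_negtrans[of u "y (rk v)" v] rk[OF uv(2)] yH T_H uv by blast
    qed
    then show ?thesis using y_iff by simp
  qed
  have 2: "rk (y n) = n" for n using rk[OF y(1), of n] y_iff by (metis nat_neq_iff)
  have 3: "E x (y (Suc n)) \<noteq> E x (y n)" for n
  proof
    assume "E x (y (Suc n)) = E x (y n)"
    then obtain w where w: "w \<in> H" "L (y n) w" "L w (y (Suc n))" using L_mid[OF y(3), of n] by auto
    have "w \<in> T" using T_up[OF y(1) w(2,1)] .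
    then show False using y(4) w by blast
  qed
  have 4: "E x (y n) \<longleftrightarrow> (even n \<longleftrightarrow> E x (y 0))" for n
  proof (induction n)
    case (Suc n)
    then show ?case using 3[of n] by auto
  qed simp
  have 5: "E x u \<longleftrightarrow> (even (rk u) \<longleftrightarrow> E x (y 0))" if u: "u \<in> T" for u
  proof -
    have "E x u = E x (y (rk u))"
    proof (rule ccontr)
      assume ne: "E x u \<noteq> E x (y (rk u))"
      then have "L u (y (rk u)) \<or> L (y (rk u)) u"
        using lt0_total[OF ne] L_iff_lt0[OF ne] L_iff_lt0[OF ne[symmetric]] by blast
      then show False using rk[OF u] by blast
    qed
    then show ?thesis by (simp only: 4[of "rk u"])
  qed
  show ?thesis
    by (rule exI[of _ rk], rule exI[of _ "E x (y 0)"], intro conjI ballI allI)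
      (rule 1, assumption, assumption, rule bexI, rule 2, rule y(1), rule 5, assumption)
qed

lemma stable_tail_many: many_twins
proof -
  show ?thesis
  proof (cases "\<exists>y :: nat \<Rightarrow> 'a. (\<forall>n. y n \<in> T) \<and> (\<forall>n. L (y (Suc n)) (y n))")
    case True
    then obtain y :: "nat \<Rightarrow> 'a" where "\<forall>n. y n \<in> T" "\<forall>n. L (y (Suc n)) (y n)" by (elim exE conjE)
    note y = this[rule_format]
    have yH: "y n \<in> H" for n using y(1) T_H by blast
    \<comment> \<open>A descending sequence is bounded by any vertex after its first term.\<close>
    obtain t where t: "t \<in> H" "L (y 0) t" using later_label[OF yH] by blast
    have "L (y n) t" for n
    proof (induction n)
      case (Suc n)
      show ?case using L_trans[OF y(2) Suc yH yH] .
    qed (rule t)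
    then show ?thesis using y t(1) bounded_sequence_many[of y False t] by simp
  next
    case noD: False
    show ?thesis
    proof (cases "\<exists>(y :: nat \<Rightarrow> 'a) t. (\<forall>n. y n \<in> T) \<and> (\<forall>n. L (y n) (y (Suc n))) \<and> t \<in> H \<and> (\<forall>n. L (y n) t)")
      case True
      then obtain y :: "nat \<Rightarrow> 'a" and t where "\<forall>n. y n \<in> T" "\<forall>n. L (y n) (y (Suc n))" "t \<in> H" "\<forall>n. L (y n) t"
        by (elim exE conjE)
      then show ?thesis using bounded_sequence_many[of y True t] by simp
    next
      case noB: False
      have "\<exists>rk e0. (\<forall>u\<in>T. \<forall>v\<in>T. L u v \<longleftrightarrow> rk u < (rk v :: nat)) \<and> (\<forall>n. \<exists>u\<in>T. rk u = n) \<and>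
          (\<forall>u\<in>T. E x u \<longleftrightarrow> (even (rk u) \<longleftrightarrow> e0))"
      proof (rule tail_ranking)
        fix y :: "nat \<Rightarrow> 'a" assume "\<And>n. y n \<in> T"
        then show "\<exists>n. \<not> L (y (Suc n)) (y n)" using noD by blast
      next
        fix y :: "nat \<Rightarrow> 'a" and t assume "\<And>n. y n \<in> T" "\<And>n. L (y n) (y (Suc n))" "t \<in> H"
        then show "\<exists>n. \<not> L (y n) t" using noB by blast
      qed
      then obtain rk :: "'a \<Rightarrow> nat" and e0 where
        "\<forall>u\<in>T. \<forall>v\<in>T. L u v \<longleftrightarrow> rk u < rk v" "\<forall>n. \<exists>u\<in>T. rk u = n" "\<forall>u\<in>T. E x u \<longleftrightarrow> (even (rk u) \<longleftrightarrow> e0)"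
        by (elim exE conjE)
      note r = this[rule_format]
      show ?thesis by (rule ranked_many[where rk = rk, OF r])
    qed
  qed
qed

end

lemma (in connected_cograph) connected_cograph_many:
  assumes "infinite V"
  shows many_twins
proof -
  have "H \<noteq> {}" unfolding H_def by (rule infinite_imp_nonempty[OF infinite_remove[OF assms]])
  from cofinal_sequence[OF this] obtain z :: "nat \<Rightarrow> 'a" where
    "\<forall>n. z n \<in> H" "\<forall>n. L (z n) (z (Suc n))" "\<forall>u\<in>H. \<exists>n. L u (z n)" by (elim exE conjE)
  note z = this[rule_format]
  obtain k where k: "\<forall>n. wle x (tail (z k)) x (tail (z n))" using exists_stable_tail[where z = z, OF z(1,2)] by (elim exE)
  interpret stable_tail V E x z k by unfold_locales (rule z, rule z, assumption, rule k[rule_format])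
  show ?thesis by (rule stable_tail_many)
qed

theorem theorem2p5:
  fixes V :: "'a set" and E :: "'a \<Rightarrow> 'a \<Rightarrow> bool"
  assumes "is_graph V E" and "countable V" and "infinite V"
    and "cograph V E"
    and "graph_connected V E" and "graph_connected V (compl_graph V E)"
  shows "\<exists>(GV :: nat set \<Rightarrow> nat set) (GE :: nat set \<Rightarrow> nat \<Rightarrow> nat \<Rightarrow> bool).
           (\<forall>A. is_graph (GV A) (GE A) \<and> equimorphic (GV A) (GE A) V E
                \<and> graph_connected (GV A) (GE A)
                \<and> graph_connected (GV A) (compl_graph (GV A) (GE A)))
         \<and> (\<forall>A B. A \<noteq> B \<longrightarrow> \<not> graph_iso (GV A) (GE A) (GV B) (GE B))"
proof -
  obtain x where x: "x \<in> V" using assms(5) unfolding graph_connected_def by blast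
  interpret connected_cograph V E x
    using assms x by unfold_locales
  show ?thesis using connected_cograph_many[OF assms(3)] unfolding many_twins_def .
qed

end
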